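(* Let $(M,g)$ be a Riemannian manifold of dimension $n\ge2$, let $STM$ be its unit sphere bundle equipped with its canonical contact structure and with the canonical lift $\bar g$ of the metric $g$. Then the contact Riemannian curl of $\bar g$ on $STM$ is identically zero, i.e. $A_{\bar g,\Theta}\equiv0$, where $\Theta$ is the contact tensor field of $STM$.
   Context: All objects are smooth; summation over repeated indices is understood. Sphere bundle. Let $(x^1,\dots,x^n)$ be local coordinates on $M$ and $(x^i,y^i)$ the induced coordinates on $TM$. $STM\subset TM$ is the hypersurface $g_{ij}(x)y^iy^j=1$, of dimension $2n-1=2\ell+1$ with $\ell=n-1$. Its contact structure is $\ker\bar\theta$, where $\bar\theta$ is the restriction to $STM$ of the Liouville 1-form $\theta=g_{ij}y^j\,dx^i$ on $TM$. The canonical lift $\bar g$ is the restriction to $STM$ of the metric $g_{ij}\,dx^i dx^j+g_{ij}\,\delta y^i\,\delta y^j$ on $TM$, where $\delta y^i=dy^i+\Gamma^i_{jk}y^j dx^k$ and $\Gamma^i_{jk}$ are the Christoffel symbols of $g$ (the Sasaki metric). Contact Riemannian curl. On a contact manifold $N$ of dimension $2\ell+1$ with (local) contact form $\theta$, put $\mathrm{vol}:=\theta\wedge(d\theta)^\ell$, which is nowhere zero. For real $\lambda$, a weighted density of weight $\lambda$ is a section of $(\Lambda^{2\ell+1}T^*N)^{\otimes\lambda}$, locally $\phi\,\omega^\lambda$ with $\omega$ the coordinate volume form. The contact tensor field is $\Theta:=\theta\otimes\mathrm{vol}^{-\frac{1}{\ell+1}}$, with components $\Theta_\alpha$. The covariant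 derivative $\nabla$ of the Levi-Civita connection of a metric $h$ on $N$, with Christoffel symbols $\Gamma_{\alpha\beta}^\gamma$, acts by $\nabla_\alpha\beta_\gamma=\partial_\alpha\beta_\gamma-\Gamma_{\alpha\gamma}^\delta\beta_\delta$ on 1-forms and $\nabla_\alpha(\phi\,\omega^\lambda)=(\partial_\alpha\phi-\lambda\Gamma_{\alpha\gamma}^\gamma\phi)\,\omega^\lambda$ on densities, and is extended by the Leibniz rule. Define the $-\frac1{\ell+1}$-density $A_{h,\Theta}:=h^{\alpha\beta}\nabla_\alpha\Theta_\beta$. The contact Riemannian curl of $h$ is the contact vector field $X$ (vector field whose flow preserves $\ker\theta$) uniquely determined by $\theta(X)\,\mathrm{vol}^{-\frac{1}{\ell+1}}=A_{h,\Theta}$; it vanishes if and only if $A_{h,\Theta}$ vanishes. *)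

theory Defs
  imports "HOL-Analysis.Analysis" "HOL-Combinatorics.Permutations"
begin

section \<open>Smooth maps between open subsets of Euclidean spaces\<close>

text \<open>The set S is meant to be open. In finite dimensions a map is of class C(k+1) on S iff it is
  differentiable on S and all its directional derivatives are of class C(k).\<close>

primrec Ck_on :: "nat \<Rightarrow> 'a::euclidean_space set \<Rightarrow> ('a \<Rightarrow> 'b::euclidean_space) \<Rightarrow> bool" where
  "Ck_on 0 S f \<longleftrightarrow> continuous_on S f"
| "Ck_on (Suc k) S f \<longleftrightarrow> (\<forall>x\<in>S. f differentiable at x) \<and>
     (\<forall>v. Ck_on k S (\<lambda>x. frechet_derivative f (at x) v))"

definition smooth_on :: "'a::euclidean_space set \<Rightarrow> ('a \<Rightarrow> 'b::euclidean_space) \<Rightarrow> bool" where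
  "smooth_on S f \<longleftrightarrow> (\<forall>k. Ck_on k S f)"


section \<open>Manifolds, tangent spaces, tangent bundle\<close>

text \<open>A chart is a pair of its domain and its coordinate map; the values of the coordinate map
  outside the domain are irrelevant.\<close>

type_synonym ('a, 'e) chart = "'a set \<times> ('a \<Rightarrow> 'e)"

definition chart_image :: "('a, 'e) chart \<Rightarrow> 'e set" where
  "chart_image c = snd c ` fst c"

definition chart_inv :: "('a, 'e) chart \<Rightarrow> 'e \<Rightarrow> 'a" where
  "chart_inv c = inv_into (fst c) (snd c)"

definition transition :: "('a, 'e) chart \<Rightarrow> ('a, 'f) chart \<Rightarrow> 'e \<Rightarrow> 'f" where
  "transition c d = snd d \<circ> chart_inv c"

definition smooth_atlas :: "'a set \<Rightarrow> ('a, 'e::euclidean_space) chart set \<Rightarrow> bool" where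
  "smooth_atlas M \<A> \<longleftrightarrow>
     (\<Union>c\<in>\<A>. fst c) = M \<and>
     (\<forall>c\<in>\<A>. inj_on (snd c) (fst c) \<and> open (chart_image c)) \<and>
     (\<forall>c\<in>\<A>. \<forall>d\<in>\<A>. open (snd c ` (fst c \<inter> fst d)) \<and>
        smooth_on (snd c ` (fst c \<inter> fst d)) (transition c d))"

definition atlas_topology :: "'a set \<Rightarrow> ('a, 'e::euclidean_space) chart set \<Rightarrow> 'a topology" where
  "atlas_topology M \<A> = topology (\<lambda>W. W \<subseteq> M \<and> (\<forall>c\<in>\<A>. open (snd c ` (W \<inter> fst c))))"

definition smooth_manifold :: "'a set \<Rightarrow> ('a, 'e::euclidean_space) chart set \<Rightarrow> bool" where
  "smooth_manifold M \<A> \<longleftrightarrow> smooth_atlas M \<A> \<and>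
     Hausdorff_space (atlas_topology M \<A>) \<and> second_countable (atlas_topology M \<A>)"

text \<open>A tangent vector at p is the family of its components in all the charts around p, which
  transform by the derivatives of the transition maps. The components in other charts are set
  to 0, so that two tangent vectors are equal iff their components agree.\<close>

definition tangent_space ::
    "('a, 'e::euclidean_space) chart set \<Rightarrow> 'a \<Rightarrow> (('a, 'e) chart \<Rightarrow> 'e) set" where
  "tangent_space \<A> p = {v.
     (\<forall>c. \<not> (c \<in> \<A> \<and> p \<in> fst c) \<longrightarrow> v c = 0) \<and>
     (\<forall>c\<in>\<A>. \<forall>d\<in>\<A>. p \<in> fst c \<inter> fst d \<longrightarrow>
        v d = frechet_derivative (transition c d) (at (snd c p)) (v c))}"

type_synonym ('a, 'e) tangent_point = "'a \<times> (('a, 'e) chart \<Rightarrow> 'e)"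

definition tangent_bundle ::
    "'a set \<Rightarrow> ('a, 'e::euclidean_space) chart set \<Rightarrow> ('a, 'e) tangent_point set" where
  "tangent_bundle M \<A> = Sigma M (tangent_space \<A>)"

text \<open>The chart (x, y) of the tangent bundle that is induced by a chart x of M.\<close>

definition bundle_chart ::
    "'a set \<Rightarrow> ('a, 'e::euclidean_space) chart set \<Rightarrow> ('a, 'e) chart \<Rightarrow>
     (('a, 'e) tangent_point, 'e \<times> 'e) chart" where
  "bundle_chart M \<A> c =
     ({z \<in> tangent_bundle M \<A>. fst z \<in> fst c}, \<lambda>z. (snd c (fst z), snd z c))"

definition bundle_atlas ::
    "'a set \<Rightarrow> ('a, 'e::euclidean_space) chart set \<Rightarrow>
     (('a, 'e) tangent_point, 'e \<times> 'e) chart set" where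
  "bundle_atlas M \<A> = bundle_chart M \<A> ` \<A>"

text \<open>The charts of an embedded submanifold S of B: homeomorphisms from open subsets W of S (in the
  subspace topology) onto open subsets of a Euclidean space, whose inverses are immersions into B.
  Only charts over a single chart domain of B are used; their domains already cover S and form a
  basis of its topology.\<close>

definition submanifold_atlas ::
    "'b set \<Rightarrow> ('b, 'e::euclidean_space) chart set \<Rightarrow> 'b set \<Rightarrow>
     ('b, 'f::euclidean_space) chart set" where
  "submanifold_atlas B \<B> S = {\<kappa>.
     openin (subtopology (atlas_topology B \<B>) S) (fst \<kappa>) \<and>
     open (chart_image \<kappa>) \<and>
     homeomorphic_map (subtopology (atlas_topology B \<B>) (fst \<kappa>))
       (top_of_set (chart_image \<kappa>)) (snd \<kappa>) \<and>
     (\<forall>b\<in>\<B>. smooth_on (snd \<kappa> ` (fst \<kappa> \<inter> fst b)) (transition \<kappa> b) \<and>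
        (\<forall>u \<in> snd \<kappa> ` (fst \<kappa> \<inter> fst b). inj (frechet_derivative (transition \<kappa> b) (at u)))) \<and>
     (\<exists>b\<in>\<B>. fst \<kappa> \<subseteq> fst b)}"


section \<open>Riemannian metrics and covariant derivatives in coordinates\<close>

definition partial :: "'n::finite \<Rightarrow> (real^'n \<Rightarrow> real) \<Rightarrow> real^'n \<Rightarrow> real" where
  "partial i f x = frechet_derivative f (at x) (axis i 1)"

text \<open>A covariant 2-tensor field is given by its matrix of components in each chart, as a
  function of the coordinates.\<close>

definition riemannian_metric ::
    "('a, real^'n) chart set \<Rightarrow> (('a, real^'n) chart \<Rightarrow> real^'n \<Rightarrow> real^'n^'n) \<Rightarrow> bool" where
  "riemannian_metric \<A> g \<longleftrightarrow>
     (\<forall>c\<in>\<A>. smooth_on (chart_image c) (g c) \<and>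
        (\<forall>x \<in> chart_image c. transpose (g c x) = g c x \<and>
           (\<forall>v. v \<noteq> 0 \<longrightarrow> v \<bullet> (g c x *v v) > 0))) \<and>
     (\<forall>c\<in>\<A>. \<forall>d\<in>\<A>. \<forall>x \<in> snd c ` (fst c \<inter> fst d).
        g c x = transpose (jacobian (transition c d) (at x)) ** g d (transition c d x) **
                jacobian (transition c d) (at x))"

text \<open>The first index of the Christoffel symbol is the upper one.\<close>

definition christoffel ::
    "(real^'n \<Rightarrow> real^'n^'n) \<Rightarrow> real^'n \<Rightarrow> 'n \<Rightarrow> 'n \<Rightarrow> 'n \<Rightarrow> real" where
  "christoffel G x i j k = (1/2) * (\<Sum>l\<in>UNIV. matrix_inv (G x) $ i $ l *
     (partial j (\<lambda>z. G z $ l $ k) x + partial k (\<lambda>z. G z $ l $ j) x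
      - partial l (\<lambda>z. G z $ j $ k) x))"

definition cov_deriv_form ::
    "(real^'m \<Rightarrow> real^'m^'m) \<Rightarrow> (real^'m \<Rightarrow> real^'m) \<Rightarrow> real^'m \<Rightarrow> 'm \<Rightarrow> 'm \<Rightarrow> real" where
  "cov_deriv_form h \<beta> u \<alpha> \<gamma> =
     partial \<alpha> (\<lambda>z. \<beta> z $ \<gamma>) u - (\<Sum>\<delta>\<in>UNIV. christoffel h u \<delta> \<alpha> \<gamma> * \<beta> u $ \<delta>)"

definition cov_deriv_density ::
    "(real^'m \<Rightarrow> real^'m^'m) \<Rightarrow> real \<Rightarrow> (real^'m \<Rightarrow> real) \<Rightarrow> real^'m \<Rightarrow> 'm \<Rightarrow> real" where
  "cov_deriv_density h lam \<phi> u \<alpha> =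
     partial \<alpha> \<phi> u - lam * (\<Sum>\<gamma>\<in>UNIV. christoffel h u \<gamma> \<alpha> \<gamma>) * \<phi> u"

text \<open>A 1-form with values in the densities of weight lam has the components T $ \<beta> with respect to
  the tensor product of the coordinate 1-form with index \<beta> and the lam-th power of the coordinate
  volume form. Its covariant derivative is determined by the two above and the Leibniz rule, see
  the lemma below.\<close>

definition cov_deriv_weighted_form ::
    "(real^'m \<Rightarrow> real^'m^'m) \<Rightarrow> real \<Rightarrow> (real^'m \<Rightarrow> real^'m) \<Rightarrow> real^'m \<Rightarrow> 'm \<Rightarrow> 'm \<Rightarrow> real" where
  "cov_deriv_weighted_form h lam T u \<alpha> \<beta> =
     partial \<alpha> (\<lambda>z. T z $ \<beta>) u - (\<Sum>\<delta>\<in>UNIV. christoffel h u \<delta> \<alpha> \<beta> * T u $ \<delta>)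
     - lam * (\<Sum>\<gamma>\<in>UNIV. christoffel h u \<gamma> \<alpha> \<gamma>) * T u $ \<beta>"

lemma cov_deriv_weighted_form_Leibniz:
  assumes "\<phi> differentiable at u" and "(\<lambda>z. \<beta> z $ \<gamma>) differentiable at u"
  shows "cov_deriv_weighted_form h lam (\<lambda>z. \<phi> z *\<^sub>R \<beta> z) u \<alpha> \<gamma> =
    \<phi> u * cov_deriv_form h \<beta> u \<alpha> \<gamma> + cov_deriv_density h lam \<phi> u \<alpha> * \<beta> u $ \<gamma>"
proof -
  have "((\<lambda>z. \<phi> z * \<beta> z $ \<gamma>) has_derivative
      (\<lambda>v. \<phi> u * frechet_derivative (\<lambda>z. \<beta> z $ \<gamma>) (at u) v
         + frechet_derivative \<phi> (at u) v * \<beta> u $ \<gamma>)) (at u)"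
    by (rule has_derivative_mult) (use assms frechet_derivative_works in blast)+
  from frechet_derivative_at[OF this, symmetric]
  show ?thesis
    by (simp add: cov_deriv_weighted_form_def cov_deriv_form_def cov_deriv_density_def partial_def
        algebra_simps sum_distrib_left)
qed


section \<open>Contact forms and the contact Riemannian curl\<close>

text \<open>A k-form on a vector space is a function of lists of k vectors.\<close>

definition wedge ::
    "nat \<Rightarrow> nat \<Rightarrow> ('v list \<Rightarrow> real) \<Rightarrow> ('v list \<Rightarrow> real) \<Rightarrow> 'v list \<Rightarrow> real" where
  "wedge k l \<alpha> \<beta> vs =
     (\<Sum>\<sigma> | \<sigma> permutes {..<k + l}. of_int (sign \<sigma>) *
        \<alpha> (map (\<lambda>i. vs ! \<sigma> i) [0..<k]) * \<beta> (map (\<lambda>i. vs ! \<sigma> i) [k..<k + l]))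
     / (fact k * fact l)"

primrec wedge_power2 :: "nat \<Rightarrow> ('v list \<Rightarrow> real) \<Rightarrow> 'v list \<Rightarrow> real" where
  "wedge_power2 0 \<omega> = (\<lambda>vs. 1)"
| "wedge_power2 (Suc j) \<omega> = wedge 2 (2 * j) \<omega> (wedge_power2 j \<omega>)"

definition form_at :: "(real^'m \<Rightarrow> real^'m) \<Rightarrow> real^'m \<Rightarrow> (real^'m) list \<Rightarrow> real" where
  "form_at \<theta> u vs = \<theta> u \<bullet> vs ! 0"

definition ext_deriv :: "(real^'m \<Rightarrow> real^'m) \<Rightarrow> real^'m \<Rightarrow> (real^'m) list \<Rightarrow> real" where
  "ext_deriv \<theta> u vs =
     frechet_derivative (\<lambda>z. \<theta> z \<bullet> vs ! 1) (at u) (vs ! 0) -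
     frechet_derivative (\<lambda>z. \<theta> z \<bullet> vs ! 0) (at u) (vs ! 1)"

text \<open>The coefficient of the form vol with respect to the coordinate volume form, on a manifold of
  dimension 2 * l + 1. The coordinate volume form requires an order of the coordinates; it only
  affects the sign of the coefficient, and only the absolute value is used below.\<close>

definition coordinate_order :: "'m::finite list" where
  "coordinate_order = (SOME xs. distinct xs \<and> set xs = UNIV)"

definition vol_coeff :: "nat \<Rightarrow> (real^'m \<Rightarrow> real^'m) \<Rightarrow> real^'m \<Rightarrow> real" where
  "vol_coeff l \<theta> u = wedge 1 (2 * l) (form_at \<theta> u) (wedge_power2 l (ext_deriv \<theta> u))
     (map (\<lambda>i. axis i 1) coordinate_order)"

text \<open>Real powers of a volume form are taken of the absolute value of its coefficient, as the
  coefficient is negative in some coordinates.\<close>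

definition vol_power ::
    "nat \<Rightarrow> (real^'m \<Rightarrow> real^'m) \<Rightarrow> real^'m \<Rightarrow> real" where
  "vol_power l \<theta> u = \<bar>vol_coeff l \<theta> u\<bar> powr (- 1 / (real l + 1))"

definition contact_tensor ::
    "nat \<Rightarrow> (real^'m \<Rightarrow> real^'m) \<Rightarrow> real^'m \<Rightarrow> real^'m" where
  "contact_tensor l \<theta> u = vol_power l \<theta> u *\<^sub>R \<theta> u"

definition contact_curl_density ::
    "nat \<Rightarrow> (real^'m \<Rightarrow> real^'m^'m) \<Rightarrow> (real^'m \<Rightarrow> real^'m) \<Rightarrow> real^'m \<Rightarrow> real" where
  "contact_curl_density l h \<theta> u = (\<Sum>\<alpha>\<in>UNIV. \<Sum>\<beta>\<in>UNIV. matrix_inv (h u) $ \<alpha> $ \<beta> *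
     cov_deriv_weighted_form h (- 1 / (real l + 1)) (contact_tensor l \<theta>) u \<alpha> \<beta>)"

definition field_components ::
    "('b \<Rightarrow> ('b, 'e) chart \<Rightarrow> 'e) \<Rightarrow> ('b, 'e) chart \<Rightarrow> 'e \<Rightarrow> 'e" where
  "field_components X \<kappa> u = X (chart_inv \<kappa> u) \<kappa>"

definition vector_field ::
    "'b set \<Rightarrow> ('b, 'e::euclidean_space) chart set \<Rightarrow> ('b \<Rightarrow> ('b, 'e) chart \<Rightarrow> 'e) \<Rightarrow> bool" where
  "vector_field N \<N> X \<longleftrightarrow> (\<forall>q\<in>N. X q \<in> tangent_space \<N> q) \<and>
     (\<forall>\<kappa>\<in>\<N>. smooth_on (chart_image \<kappa>) (field_components X \<kappa>))"

definition local_flow ::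
    "'e::euclidean_space set \<Rightarrow> ('e \<Rightarrow> 'e) \<Rightarrow> real \<Rightarrow> 'e set \<Rightarrow> (real \<Rightarrow> 'e \<Rightarrow> 'e) \<Rightarrow> bool" where
  "local_flow D Z \<epsilon> V \<Phi> \<longleftrightarrow> \<epsilon> > 0 \<and> open V \<and> V \<subseteq> D \<and>
     smooth_on ({-\<epsilon><..<\<epsilon>} \<times> V) (\<lambda>(t, w). \<Phi> t w) \<and>
     (\<forall>w\<in>V. \<Phi> 0 w = w \<and> (\<forall>t\<in>{-\<epsilon><..<\<epsilon>}. \<Phi> t w \<in> D \<and>
        ((\<lambda>s. \<Phi> s w) has_vector_derivative Z (\<Phi> t w)) (at t)))"

definition form_kernel :: "real^'m \<Rightarrow> (real^'m) set" where
  "form_kernel \<xi> = {v. \<xi> \<bullet> v = 0}"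

text \<open>Existence and uniqueness of smooth local flows make it immaterial that the flow around each
  point is bound by an existential quantifier. The contact form \<theta> is given by its components in
  each chart.\<close>

definition contact_vector_field ::
    "'b set \<Rightarrow> ('b, real^'m) chart set \<Rightarrow> (('b, real^'m) chart \<Rightarrow> real^'m \<Rightarrow> real^'m) \<Rightarrow>
     ('b \<Rightarrow> ('b, real^'m) chart \<Rightarrow> real^'m) \<Rightarrow> bool" where
  "contact_vector_field N \<N> \<theta> X \<longleftrightarrow> vector_field N \<N> X \<and>
     (\<forall>\<kappa>\<in>\<N>. \<forall>u \<in> chart_image \<kappa>. \<exists>\<epsilon> V \<Phi>.
        u \<in> V \<and> local_flow (chart_image \<kappa>) (field_components X \<kappa>) \<epsilon> V \<Phi> \<and>
        (\<forall>t\<in>{-\<epsilon><..<\<epsilon>}. \<forall>w\<in>V.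
           frechet_derivative (\<Phi> t) (at w) ` form_kernel (\<theta> \<kappa> w) = form_kernel (\<theta> \<kappa> (\<Phi> t w))))"

definition is_contact_riemannian_curl ::
    "nat \<Rightarrow> 'b set \<Rightarrow> ('b, real^'m) chart set \<Rightarrow>
     (('b, real^'m) chart \<Rightarrow> real^'m \<Rightarrow> real^'m) \<Rightarrow>
     (('b, real^'m) chart \<Rightarrow> real^'m \<Rightarrow> real^'m^'m) \<Rightarrow>
     ('b \<Rightarrow> ('b, real^'m) chart \<Rightarrow> real^'m) \<Rightarrow> bool" where
  "is_contact_riemannian_curl l N \<N> \<theta> h X \<longleftrightarrow> contact_vector_field N \<N> \<theta> X \<and>
     (\<forall>\<kappa>\<in>\<N>. \<forall>u \<in> chart_image \<kappa>.
        (\<theta> \<kappa> u \<bullet> field_components X \<kappa> u) * vol_power l (\<theta> \<kappa>) u =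
        contact_curl_density l (h \<kappa>) (\<theta> \<kappa>) u)"


section \<open>The unit sphere bundle\<close>

definition sphere_bundle ::
    "'a set \<Rightarrow> ('a, real^'n) chart set \<Rightarrow> (('a, real^'n) chart \<Rightarrow> real^'n \<Rightarrow> real^'n^'n) \<Rightarrow>
     ('a, real^'n) tangent_point set" where
  "sphere_bundle M \<A> g = {(p, v) \<in> tangent_bundle M \<A>.
     \<forall>c\<in>\<A>. p \<in> fst c \<longrightarrow>
       (\<Sum>i\<in>UNIV. \<Sum>j\<in>UNIV. g c (snd c p) $ i $ j * v c $ i * v c $ j) = 1}"

definition sphere_atlas ::
    "'a set \<Rightarrow> ('a, real^'n) chart set \<Rightarrow> (('a, real^'n) chart \<Rightarrow> real^'n \<Rightarrow> real^'n^'n) \<Rightarrow>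
     (('a, real^'n) tangent_point, real^'m) chart set" where
  "sphere_atlas M \<A> g =
     submanifold_atlas (tangent_bundle M \<A>) (bundle_atlas M \<A>) (sphere_bundle M \<A> g)"

text \<open>The Liouville form and the Sasaki metric in the induced coordinates (x, y) of the tangent
  bundle, evaluated on tangent vectors with components (a, b), where a = dx and b = dy.\<close>

definition liouville ::
    "(real^'n \<Rightarrow> real^'n^'n) \<Rightarrow> (real^'n) \<times> (real^'n) \<Rightarrow> (real^'n) \<times> (real^'n) \<Rightarrow> real" where
  "liouville G = (\<lambda>(x, y) (a, b). \<Sum>i\<in>UNIV. \<Sum>j\<in>UNIV. G x $ i $ j * y $ j * a $ i)"

definition delta_y ::
    "(real^'n \<Rightarrow> real^'n^'n) \<Rightarrow> (real^'n) \<times> (real^'n) \<Rightarrow> (real^'n) \<times> (real^'n) \<Rightarrow> real^'n" where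
  "delta_y G = (\<lambda>(x, y) (a, b). \<chi> i. b $ i +
     (\<Sum>j\<in>UNIV. \<Sum>k\<in>UNIV. christoffel G x i j k * y $ j * a $ k))"

definition sasaki ::
    "(real^'n \<Rightarrow> real^'n^'n) \<Rightarrow> (real^'n) \<times> (real^'n) \<Rightarrow> (real^'n) \<times> (real^'n) \<Rightarrow>
     (real^'n) \<times> (real^'n) \<Rightarrow> real" where
  "sasaki G z w w' = (\<Sum>i\<in>UNIV. \<Sum>j\<in>UNIV. G (fst z) $ i $ j *
     (fst w $ i * fst w' $ j + delta_y G z w $ i * delta_y G z w' $ j))"

text \<open>Restriction to the sphere bundle, in a chart \<kappa>: pull back by the inclusion, expressed in \<kappa> and
  in the coordinates (x, y) induced by some chart c of M that covers the whole domain of \<kappa>. As the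
  Liouville form and the Sasaki metric are tensor fields on the tangent bundle, the result does not
  depend on the choice of c.\<close>

definition base_chart ::
    "'a set \<Rightarrow> ('a, real^'n) chart set \<Rightarrow> (('a, real^'n) tangent_point, real^'m) chart \<Rightarrow>
     ('a, real^'n) chart" where
  "base_chart M \<A> \<kappa> = (SOME c. c \<in> \<A> \<and> fst \<kappa> \<subseteq> fst (bundle_chart M \<A> c))"

definition sphere_inclusion ::
    "'a set \<Rightarrow> ('a, real^'n) chart set \<Rightarrow> (('a, real^'n) tangent_point, real^'m) chart \<Rightarrow>
     real^'m \<Rightarrow> (real^'n) \<times> (real^'n)" where
  "sphere_inclusion M \<A> \<kappa> = transition \<kappa> (bundle_chart M \<A> (base_chart M \<A> \<kappa>))"

definition sphere_contact_form ::
    "'a set \<Rightarrow> ('a, real^'n) chart set \<Rightarrow> (('a, real^'n) chart \<Rightarrow> real^'n \<Rightarrow> real^'n^'n) \<Rightarrow>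
     (('a, real^'n) tangent_point, real^'m) chart \<Rightarrow> real^'m \<Rightarrow> real^'m" where
  "sphere_contact_form M \<A> g \<kappa> u = (let F = sphere_inclusion M \<A> \<kappa> in
     \<chi> \<alpha>. liouville (g (base_chart M \<A> \<kappa>)) (F u) (frechet_derivative F (at u) (axis \<alpha> 1)))"

definition sphere_metric ::
    "'a set \<Rightarrow> ('a, real^'n) chart set \<Rightarrow> (('a, real^'n) chart \<Rightarrow> real^'n \<Rightarrow> real^'n^'n) \<Rightarrow>
     (('a, real^'n) tangent_point, real^'m) chart \<Rightarrow> real^'m \<Rightarrow> real^'m^'m" where
  "sphere_metric M \<A> g \<kappa> u = (let F = sphere_inclusion M \<A> \<kappa> in
     \<chi> \<alpha> \<beta>. sasaki (g (base_chart M \<A> \<kappa>)) (F u)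
       (frechet_derivative F (at u) (axis \<alpha> 1)) (frechet_derivative F (at u) (axis \<beta> 1)))"

end

theory Submission
  imports Defs
begin

text \<open>At each point of the sphere bundle choose a frame made of the geodesic spray and of the horizontal
  and vertical lifts of an orthonormal basis of the complement of y. It is orthonormal for the Sasaki
  metric and a Darboux basis for the contact form, so vol is a constant multiple of the Riemannian
  volume and the density factor of the contact tensor is parallel. Thus the curl density is, up to
  that factor, the divergence of the contact form, i.e. half the trace of the Lie derivative of the
  metric along the spray. This Lie derivative pairs horizontal with vertical vectors only; the
  isometry that changes the sign of the vertical components therefore reverses its sign, and its trace
  vanishes. Finally, a contact field X with theta(X) = 0 satisfies dtheta(X, v) = 0 on the contact
  hyperplane and is therefore zero.\<close>

section \<open>Smooth maps and symmetry of second derivatives\<close>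

text \<open>The frame is chosen separately at each point, without smooth dependence on it:
  \<open>vol_coeff\<close> involves only the values of the contact form and of its exterior
  derivative at the point, and the constant, the square of \<open>darboux_volume\<close>, is the
  same everywhere. The resulting identity between the square of \<open>vol_coeff\<close> and the
  determinant of the metric therefore holds on an open set and can be differentiated; squaring
  removes the sign left open by the order of the coordinates. The charts of the sphere bundle are
  arbitrary and not adapted to horizontal and vertical directions, so a tangent vector
  \<open>a\<close> is handled through the pair \<open>hor u a\<close>, \<open>ver u a\<close>, and a
  dimension count shows which pairs occur. The Lie derivative has no purely horizontal or purely
  vertical part because the connection is metric and torsion-free; its mixed part is made of the
  metric and of the curvature operator along y. In the last claim, time and space derivatives of the
  flow are exchanged by the symmetry of second derivatives.\<close>

lemma frechet_derivative_cong_open: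
  assumes "open S" "x \<in> S" "\<And>z. z \<in> S \<Longrightarrow> f z = g z"
  shows "frechet_derivative f (at x) = frechet_derivative g (at x)"
proof -
  have "(f has_derivative D) (at x) \<longleftrightarrow> (g has_derivative D) (at x)" for D
    using has_derivative_transform_within_open[of f D x UNIV S g]
      has_derivative_transform_within_open[of g D x UNIV S f] assms by auto
  then show ?thesis by (simp add: frechet_derivative_def)
qed

lemma differentiable_cong_open:
  assumes "open S" "x \<in> S" "\<And>z. z \<in> S \<Longrightarrow> f z = g z" "f differentiable at x"
  shows "g differentiable at x"
  using assms has_derivative_transform_within_open[of f _ x UNIV S g]
  unfolding differentiable_def by blast

lemma Ck_on_cong:
  assumes "open S" "\<And>x. x \<in> S \<Longrightarrow> f x = g x" "Ck_on k S f"
  shows "Ck_on k S g"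
  using assms(2,3)
proof (induction k arbitrary: f g)
  case 0
  then show ?case by (simp cong: continuous_on_cong)
next
  case (Suc k)
  have "Ck_on k S (\<lambda>x. frechet_derivative g (at x) v)" for v
    by (rule Suc.IH[of "\<lambda>x. frechet_derivative f (at x) v"])
      (use Suc.prems frechet_derivative_cong_open[OF assms(1), of _ f g] in auto)
  with Suc.prems differentiable_cong_open[OF assms(1), of _ f g] show ?case
    by (metis Ck_on.simps(2))
qed

lemma smooth_on_cong:
  assumes "open S" "\<And>x. x \<in> S \<Longrightarrow> f x = g x" "smooth_on S f"
  shows "smooth_on S g"
  using assms Ck_on_cong unfolding smooth_on_def by blast

lemma Ck_on_const: "Ck_on k S (\<lambda>x. c)"
  by (induction k arbitrary: c) auto

lemma frechet_derivative_bounded_linear: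
  assumes "bounded_linear f"
  shows "frechet_derivative f (at x) = f"
  using frechet_derivative_at[OF bounded_linear_imp_has_derivative[OF assms]] by simp

lemma smooth_on_bounded_linear:
  assumes "bounded_linear f"
  shows "smooth_on S f"
proof -
  have "Ck_on k S f" for k
    by (cases k) (auto simp: frechet_derivative_bounded_linear[OF assms] Ck_on_const
        bounded_linear_imp_differentiable[OF assms] intro: linear_continuous_on assms)
  then show ?thesis by (simp add: smooth_on_def)
qed

lemma smooth_on_imp_differentiable:
  assumes "smooth_on S f" "x \<in> S"
  shows "f differentiable at x"
  using assms unfolding smooth_on_def by (metis Ck_on.simps(2))

lemma smooth_on_imp_has_derivative:
  assumes "smooth_on S f" "x \<in> S"
  shows "(f has_derivative frechet_derivative f (at x)) (at x)"
  using smooth_on_imp_differentiable[OF assms] frechet_derivative_works by blast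

lemma smooth_on_frechet_derivative:
  assumes "smooth_on S f"
  shows "smooth_on S (\<lambda>x. frechet_derivative f (at x) v)"
  using assms unfolding smooth_on_def by (metis Ck_on.simps(2))

definition second_deriv :: "('a::euclidean_space \<Rightarrow> 'b::euclidean_space) \<Rightarrow> 'a \<Rightarrow> 'a \<Rightarrow> 'a \<Rightarrow> 'b" where
  "second_deriv f x a b = frechet_derivative (\<lambda>z. frechet_derivative f (at z) b) (at x) a"

lemma smooth_on_has_second_deriv:
  assumes "smooth_on S f" "x \<in> S"
  shows "((\<lambda>z. frechet_derivative f (at z) b) has_derivative (\<lambda>a. second_deriv f x a b)) (at x)"
  using smooth_on_imp_has_derivative[OF smooth_on_frechet_derivative[OF assms(1)] assms(2)]
  unfolding second_deriv_def .

text \<open>Both second derivatives are the limit of the second difference quotient in the directions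
  a and b, by the mean value theorem.\<close>

lemma second_difference_tendsto:
  fixes f :: "'a::euclidean_space \<Rightarrow> real"
  assumes S: "open S" "u \<in> S"
    and f': "\<And>x. x \<in> S \<Longrightarrow> (f has_derivative f' x) (at x)"
    and f'': "((\<lambda>x. f' x a) has_derivative L) (at u)"
  shows "((\<lambda>t. (f (u + t *\<^sub>R a + t *\<^sub>R b) - f (u + t *\<^sub>R a) - f (u + t *\<^sub>R b) + f u) / t\<^sup>2)
    \<longlongrightarrow> L b) (at_right 0)"
proof -
  interpret L: bounded_linear L using f'' has_derivative_bounded_linear by blast
  have *: "\<forall>\<^sub>F t in at_right 0. \<bar>(f (u + t *\<^sub>R a + t *\<^sub>R b) - f (u + t *\<^sub>R a) - f (u + t *\<^sub>R b) + f u) / t\<^sup>2 - L b\<bar> < \<epsilon>"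
    if "\<epsilon> > 0" for \<epsilon> :: real
  proof -
    define K where "K = norm a + norm b + 1"
    have K: "K > 0" unfolding K_def by (smt (verit) norm_ge_zero)
    \<comment> \<open>Two errors of size at most \<open>e * (t * K)\<close> occur below; the 3 makes
      their sum two thirds of \<open>t * \<epsilon>\<close>, which is strictly smaller than
      \<open>t * \<epsilon>\<close>.\<close>
    define e where "e = \<epsilon> / (3 * K)"
    have e: "e > 0" using that K by (simp add: e_def)
    obtain r where r: "r > 0" "ball u r \<subseteq> S" using S open_contains_ball by blast
    obtain d where d: "d > 0" "\<And>y. norm (y - u) < d \<Longrightarrow> \<bar>f' y a - f' u a - L (y - u)\<bar> \<le> e * norm (y - u)"
      using f'' e unfolding has_derivative_at_alt by (metis real_norm_def)
    define q where "q = min r d / K"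
    have q: "q > 0" using r d K by (simp add: q_def)
    have small: "norm (s *\<^sub>R a + s' *\<^sub>R b) \<le> t * K" "t * K < min r d"
      if "0 \<le> s" "s \<le> t" "0 \<le> s'" "s' \<le> t" "t < q" for s s' t
    proof -
      have "norm (s *\<^sub>R a + s' *\<^sub>R b) \<le> s * norm a + s' * norm b"
        using that norm_triangle_ineq[of "s *\<^sub>R a" "s' *\<^sub>R b"] by auto
      also have "\<dots> \<le> t * norm a + t * norm b"
        using that by (intro add_mono mult_right_mono) auto
      also have "\<dots> \<le> t * K" using that by (simp add: K_def algebra_simps)
      finally show "norm (s *\<^sub>R a + s' *\<^sub>R b) \<le> t * K" .
      show "t * K < min r d" using that K by (simp add: q_def pos_less_divide_eq)
    qed
    have "\<bar>(f (u + t *\<^sub>R a + t *\<^sub>R b) - f (u + t *\<^sub>R a) - f (u + t *\<^sub>R b) + f u) / t\<^sup>2 - L b\<bar> < \<epsilon>"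
      if t: "0 < t" "t < q" for t
    proof -
      \<comment> \<open>The second difference is \<open>\<psi> t - \<psi> 0\<close>. The mean value
        theorem is applied in the direction \<open>a\<close> only; the difference of first
        derivatives that it leaves is estimated by the differentiability of
        \<open>\<lambda>x. f' x a\<close> at the single point \<open>u\<close>.\<close>
      define \<psi> where "\<psi> s = f (u + s *\<^sub>R a + t *\<^sub>R b) - f (u + s *\<^sub>R a)" for s
      have inS: "u + s *\<^sub>R a + s' *\<^sub>R b \<in> S" if "0 \<le> s" "s \<le> t" "0 \<le> s'" "s' \<le> t" for s s'
      proof -
        have "norm (s *\<^sub>R a + s' *\<^sub>R b) < r"
          using small[OF that \<open>t < q\<close>] by linarith
        then have "u + s *\<^sub>R a + s' *\<^sub>R b \<in> ball u r"
          by (metis add.assoc add_diff_cancel_left' dist_norm mem_ball norm_minus_commute)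
        with r show ?thesis by blast
      qed
      have der: "(\<psi> has_real_derivative (f' (u + s *\<^sub>R a + t *\<^sub>R b) a - f' (u + s *\<^sub>R a) a)) (at s)"
        if "0 \<le> s" "s \<le> t" for s
      proof -
        have 1: "((\<lambda>s. f (u + s *\<^sub>R a + c)) has_derivative (\<lambda>h. f' (u + s *\<^sub>R a + c) (h *\<^sub>R a))) (at s)"
          if "u + s *\<^sub>R a + c \<in> S" for c
          by (rule has_derivative_compose[of "\<lambda>s. u + s *\<^sub>R a + c" _ s UNIV f, OF _ f'[OF that]])
            (auto intro!: derivative_eq_intros)
        have lin: "f' (u + s *\<^sub>R a + c) (h *\<^sub>R a) = f' (u + s *\<^sub>R a + c) a * h"
          if "u + s *\<^sub>R a + c \<in> S" for c h
          using linear_scale[OF has_derivative_linear[OF f'[OF that]]] by simp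
        have "u + s *\<^sub>R a + t *\<^sub>R b \<in> S" "u + s *\<^sub>R a + 0 \<in> S"
          using inS[of s t] inS[of s 0] that t by auto
        from 1[OF this(1)] 1[OF this(2)] lin[OF this(1)] lin[OF this(2)] show ?thesis
          unfolding \<psi>_def has_field_derivative_def
          by (auto intro!: derivative_eq_intros simp: algebra_simps)
      qed
      from MVT2[OF t(1) der] obtain \<xi> where \<xi>: "0 < \<xi>" "\<xi> < t"
        and eq: "\<psi> t - \<psi> 0 = t * (f' (u + \<xi> *\<^sub>R a + t *\<^sub>R b) a - f' (u + \<xi> *\<^sub>R a) a)"
        by auto
      define y1 where "y1 = \<xi> *\<^sub>R a + t *\<^sub>R b"
      define y2 where "y2 = \<xi> *\<^sub>R a"
      have n1: "norm y1 \<le> t * K" "norm y1 < d" using small[of \<xi> t t] \<xi> t by (auto simp: y1_def)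
      have n2: "norm y2 \<le> t * K" "norm y2 < d" using small[of \<xi> t 0] \<xi> t by (auto simp: y2_def)
      have "\<bar>f' (u + y1) a - f' u a - L y1\<bar> \<le> e * (t * K)"
        by (rule order_trans[OF _ mult_left_mono[OF n1(1), of e]]) (use d(2)[of "u + y1"] n1(2) e in auto)
      moreover have "\<bar>f' (u + y2) a - f' u a - L y2\<bar> \<le> e * (t * K)"
        by (rule order_trans[OF _ mult_left_mono[OF n2(1), of e]]) (use d(2)[of "u + y2"] n2(2) e in auto)
      moreover have "L y1 - L y2 = t * L b"
        by (simp add: y1_def y2_def L.add L.scaleR)
      ultimately have "\<bar>f' (u + y1) a - f' (u + y2) a - t * L b\<bar> \<le> 2 * (e * (t * K))"
        by linarith
      also have "\<dots> < t * \<epsilon>" using t K that \<open>\<epsilon> > 0\<close> by (simp add: e_def field_simps)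
      finally have **: "\<bar>f' (u + y1) a - f' (u + y2) a - t * L b\<bar> < t * \<epsilon>" .
      have "(f (u + t *\<^sub>R a + t *\<^sub>R b) - f (u + t *\<^sub>R a) - f (u + t *\<^sub>R b) + f u) / t\<^sup>2 - L b
          = (\<psi> t - \<psi> 0) / t\<^sup>2 - L b" by (simp add: \<psi>_def)
      also have "\<dots> = (f' (u + y1) a - f' (u + y2) a - t * L b) / t"
        using t by (simp add: eq y1_def y2_def field_simps power2_eq_square)
      finally show ?thesis using ** t by (simp add: abs_divide pos_divide_less_eq mult.commute)
    qed
    then show ?thesis unfolding eventually_at_right_field using q by (intro exI[of _ q]) auto
  qed
  show ?thesis unfolding tendsto_iff dist_real_def using * by blast
qed

lemma second_deriv_sym_real:
  fixes f :: "'a::euclidean_space \<Rightarrow> real"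
  assumes "open S" "u \<in> S"
    and "\<And>x. x \<in> S \<Longrightarrow> (f has_derivative f' x) (at x)"
    and "((\<lambda>x. f' x a) has_derivative L) (at u)" "((\<lambda>x. f' x b) has_derivative L') (at u)"
  shows "L b = L' a"
proof -
  have "((\<lambda>t. (f (u + t *\<^sub>R a + t *\<^sub>R b) - f (u + t *\<^sub>R a) - f (u + t *\<^sub>R b) + f u) / t\<^sup>2)
    \<longlongrightarrow> L' a) (at_right 0)"
    using second_difference_tendsto[OF assms(1-3,5), of a] by (simp add: algebra_simps)
  from tendsto_unique[OF _ second_difference_tendsto[OF assms(1-4), of b] this] show ?thesis by simp
qed

lemma second_deriv_sym:
  assumes "open S" "smooth_on S f" "u \<in> S"
  shows "second_deriv f u a b = second_deriv f u b a"
proof (rule euclidean_eqI)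
  fix i :: 'b assume "i \<in> Basis"
  have "second_deriv f u b a \<bullet> i = second_deriv f u a b \<bullet> i"
    by (rule second_deriv_sym_real[OF assms(1,3), where f = "\<lambda>x. f x \<bullet> i"
          and f' = "\<lambda>x v. frechet_derivative f (at x) v \<bullet> i"])
      (auto intro!: has_derivative_inner_left smooth_on_imp_has_derivative[OF assms(2)]
         smooth_on_has_second_deriv[OF assms(2,3)])
  then show "second_deriv f u a b \<bullet> i = second_deriv f u b a \<bullet> i" by simp
qed

text \<open>Linearity in the outer direction is that of a derivative; symmetry transfers it to the
  inner direction.\<close>

lemma second_deriv_linear:
  assumes "smooth_on S f" "u \<in> S" "open S"
  shows "linear (\<lambda>a. second_deriv f u a b)" "linear (\<lambda>b. second_deriv f u a b)"
proof -
  show "linear (\<lambda>a. second_deriv f u a b)" for b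
    using has_derivative_linear[OF smooth_on_has_second_deriv[OF assms(1,2)]] .
  then have "linear (\<lambda>b. second_deriv f u b a)" .
  then show "linear (\<lambda>b. second_deriv f u a b)"
    by (simp add: second_deriv_sym[OF assms(3,1,2), of a])
qed

section \<open>Wedge products and Darboux bases\<close>

lemma permutesI_inj_on:
  assumes "finite S" "inj_on p S" "\<And>x. x \<in> S \<Longrightarrow> p x \<in> S" "\<And>x. x \<notin> S \<Longrightarrow> p x = x"
  shows "p permutes S"
proof (rule bij_imp_permutes)
  show "bij_betw p S S"
    using endo_inj_surj[of S p] assms by (auto simp: bij_betw_def)
qed (use assms in auto)

lemma wedge_cong:
  assumes "\<And>is. length is = k \<Longrightarrow> set is \<subseteq> set vs \<Longrightarrow> \<alpha> is = \<alpha>' is"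
    and "\<And>is. length is = l \<Longrightarrow> set is \<subseteq> set vs \<Longrightarrow> \<beta> is = \<beta>' is"
    and "length vs = k + l"
  shows "wedge k l \<alpha> \<beta> vs = wedge k l \<alpha>' \<beta>' vs"
proof -
  have "\<alpha> (map (\<lambda>i. vs ! \<sigma> i) [0..<k]) = \<alpha>' (map (\<lambda>i. vs ! \<sigma> i) [0..<k])"
    "\<beta> (map (\<lambda>i. vs ! \<sigma> i) [k..<k + l]) = \<beta>' (map (\<lambda>i. vs ! \<sigma> i) [k..<k + l])"
    if "\<sigma> permutes {..<k + l}" for \<sigma>
  proof -
    have "\<sigma> i < length vs" if "i < k + l" for i
      using permutes_in_image[OF \<open>\<sigma> permutes {..<k + l}\<close>, of i] that assms(3) by auto
    then show "\<alpha> (map (\<lambda>i. vs ! \<sigma> i) [0..<k]) = \<alpha>' (map (\<lambda>i. vs ! \<sigma> i) [0..<k])"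
      "\<beta> (map (\<lambda>i. vs ! \<sigma> i) [k..<k + l]) = \<beta>' (map (\<lambda>i. vs ! \<sigma> i) [k..<k + l])"
      by (auto intro!: assms(1,2))
  qed
  then show ?thesis by (simp add: wedge_def)
qed

lemma wedge_power2_cong:
  assumes "\<And>is. length is = 2 \<Longrightarrow> set is \<subseteq> S \<Longrightarrow> \<omega> is = \<omega>' is"
    and "length vs = 2 * j" "set vs \<subseteq> S"
  shows "wedge_power2 j \<omega> vs = wedge_power2 j \<omega>' vs"
  using assms(2,3)
proof (induction j arbitrary: vs)
  case (Suc j)
  have "wedge 2 (2 * j) \<omega> (wedge_power2 j \<omega>) vs = wedge 2 (2 * j) \<omega>' (wedge_power2 j \<omega>') vs"
    by (rule wedge_cong) (use Suc assms(1) in auto)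
  then show ?case by simp
qed simp

text \<open>\<open>wedge\<close> puts no structure on the type of its vectors and can be applied to
  lists of indices. This moves an evaluation on basis vectors to the indices, where a Darboux basis
  becomes pure combinatorics.\<close>

lemma wedge_map:
  assumes "length js = k + l"
  shows "wedge k l \<alpha> \<beta> (map b js) = wedge k l (\<lambda>is. \<alpha> (map b is)) (\<lambda>is. \<beta> (map b is)) js"
proof -
  have "map (\<lambda>i. map b js ! \<sigma> i) [0..<k] = map b (map (\<lambda>i. js ! \<sigma> i) [0..<k])"
    "map (\<lambda>i. map b js ! \<sigma> i) [k..<k + l] = map b (map (\<lambda>i. js ! \<sigma> i) [k..<k + l])"
    if "\<sigma> permutes {..<k + l}" for \<sigma>
    using permutes_in_image[OF that] assms by auto
  then show ?thesis unfolding wedge_def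
    by (intro arg_cong2[where f = "(/)"] sum.cong) (auto simp only: mem_Collect_eq)
qed

lemma wedge_power2_map:
  assumes "length js = 2 * j"
  shows "wedge_power2 j \<omega> (map b js) = wedge_power2 j (\<lambda>is. \<omega> (map b is)) js"
  using assms
proof (induction j arbitrary: js)
  case (Suc j)
  have "wedge 2 (2 * j) \<omega> (wedge_power2 j \<omega>) (map b js) =
      wedge 2 (2 * j) (\<lambda>is. \<omega> (map b is)) (\<lambda>is. wedge_power2 j \<omega> (map b is)) js"
    by (rule wedge_map) (use Suc.prems in simp)
  also have "\<dots> = wedge 2 (2 * j) (\<lambda>is. \<omega> (map b is)) (wedge_power2 j (\<lambda>is. \<omega> (map b is))) js"
    by (rule wedge_cong) (use Suc in auto)
  finally show ?case by simp
qed simp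

text \<open>The sum over all permutations alternates whatever \<open>\<alpha>\<close> and
  \<open>\<beta>\<close> are, since composition with \<open>\<tau>\<close> only reindexes
  it.\<close>

lemma wedge_permute:
  assumes \<tau>: "\<tau> permutes {..<k + l}" and "length vs = k + l"
  shows "wedge k l \<alpha> \<beta> (map (\<lambda>i. vs ! \<tau> i) [0..<k + l]) = of_int (sign \<tau>) * wedge k l \<alpha> \<beta> vs"
proof -
  define f where "f \<sigma> = of_int (sign \<sigma>) * \<alpha> (map (\<lambda>i. vs ! \<sigma> i) [0..<k]) * \<beta> (map (\<lambda>i. vs ! \<sigma> i) [k..<k + l])" for \<sigma>
  define g where "g \<sigma> = of_int (sign \<sigma>) * \<alpha> (map (\<lambda>i. map (\<lambda>i. vs ! \<tau> i) [0..<k + l] ! \<sigma> i) [0..<k])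
     * \<beta> (map (\<lambda>i. map (\<lambda>i. vs ! \<tau> i) [0..<k + l] ! \<sigma> i) [k..<k + l])" for \<sigma>
  have fg: "f (\<tau> \<circ> \<sigma>) = of_int (sign \<tau>) * g \<sigma>" if \<sigma>: "\<sigma> permutes {..<k + l}" for \<sigma>
  proof -
    have "sign (\<tau> \<circ> \<sigma>) = sign \<tau> * sign \<sigma>"
      using \<tau> \<sigma> permutation_permutes by (blast intro: sign_compose)
    moreover have "map (\<lambda>i. map (\<lambda>i. vs ! \<tau> i) [0..<k + l] ! \<sigma> i) [0..<k] = map (\<lambda>i. vs ! \<tau> (\<sigma> i)) [0..<k]"
      "map (\<lambda>i. map (\<lambda>i. vs ! \<tau> i) [0..<k + l] ! \<sigma> i) [k..<k + l] = map (\<lambda>i. vs ! \<tau> (\<sigma> i)) [k..<k + l]"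
      using permutes_in_image[OF \<sigma>] by auto
    ultimately show ?thesis unfolding f_def g_def o_def by (simp only: of_int_mult mult.assoc)
  qed
  have "sum f {\<sigma>. \<sigma> permutes {..<k + l}} = (\<Sum>\<sigma> | \<sigma> permutes {..<k + l}. of_int (sign \<tau>) * g \<sigma>)"
    by (subst setum_permutations_compose_left[OF \<tau>]) (use fg in simp)
  then have "of_int (sign \<tau>) * sum f {\<sigma>. \<sigma> permutes {..<k + l}} =
      of_int (sign \<tau> * sign \<tau>) * sum g {\<sigma>. \<sigma> permutes {..<k + l}}"
    by (simp add: sum_distrib_left[symmetric] mult.assoc del: sign_idempotent)
  then show ?thesis by (simp add: wedge_def f_def[symmetric] g_def[symmetric] sum_divide_distrib[symmetric])
qed

section \<open>Multilinearity and change of basis\<close>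

lemma linear_sum_divide:
  fixes f :: "'i \<Rightarrow> 'v::real_vector \<Rightarrow> real"
  assumes "\<And>i. i \<in> I \<Longrightarrow> linear (f i)"
  shows "linear (\<lambda>x. (\<Sum>i\<in>I. f i x) / c)"
  by (rule linearI)
    (simp_all add: assms linear_add linear_scale sum.distrib sum_distrib_left add_divide_distrib)

definition multilinear_form :: "nat \<Rightarrow> ('v::real_vector list \<Rightarrow> real) \<Rightarrow> bool" where
  "multilinear_form k f \<longleftrightarrow> (\<forall>vs p. length vs = k \<longrightarrow> p < k \<longrightarrow> linear (\<lambda>x. f (vs[p := x])))"

text \<open>In each summand the slot \<open>p\<close> is used at exactly one position
  \<open>q\<close>, the one with \<open>\<sigma> q = p\<close>. The varying vector thus enters only
  one of the two factors, and the summand inherits the linearity of that factor.\<close>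

lemma multilinear_form_wedge:
  assumes "multilinear_form k \<alpha>" "multilinear_form l \<beta>"
  shows "multilinear_form (k + l) (wedge k l \<alpha> \<beta>)"
  unfolding multilinear_form_def
proof (intro allI impI)
  fix vs :: "'a list" and p assume vs: "length vs = k + l" and p: "p < k + l"
  have "linear (\<lambda>x. of_int (sign \<sigma>) * \<alpha> (map (\<lambda>i. vs[p := x] ! \<sigma> i) [0..<k])
      * \<beta> (map (\<lambda>i. vs[p := x] ! \<sigma> i) [k..<k + l]))" if \<sigma>: "\<sigma> permutes {..<k + l}" for \<sigma>
  proof -
    obtain q where q: "q < k + l" "\<sigma> q = p"
      using permutes_image[OF \<sigma>] p by (metis imageE lessThan_iff)
    have nth: "vs[p := x] ! \<sigma> i = (if i = q then x else vs ! \<sigma> i)" for x i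
      using permutes_inj[OF \<sigma>] q p vs by (auto simp: inj_def nth_list_update)
    show ?thesis
    proof (cases "q < k")
      case True
      have 1: "map (\<lambda>i. vs[p := x] ! \<sigma> i) [0..<k] = (map (\<lambda>i. vs ! \<sigma> i) [0..<k])[q := x]" for x
        by (rule nth_equalityI) (auto simp: nth nth_list_update)
      have 2: "map (\<lambda>i. vs[p := x] ! \<sigma> i) [k..<k + l] = map (\<lambda>i. vs ! \<sigma> i) [k..<k + l]" for x
        using True by (auto simp: nth)
      have "linear (\<lambda>x. \<alpha> ((map (\<lambda>i. vs ! \<sigma> i) [0..<k])[q := x]))"
        using assms(1) True by (simp add: multilinear_form_def)
      from linear_compose[OF this linear_times[of "of_int (sign \<sigma>) * \<beta> (map (\<lambda>i. vs ! \<sigma> i) [k..<k + l])"]]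
      show ?thesis unfolding 1 2 by (simp add: o_def mult.assoc mult.commute mult.left_commute)
    next
      case False
      have 1: "map (\<lambda>i. vs[p := x] ! \<sigma> i) [k..<k + l] = (map (\<lambda>i. vs ! \<sigma> i) [k..<k + l])[q - k := x]" for x
        using False by (intro nth_equalityI) (auto simp: nth nth_list_update)
      have 2: "map (\<lambda>i. vs[p := x] ! \<sigma> i) [0..<k] = map (\<lambda>i. vs ! \<sigma> i) [0..<k]" for x
        using False by (auto simp: nth)
      have "linear (\<lambda>x. \<beta> ((map (\<lambda>i. vs ! \<sigma> i) [k..<k + l])[q - k := x]))"
        using assms(2) False q by (simp add: multilinear_form_def)
      from linear_compose[OF this linear_times[of "of_int (sign \<sigma>) * \<alpha> (map (\<lambda>i. vs ! \<sigma> i) [0..<k])"]]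
      show ?thesis unfolding 1 2 by (simp add: o_def)
    qed
  qed
  then show "linear (\<lambda>x. wedge k l \<alpha> \<beta> (vs[p := x]))"
    unfolding wedge_def by (intro linear_sum_divide) simp
qed

lemma multilinear_form_wedge_power2:
  assumes "multilinear_form 2 \<omega>"
  shows "multilinear_form (2 * j) (wedge_power2 j \<omega>)"
proof (induction j)
  case 0
  then show ?case by (simp add: multilinear_form_def)
next
  case (Suc j)
  then show ?case using multilinear_form_wedge[OF assms Suc] by simp
qed

text \<open>The action of A on the index side, rather than on the vectors, is what makes the property
  multiplicative in A and hence reduces it to elementary matrices.\<close>

lemma alternating_multilinear_det:
  fixes f :: "('m::finite \<Rightarrow> 'v::real_vector) \<Rightarrow> real" and A :: "real^'m^'m"
  assumes lin: "\<And>x i. linear (\<lambda>v. f (x(i := v)))"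
    and alt: "\<And>x m n. m \<noteq> n \<Longrightarrow> f (x \<circ> Transposition.transpose m n) = - f x"
  shows "f (\<lambda>i. \<Sum>j\<in>UNIV. A $ i $ j *\<^sub>R x j) = det A * f x"
proof -
  have zero: "f x = 0" if "x i = 0" for x i
    using linear_0[OF lin[of x i]] that fun_upd_triv[of x i] by simp
  have same: "f x = 0" if "m \<noteq> n" "x m = x n" for x m n
  proof -
    have "x \<circ> Transposition.transpose m n = x"
      using that by (auto simp: fun_eq_iff Transposition.transpose_def)
    with alt[OF that(1), of x] show ?thesis by simp
  qed
  \<comment> \<open>\<open>x\<close> is quantified because the product case applies the hypothesis
    for one factor to the family that the other factor has already transformed. The five cases are
    products, matrices with a zero row, diagonal matrices, transpositions, and the addition of a
    multiple of one row to another.\<close>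
  have "\<forall>x. f (\<lambda>i. \<Sum>j\<in>UNIV. A $ i $ j *\<^sub>R x j) = det A * f x"
  proof (induction A rule: induct_matrix_elementary)
    case (1 A B)
    have "(\<Sum>j\<in>UNIV. (A ** B) $ i $ j *\<^sub>R x j) = (\<Sum>k\<in>UNIV. A $ i $ k *\<^sub>R (\<Sum>j\<in>UNIV. B $ k $ j *\<^sub>R x j))" for i and x :: "'m \<Rightarrow> 'v"
      unfolding matrix_matrix_mult_def
      by (simp add: scaleR_sum_left scaleR_sum_right) (rule sum.swap)
    then show ?case using 1 by (simp add: det_mul)
  next
    case (2 A i)
    have "A $ i $ j = 0" for j using 2 by (simp add: row_def vec_eq_iff)
    then show ?case using 2 by (auto simp: det_zero_row(2) intro: zero[of _ i])
  next
    case (3 A)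
    have "(\<Sum>j\<in>UNIV. A $ i $ j *\<^sub>R x j) = A $ i $ i *\<^sub>R x i" for i and x :: "'m \<Rightarrow> 'v"
      using 3 by (subst sum.mono_neutral_right[of _ "{i}"]) auto
    \<comment> \<open>The diagonal entries are pulled out one coordinate at a time; \<open>S\<close>
      is the set of coordinates scaled so far.\<close>
    moreover have "f (\<lambda>i. if i \<in> S then c i *\<^sub>R x i else x i) = (\<Prod>i\<in>S. c i) * f x" for S c x
    proof (induction S rule: finite_induct[OF finite])
      case (2 k S)
      let ?y = "\<lambda>i. if i \<in> S then c i *\<^sub>R x i else x i"
      have "f (?y(k := c k *\<^sub>R x k)) = c k * f (?y(k := x k))"
        using linear_scale[OF lin[of ?y k], of "c k" "x k"] by simp
      moreover have "?y(k := x k) = ?y" using 2 by auto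
      moreover have "?y(k := c k *\<^sub>R x k) = (\<lambda>i. if i \<in> insert k S then c i *\<^sub>R x i else x i)" by auto
      ultimately show ?case using 2 by simp
    qed simp
    from this[of UNIV "\<lambda>i. A $ i $ i"]
    have "f (\<lambda>i. A $ i $ i *\<^sub>R x i) = det A * f x" for x
      using det_diagonal[of A] 3 by simp
    ultimately show ?case by simp
  next
    case (4 m n)
    let ?A = "(\<chi> i j. mat 1 $ i $ Transposition.transpose m n j) :: real^'m^'m"
    have e: "?A $ i $ j = of_bool (j = Transposition.transpose m n i)" for i j
      by (auto simp: mat_def transpose_eq_iff)
    have "(\<Sum>j\<in>UNIV. ?A $ i $ j *\<^sub>R x j) = (x \<circ> Transposition.transpose m n) i" for i and x :: "'m \<Rightarrow> 'v"
      unfolding e by (simp add: of_bool_def if_distrib[of "\<lambda>c. c *\<^sub>R _"] cong: if_cong)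
    moreover have "det ?A = - 1"
      using det_permute_columns[of "Transposition.transpose m n" "mat 1 :: real^'m^'m"] 4
      by (simp add: permutes_swap_id sign_swap_id)
    ultimately show ?case using alt[OF 4] by (simp add: o_def)
  next
    case (5 m n c)
    let ?A = "(\<chi> i j. if i = m \<and> j = n then c else of_bool (i = j)) :: real^'m^'m"
    have "(\<lambda>i. \<Sum>j\<in>UNIV. ?A $ i $ j *\<^sub>R x j) = x(m := x m + c *\<^sub>R x n)" for x :: "'m \<Rightarrow> 'v"
    proof
      fix i
      have "(\<Sum>j\<in>UNIV. ?A $ i $ j *\<^sub>R x j) = (\<Sum>j\<in>UNIV. (if i = m \<and> j = n then c *\<^sub>R x j else 0) + (if j = i then x j else 0))"
        using 5 by (intro sum.cong) auto
      then show "(\<Sum>j\<in>UNIV. ?A $ i $ j *\<^sub>R x j) = (x(m := x m + c *\<^sub>R x n)) i"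
        by (cases "i = m") (auto simp: sum.distrib)
    qed
    moreover have "f (x(m := x m + c *\<^sub>R x n)) = f x" for x
    proof -
      have "f (x(m := x m + c *\<^sub>R x n)) = f (x(m := x m)) + c * f (x(m := x n))"
        using linear_add[OF lin[of x m]] linear_scale[OF lin[of x m]] by simp
      moreover have "f (x(m := x n)) = 0" using same[OF 5] 5 by simp
      ultimately show ?thesis by simp
    qed
    moreover have "det ?A = 1"
    proof -
      have "?A = (\<chi> k. if k = m then row m (mat 1) + c *s row n (mat 1) else row k (mat 1))"
        using 5 by (auto simp: vec_eq_iff row_def mat_def)
      then show ?thesis using det_row_operation[OF 5, of "mat 1" c] by simp
    qed
    ultimately show ?case by simp
  qed
  then show ?thesis by blast
qed

text \<open>The antisymmetrization inside \<open>\<beta>\<close> is absorbed by the outer one: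
  shifted to the last \<open>l\<close> positions, each \<open>\<tau>\<close> becomes a permutation
  \<open>sh \<tau>\<close> of all positions, and composition with it leaves the outer sum unchanged.
  The inner sum thus yields \<open>fact l\<close> equal terms, which cancel the
  normalization.\<close>

lemma wedge_antisymmetrized:
  assumes \<beta>: "\<And>ws. length ws = l \<Longrightarrow> \<beta> ws =
      c * (\<Sum>\<tau> | \<tau> permutes {..<l}. of_int (sign \<tau>) * t (map (\<lambda>i. ws ! \<tau> i) [0..<l]))"
  shows "wedge k l \<alpha> \<beta> vs = c / fact k * (\<Sum>\<sigma> | \<sigma> permutes {..<k + l}. of_int (sign \<sigma>) *
    \<alpha> (map (\<lambda>i. vs ! \<sigma> i) [0..<k]) * t (map (\<lambda>i. vs ! \<sigma> i) [k..<k + l]))"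
proof -
  define P where "P = {\<sigma>. \<sigma> permutes {..<k + l}}"
  define Q where "Q = {\<tau>. \<tau> permutes {..<l}}"
  define a where "a \<sigma> = \<alpha> (map (\<lambda>i. vs ! \<sigma> i) [0..<k])" for \<sigma>
  define b where "b \<sigma> = t (map (\<lambda>i. vs ! \<sigma> i) [k..<k + l])" for \<sigma>
  define sh where "sh \<tau> = map_permutation {..<l} (\<lambda>i. i + k) \<tau>" for \<tau> :: "nat \<Rightarrow> nat"
  define T where "T = (\<Sum>\<sigma>\<in>P. of_int (sign \<sigma>) * a \<sigma> * b \<sigma>)"
  have inj: "inj_on (\<lambda>i. i + k) {..<l}" by (simp add: inj_on_def)
  have sh: "sh \<tau> permutes {..<k + l}" "sign (sh \<tau>) = sign \<tau>" "\<And>i. i < k \<Longrightarrow> sh \<tau> i = i"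
    "\<And>i. i < l \<Longrightarrow> sh \<tau> (k + i) = k + \<tau> i" if "\<tau> permutes {..<l}" for \<tau>
  proof -
    have *: "(\<lambda>i. i + k) ` {..<l} = {k..<k + l}"
      by (auto simp: image_iff) (metis add.commute le_add_diff_inverse nat_add_left_cancel_less lessThan_iff)
    have p: "sh \<tau> permutes {k..<k + l}" unfolding sh_def
      by (rule map_permutation_permutes) (use that inj * in \<open>auto simp: bij_betw_def\<close>)
    then show "sh \<tau> permutes {..<k + l}" by (rule permutes_subset) auto
    show "sign (sh \<tau>) = sign \<tau>" unfolding sh_def by (rule sign_map_permutation) (use that inj in auto)
    show "sh \<tau> i = i" if "i < k" for i using permutes_not_in[OF p] that by simp
    show "sh \<tau> (k + i) = k + \<tau> i" if "i < l" for i
      using map_permutation_apply[OF inj, of i \<tau>] that by (simp add: sh_def add.commute)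
  qed
  have inner: "(\<Sum>\<sigma>\<in>P. of_int (sign \<sigma>) * a \<sigma> * (of_int (sign \<tau>) * b (\<sigma> \<circ> sh \<tau>))) = T" if "\<tau> \<in> Q" for \<tau>
  proof -
    have \<tau>: "\<tau> permutes {..<l}" using that by (simp add: Q_def)
    have "of_int (sign \<sigma>) * a \<sigma> * (of_int (sign \<tau>) * b (\<sigma> \<circ> sh \<tau>)) =
        of_int (sign (\<sigma> \<circ> sh \<tau>)) * a (\<sigma> \<circ> sh \<tau>) * b (\<sigma> \<circ> sh \<tau>)" if "\<sigma> \<in> P" for \<sigma>
    proof -
      have "sign (\<sigma> \<circ> sh \<tau>) = sign \<sigma> * sign \<tau>"
        using sh(1,2)[OF \<tau>] that permutation_permutes unfolding P_def
        by (metis finite_lessThan mem_Collect_eq sign_compose)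
      moreover have "a (\<sigma> \<circ> sh \<tau>) = a \<sigma>"
        unfolding a_def by (rule arg_cong[of _ _ \<alpha>]) (use sh(3)[OF \<tau>] in simp)
      ultimately show ?thesis by simp
    qed
    then have "(\<Sum>\<sigma>\<in>P. of_int (sign \<sigma>) * a \<sigma> * (of_int (sign \<tau>) * b (\<sigma> \<circ> sh \<tau>))) =
        (\<Sum>\<sigma>\<in>P. of_int (sign (\<sigma> \<circ> sh \<tau>)) * a (\<sigma> \<circ> sh \<tau>) * b (\<sigma> \<circ> sh \<tau>))" by (rule sum.cong[OF refl])
    also have "\<dots> = T" unfolding T_def P_def
      by (rule sum_permutations_compose_right[OF sh(1)[OF \<tau>], symmetric])
    finally show ?thesis .
  qed
  have outer: "of_int (sign \<sigma>) * a \<sigma> * \<beta> (map (\<lambda>i. vs ! \<sigma> i) [k..<k + l]) =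
      c * (\<Sum>\<tau>\<in>Q. of_int (sign \<sigma>) * a \<sigma> * (of_int (sign \<tau>) * b (\<sigma> \<circ> sh \<tau>)))" for \<sigma>
  proof -
    have "t (map (\<lambda>i. map (\<lambda>i. vs ! \<sigma> i) [k..<k + l] ! \<tau> i) [0..<l]) = b (\<sigma> \<circ> sh \<tau>)" if "\<tau> \<in> Q" for \<tau>
    proof -
      have \<tau>: "\<tau> permutes {..<l}" using that by (simp add: Q_def)
      show ?thesis unfolding b_def
        by (rule arg_cong[of _ _ t], rule nth_equalityI)
          (use sh(4)[OF \<tau>] permutes_in_image[OF \<tau>] in auto)
    qed
    then show ?thesis by (subst \<beta>) (simp_all add: Q_def[symmetric] sum_distrib_left mult_ac)
  qed
  have "wedge k l \<alpha> \<beta> vs = c * (\<Sum>\<sigma>\<in>P. \<Sum>\<tau>\<in>Q. of_int (sign \<sigma>) * a \<sigma> * (of_int (sign \<tau>) * b (\<sigma> \<circ> sh \<tau>))) / (fact k * fact l)"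
    unfolding wedge_def P_def[symmetric] a_def[symmetric] outer by (simp only: sum_distrib_left)
  also have "(\<Sum>\<sigma>\<in>P. \<Sum>\<tau>\<in>Q. of_int (sign \<sigma>) * a \<sigma> * (of_int (sign \<tau>) * b (\<sigma> \<circ> sh \<tau>))) = (\<Sum>\<tau>\<in>Q. T)"
    by (subst sum.swap) (simp add: inner)
  also have "\<dots> = fact l * T"
    using card_permutations[of "{..<l}" l] by (simp add: Q_def)
  finally show ?thesis by (simp add: T_def a_def b_def P_def)
qed

text \<open>Turns the recursive power into a single sum over permutations. By
  \<open>wedge_antisymmetrized\<close> the factorial of the remaining degree cancels at each stage,
  and only \<open>fact 2\<close> survives for each factor.\<close>

lemma wedge_power2_eq_sum:
  assumes "length vs = 2 * j"
  shows "wedge_power2 j \<omega> vs = (1 / 2) ^ j * (\<Sum>\<sigma> | \<sigma> permutes {..<2 * j}. of_int (sign \<sigma>) *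
    (\<Prod>i<j. \<omega> [vs ! \<sigma> (2 * i), vs ! \<sigma> (2 * i + 1)]))"
  using assms
proof (induction j arbitrary: vs)
  case 0
  then show ?case by (simp add: permutes_empty)
next
  case (Suc j)
  define t where "t ws = (\<Prod>i<j. \<omega> [ws ! (2 * i), ws ! (2 * i + 1)])" for ws
  have IH: "wedge_power2 j \<omega> ws = (1 / 2) ^ j * (\<Sum>\<tau> | \<tau> permutes {..<2 * j}. of_int (sign \<tau>) *
      t (map (\<lambda>i. ws ! \<tau> i) [0..<2 * j]))" if "length ws = 2 * j" for ws
    using Suc.IH[OF that] by (simp add: t_def)
  have t: "\<omega> (map (\<lambda>i. vs ! \<sigma> i) [0..<2]) * t (map (\<lambda>i. vs ! \<sigma> i) [2..<2 + 2 * j]) =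
      (\<Prod>i<Suc j. \<omega> [vs ! \<sigma> (2 * i), vs ! \<sigma> (2 * i + 1)])" for \<sigma>
  proof -
    have "[0..<2] = [0, 1::nat]" by (simp add: upt_rec)
    then show ?thesis
      by (subst prod.lessThan_Suc_shift) (simp add: t_def del: upt_Suc)
  qed
  have "wedge_power2 (Suc j) \<omega> vs = (1 / 2) ^ j / fact 2 * (\<Sum>\<sigma> | \<sigma> permutes {..<2 + 2 * j}. of_int (sign \<sigma>) *
      \<omega> (map (\<lambda>i. vs ! \<sigma> i) [0..<2]) * t (map (\<lambda>i. vs ! \<sigma> i) [2..<2 + 2 * j]))"
    unfolding wedge_power2.simps by (rule wedge_antisymmetrized[OF IH])
  then show ?case unfolding mult.assoc t by simp
qed

text \<open>Exchanging the first two slots reverses the sign of a permutation, so the subtracted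
  half of the form contributes as much as \<open>U\<close> itself.\<close>

lemma wedge_two_antisymmetrize:
  assumes "length vs = 2 + l"
  shows "wedge 2 l (\<lambda>is. U (is ! 0) (is ! 1) - U (is ! 1) (is ! 0)) \<beta> vs =
    2 * wedge 2 l (\<lambda>is. U (is ! 0) (is ! 1)) \<beta> vs"
proof -
  define P where "P = {\<sigma>. \<sigma> permutes {..<2 + l}}"
  define f where "f \<sigma> = of_int (sign \<sigma>) * U (vs ! \<sigma> 0) (vs ! \<sigma> 1) * \<beta> (map (\<lambda>i. vs ! \<sigma> i) [2..<2 + l])" for \<sigma>
  define g where "g \<sigma> = of_int (sign \<sigma>) * U (vs ! \<sigma> 1) (vs ! \<sigma> 0) * \<beta> (map (\<lambda>i. vs ! \<sigma> i) [2..<2 + l])" for \<sigma>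
  define \<tau> where "\<tau> = Transposition.transpose 0 (1::nat)"
  have \<tau>: "\<tau> permutes {..<2 + l}" unfolding \<tau>_def by (rule permutes_swap_id) auto
  have "f (\<sigma> \<circ> \<tau>) = - g \<sigma>" if "\<sigma> \<in> P" for \<sigma>
  proof -
    have "sign (\<sigma> \<circ> \<tau>) = sign \<sigma> * sign \<tau>"
      using \<tau> that permutation_permutes unfolding P_def
      by (metis finite_lessThan mem_Collect_eq sign_compose)
    moreover have "map (\<lambda>i. vs ! (\<sigma> \<circ> \<tau>) i) [2..<2 + l] = map (\<lambda>i. vs ! \<sigma> i) [2..<2 + l]"
      by (auto simp: \<tau>_def Transposition.transpose_def)
    ultimately show ?thesis unfolding f_def g_def by (simp only:) (simp add: \<tau>_def sign_swap_id del: upt_Suc)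
  qed
  then have "sum f P = - sum g P"
    unfolding P_def by (subst sum_permutations_compose_right[OF \<tau>]) (simp add: sum_negf)
  moreover have "wedge 2 l (\<lambda>is. U (is ! 0) (is ! 1) - U (is ! 1) (is ! 0)) \<beta> vs = (sum f P - sum g P) / (fact 2 * fact l)"
    unfolding wedge_def P_def[symmetric] f_def g_def sum_subtractf[symmetric]
    by (intro arg_cong2[where f = "(/)"] sum.cong) (auto simp: algebra_simps)
  moreover have "wedge 2 l (\<lambda>is. U (is ! 0) (is ! 1)) \<beta> vs = sum f P / (fact 2 * fact l)"
    unfolding wedge_def P_def[symmetric] f_def by simp
  ultimately show ?thesis by simp
qed

lemma wedge_scale:
  "wedge k l (\<lambda>is. c * \<alpha> is) \<beta> vs = c * wedge k l \<alpha> \<beta> vs"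
  "wedge k l \<alpha> (\<lambda>is. c * \<beta> is) vs = c * wedge k l \<alpha> \<beta> vs"
  by (simp_all add: wedge_def sum_distrib_left mult_ac)

text \<open>Allows \<open>darboux_form\<close> to be replaced by one of its two indicator terms, so
  that the products in \<open>wedge_power2_eq_sum\<close> are only 0 or 1.\<close>

lemma wedge_power2_antisymmetrize:
  assumes "length vs = 2 * j"
  shows "wedge_power2 j (\<lambda>is. U (is ! 0) (is ! 1) - U (is ! 1) (is ! 0)) vs =
    2 ^ j * wedge_power2 j (\<lambda>is. U (is ! 0) (is ! 1)) vs"
  using assms
proof (induction j arbitrary: vs)
  case (Suc j)
  let ?W = "\<lambda>is. U (is ! 0) (is ! 1) - U (is ! 1) (is ! 0)" and ?U = "\<lambda>is. U (is ! 0) (is ! 1)"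
  have "wedge_power2 (Suc j) ?W vs = wedge 2 (2 * j) ?W (\<lambda>ws. 2 ^ j * wedge_power2 j ?U ws) vs"
    unfolding wedge_power2.simps by (rule wedge_cong) (use Suc in auto)
  also have "\<dots> = 2 ^ j * (2 * wedge_power2 (Suc j) ?U vs)"
    using wedge_two_antisymmetrize[of vs "2 * j" U] Suc.prems by (simp add: wedge_scale)
  finally show ?case by simp
qed simp

text \<open>The permutation is the product of its restriction A to the odd numbers and of a conjugate of A
  by the involution that exchanges the members of each pair.\<close>

lemma sign_pair_permutation:
  assumes \<sigma>: "\<sigma> permutes {..<2 * l + 1}" and 0: "\<sigma> 0 = 0"
    and pair: "\<And>i. i < l \<Longrightarrow> odd (\<sigma> (2 * i + 1)) \<and> \<sigma> (2 * i + 2) = Suc (\<sigma> (2 * i + 1))"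
  shows "sign \<sigma> = 1"
proof -
  let ?S = "{..<2 * l + 1}"
  define A where "A n = (if odd n then \<sigma> n else n)" for n
  define B where "B n = (if even n then \<sigma> n else n)" for n
  \<comment> \<open>The pairs are (1, 2), (3, 4), ..., (2 l - 1, 2 l); the index 0 belongs to none
    and stays fixed.\<close>
  define \<tau> where "\<tau> n = (if n = 0 \<or> n > 2 * l then n else if odd n then n + 1 else n - 1)" for n :: nat
  have out: "\<sigma> n = n" if "n > 2 * l" for n using permutes_not_in[OF \<sigma>] that by auto
  have odd: "odd (\<sigma> n)" "n \<le> 2 * l \<Longrightarrow> \<sigma> (Suc n) = Suc (\<sigma> n)" if n: "odd n" for n
  proof -
    obtain i where i: "n = 2 * i + 1" using n by (elim oddE)
    show "odd (\<sigma> n)" using pair[of i] i n out[of n] by (cases "i < l") auto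
    show "\<sigma> (Suc n) = Suc (\<sigma> n)" if "n \<le> 2 * l" using pair[of i] i that by auto
  qed
  have even: "even (\<sigma> n)" if "even n" for n
  proof (cases "n = 0 \<or> n > 2 * l")
    case True
    then show ?thesis using 0 out that by auto
  next
    case False
    then obtain k where k: "n = Suc k" by (cases n) auto
    then have "k \<le> 2 * l" "odd k" using False that by auto
    with k show ?thesis using odd[of k] by simp
  qed
  have inj: "inj \<sigma>" using permutes_inj[OF \<sigma>] .
  have Ap: "A permutes ?S"
  proof (rule permutesI_inj_on)
    show "inj_on A ?S"
    proof (rule inj_onI)
      fix x y assume "A x = A y"
      moreover have "odd (A n) = odd n" for n using odd by (simp add: A_def)
      ultimately show "x = y" using injD[OF inj, of x y] by (metis A_def)
    qed
    show "A x \<in> ?S" if "x \<in> ?S" for x using permutes_in_image[OF \<sigma>, of x] that by (auto simp: A_def)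
    show "A x = x" if "x \<notin> ?S" for x using out that by (auto simp: A_def)
  qed simp
  have \<tau>p: "\<tau> permutes ?S"
  proof (rule permutesI_inj_on)
    show "inj_on \<tau> ?S"
      unfolding inj_on_def \<tau>_def by (auto split: if_splits) presburger+
    show "\<tau> x \<in> ?S" if "x \<in> ?S" for x using that by (auto simp: \<tau>_def) presburger
    show "\<tau> x = x" if "x \<notin> ?S" for x using that by (auto simp: \<tau>_def)
  qed simp
  have le: "\<sigma> n \<le> 2 * l" if "n \<le> 2 * l" for n using permutes_in_image[OF \<sigma>, of n] that by auto
  \<comment> \<open>For an even \<open>n = Suc k\<close> of some pair, \<open>\<tau>\<close> leads
    to the odd partner \<open>k\<close>, \<open>A\<close> sends it to \<open>\<sigma> k\<close>, and
    \<open>\<tau>\<close> leads on to \<open>Suc (\<sigma> k)\<close>, which is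
    \<open>\<sigma> n\<close> since pairs go to pairs.\<close>
  have B: "B = \<tau> \<circ> (A \<circ> \<tau>)"
  proof
    fix n
    have "n = 0 \<or> n > 2 * l \<or> (n \<le> 2 * l \<and> odd n) \<or> (\<exists>k. n = Suc k \<and> Suc k \<le> 2 * l \<and> odd k)"
      by (cases n) auto
    then consider "n = 0 \<or> n > 2 * l" | "n \<le> 2 * l" "odd n" | k where "n = Suc k" "Suc k \<le> 2 * l" "odd k"
      by blast
    then show "B n = (\<tau> \<circ> (A \<circ> \<tau>)) n"
    proof cases
      case 1
      then show ?thesis using 0 out by (auto simp: A_def B_def \<tau>_def)
    next
      case 2
      then have "n < 2 * l" by presburger
      then show ?thesis using 2 by (auto simp: A_def B_def \<tau>_def)
    next
      case 3
      have "\<sigma> k > 0" using odd(1)[OF 3(3)] by (cases "\<sigma> k") auto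
      then show ?thesis using 3 odd[of k] le[of k] by (auto simp: A_def B_def \<tau>_def)
    qed
  qed
  have AB: "\<sigma> = A \<circ> B" using odd even by (auto simp: A_def B_def fun_eq_iff)
  have pA: "permutation A" and p\<tau>: "permutation \<tau>"
    using Ap \<tau>p permutation_permutes by (metis finite_lessThan)+
  then have pB: "permutation B" unfolding B by (intro permutation_compose)
  have "sign B = sign \<tau> * (sign A * sign \<tau>)"
    unfolding B using pA p\<tau> by (simp add: sign_compose permutation_compose)
  then have "sign B = sign A" by (simp add: mult.left_commute)
  then show ?thesis using sign_compose[OF pA pB] AB by simp
qed

text \<open>The forms dtheta and theta of a Darboux basis, as functions of the basis indices: dtheta is the
  sum of the products of the coforms 2 i + 1 and 2 i + 2, and theta is the coform 0.\<close>

definition darboux_form :: "nat list \<Rightarrow> real" where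
  "darboux_form is = of_bool (odd (is ! 0) \<and> is ! 1 = Suc (is ! 0)) - of_bool (odd (is ! 1) \<and> is ! 0 = Suc (is ! 1))"

text \<open>The value of vol on every Darboux basis. With indices in place of vectors it visibly
  depends on \<open>l\<close> alone, which makes it constant over the sphere bundle.\<close>

definition darboux_volume :: "nat \<Rightarrow> real" where
  "darboux_volume l = wedge 1 (2 * l) (\<lambda>is. of_bool (is ! 0 = 0)) (wedge_power2 l darboux_form) [0..<2 * l + 1]"

text \<open>Only permutations that fix 0 and carry pairs to pairs contribute. They have sign 1, so
  nothing cancels, and the identity contributes 1.\<close>

lemma darboux_volume_pos: "darboux_volume l > 0"
proof -
  define U where "U a b = (of_bool (odd a \<and> b = Suc a) :: real)" for a b
  let ?U = "\<lambda>is. U (is ! 0) (is ! 1)"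
  have df: "darboux_form = (\<lambda>is. U (is ! 0) (is ! 1) - U (is ! 1) (is ! 0))"
    by (simp add: darboux_form_def U_def fun_eq_iff)
  define t where "t ws = (\<Prod>i<l. U (ws ! (2 * i)) (ws ! (2 * i + 1)))" for ws
  have \<beta>: "wedge_power2 l ?U ws = (1 / 2) ^ l * (\<Sum>\<tau> | \<tau> permutes {..<2 * l}. of_int (sign \<tau>) *
      t (map (\<lambda>i. ws ! \<tau> i) [0..<2 * l]))" if "length ws = 2 * l" for ws
    using wedge_power2_eq_sum[OF that, of ?U] by (simp add: t_def)
  define P where "P = {\<sigma>. \<sigma> permutes {..<1 + 2 * l}}"
  let ?vs = "[0..<2 * l + 1]"
  define s where "s \<sigma> = of_int (sign \<sigma>) * of_bool (map (\<lambda>i. ?vs ! \<sigma> i) [0..<1] ! 0 = 0) *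
      t (map (\<lambda>i. ?vs ! \<sigma> i) [1..<1 + 2 * l])" for \<sigma>
  have "darboux_volume l = wedge 1 (2 * l) (\<lambda>is. of_bool (is ! 0 = 0)) (\<lambda>ws. 2 ^ l * wedge_power2 l ?U ws) ?vs"
    unfolding darboux_volume_def df by (rule wedge_cong) (use wedge_power2_antisymmetrize[of _ l U] in auto)
  \<comment> \<open>The powers of 2 cancel: \<open>2 ^ l\<close> comes from dropping one half of the
    antisymmetric form, \<open>(1 / 2) ^ l\<close> from the normalization of the wedge
    powers.\<close>
  also have "\<dots> = 2 ^ l * ((1 / 2) ^ l / fact 1 * sum s P)"
    unfolding wedge_scale s_def P_def by (subst wedge_antisymmetrized[OF \<beta>]) auto
  also have "\<dots> = sum s P" by (simp add: power_one_over field_simps)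
  finally have eq: "darboux_volume l = sum s P" .
  have s: "s \<sigma> = of_int (sign \<sigma>) * of_bool (\<sigma> 0 = 0) * (\<Prod>i<l. U (\<sigma> (2 * i + 1)) (\<sigma> (2 * i + 2)))" if "\<sigma> \<in> P" for \<sigma>
  proof -
    have "?vs ! \<sigma> i = \<sigma> i" if "i < 1 + 2 * l" for i
      using permutes_in_image[of \<sigma> "{..<1 + 2 * l}" i] that \<open>\<sigma> \<in> P\<close> nth_upt[of 0 "\<sigma> i" "2 * l + 1"] by (auto simp: P_def)
    then show ?thesis by (simp add: s_def t_def del: upt_Suc)
  qed
  have "s \<sigma> \<ge> 0" if "\<sigma> \<in> P" for \<sigma>
  proof (cases "s \<sigma> = 0")
    case False
    then have "\<sigma> 0 = 0" "\<And>i. i < l \<Longrightarrow> U (\<sigma> (2 * i + 1)) (\<sigma> (2 * i + 2)) \<noteq> 0"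
      using s[OF that] by auto
    then have "sign \<sigma> = 1"
      using that by (intro sign_pair_permutation[of _ l]) (auto simp: P_def U_def)
    then show ?thesis using s[OF that] by (auto intro!: prod_nonneg simp: U_def)
  qed simp
  moreover have "finite P" by (simp add: P_def finite_permutations)
  moreover have "id \<in> P" by (simp add: P_def permutes_id)
  moreover have "s id = 1" using s[OF \<open>id \<in> P\<close>] by (simp add: U_def)
  ultimately have "sum s P \<ge> 1" using member_le_sum[of id P s] by auto
  then show ?thesis using eq by simp
qed

section \<open>Matrix calculus and Christoffel symbols\<close>

lemma has_derivative_det:
  fixes H :: "'a::real_normed_vector \<Rightarrow> real^'m^'m"
  assumes "\<And>i j. ((\<lambda>z. H z $ i $ j) has_derivative (\<lambda>v. D v i j)) (at u)"
  shows "((\<lambda>z. det (H z)) has_derivative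
    (\<lambda>v. \<Sum>k\<in>UNIV. det (\<chi> i. if i = k then \<chi> j. D v k j else H u $ i))) (at u)"
proof -
  have prod: "D v k (\<sigma> k) * (\<Prod>i\<in>UNIV - {k}. H u $ i $ \<sigma> i)
      = (\<Prod>i\<in>UNIV. (\<chi> i. if i = k then \<chi> j. D v k j else H u $ i) $ i $ \<sigma> i)" for v k \<sigma>
    by (subst prod.remove[of UNIV k]) (auto intro!: prod.cong)
  have "((\<lambda>z. det (H z)) has_derivative (\<lambda>v. \<Sum>\<sigma> | \<sigma> permutes UNIV.
      of_int (sign \<sigma>) * (\<Sum>k\<in>UNIV. D v k (\<sigma> k) * (\<Prod>i\<in>UNIV - {k}. H u $ i $ \<sigma> i)))) (at u)"
    unfolding det_def
    by (intro has_derivative_sum has_derivative_mult_right has_derivative_prod assms)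
  then show ?thesis
    unfolding prod det_def sum_distrib_left by (subst (asm) sum.swap) simp
qed

lemma matrix_inv_works:
  fixes A :: "real^'m^'m"
  assumes "det A \<noteq> 0"
  shows "A ** matrix_inv A = mat 1" "matrix_inv A ** A = mat 1"
proof -
  have "\<exists>B. A ** B = mat 1 \<and> B ** A = mat 1"
    using assms invertible_det_nz[of A] unfolding invertible_def by blast
  from someI_ex[OF this] show "A ** matrix_inv A = mat 1" "matrix_inv A ** A = mat 1"
    unfolding matrix_inv_def by auto
qed

lemma matrix_inv_sym:
  fixes A :: "real^'m^'m"
  assumes "det A \<noteq> 0" "transpose A = A"
  shows "transpose (matrix_inv A) = matrix_inv A"
proof -
  have "transpose (matrix_inv A) ** A = mat 1"
    using matrix_inv_works(1)[OF assms(1)] assms(2) by (metis matrix_transpose_mul transpose_mat)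
  then show ?thesis
    by (metis matrix_inv_works(1)[OF assms(1)] matrix_mul_assoc matrix_mul_lid matrix_mul_rid)
qed

text \<open>Cramer's rule for the columns of the inverse. As quotients of determinants, the entries
  of the inverse are seen to be differentiable.\<close>

lemma matrix_inv_entry:
  fixes A :: "real^'m^'m"
  assumes "det A \<noteq> 0"
  shows "matrix_inv A $ i $ j = det (\<chi> r s. if s = i then axis j 1 $ r else A $ r $ s) / det A"
proof -
  have "A *v (matrix_inv A *v axis j 1) = axis j 1"
    by (simp add: matrix_vector_mul_assoc matrix_inv_works[OF assms])
  then have "matrix_inv A *v axis j 1 = (\<chi> k. det (\<chi> r s. if s = k then axis j 1 $ r else A $ r $ s) / det A)"
    using cramer[OF assms] by blast
  then have "(matrix_inv A *v axis j 1) $ i = det (\<chi> r s. if s = i then axis j 1 $ r else A $ r $ s) / det A"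
    by simp
  then show ?thesis by (simp add: matrix_vector_mul_component inner_axis)
qed

lemma differentiable_matrix_inv_entry:
  fixes H :: "'a::real_normed_vector \<Rightarrow> real^'m^'m"
  assumes H: "\<And>i j. (\<lambda>z. H z $ i $ j) differentiable at u"
    and S: "open S" "u \<in> S" "\<And>z. z \<in> S \<Longrightarrow> det (H z) \<noteq> 0"
  shows "(\<lambda>z. matrix_inv (H z) $ i $ j) differentiable at u"
proof -
  have det: "(\<lambda>z. det (K z)) differentiable at u"
    if "\<And>i j. (\<lambda>z. K z $ i $ j) differentiable at u" for K :: "'a \<Rightarrow> real^'m^'m"
    using has_derivative_det[of K "\<lambda>v i j. frechet_derivative (\<lambda>z. K z $ i $ j) (at u) v" u]
      that frechet_derivative_works differentiable_def by blast
  have "(\<lambda>z. (if s = i then axis j 1 $ r else H z $ r $ s) :: real) differentiable at u" for r s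
    using H by (cases "s = i") auto
  then have "(\<lambda>z. det (\<chi> r s. if s = i then axis j 1 $ r else H z $ r $ s) / det (H z)) differentiable at u"
    using S H by (intro differentiable_divide det) auto
  then obtain D where "((\<lambda>z. det (\<chi> r s. if s = i then axis j 1 $ r else H z $ r $ s) / det (H z)) has_derivative D) (at u)"
    unfolding differentiable_def by blast
  then have "((\<lambda>z. matrix_inv (H z) $ i $ j) has_derivative D) (at u)"
    by (rule has_derivative_transform_within_open[OF _ S(1,2)]) (use S(3) in \<open>simp add: matrix_inv_entry\<close>)
  then show ?thesis unfolding differentiable_def by blast
qed

lemma det_replace_row:
  fixes A :: "real^'m^'m"
  assumes "det A \<noteq> 0"
  shows "det (\<chi> i. if i = k then b else A $ i) = (\<Sum>j\<in>UNIV. matrix_inv A $ j $ k * b $ j) * det A"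
proof -
  define x where "x = b v* matrix_inv A"
  have "x v* A = b"
    by (simp add: x_def vector_matrix_mul_assoc matrix_inv_works[OF assms])
  moreover have "x v* A = (\<Sum>i\<in>UNIV. x $ i *s row i A)"
    by (simp add: vec_eq_iff vector_matrix_mult_def row_def mult.commute)
  ultimately have sum_b: "(\<Sum>i\<in>UNIV. x $ i *s row i A) = b" by simp
  have "det (\<chi> i. if i = k then b else row i A) = x $ k * det A"
    using cramer_lemma_transpose[of k x A] unfolding sum_b .
  moreover have "(\<chi> i. if i = k then b else row i A) = (\<chi> i. if i = k then b else A $ i)"
    by (simp add: vec_eq_iff row_def)
  moreover have "x $ k = (\<Sum>j\<in>UNIV. matrix_inv A $ j $ k * b $ j)"
    by (simp add: x_def vector_matrix_mult_def mult.commute)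
  ultimately show ?thesis by simp
qed

text \<open>Jacobi's formula: the transposed Cramer rule evaluates the determinants with one row
  replaced by its derivative.\<close>

lemma has_derivative_det_inv:
  fixes H :: "'a::real_normed_vector \<Rightarrow> real^'m^'m"
  assumes "\<And>i j. ((\<lambda>z. H z $ i $ j) has_derivative (\<lambda>v. D v i j)) (at u)" and "det (H u) \<noteq> 0"
  shows "((\<lambda>z. det (H z)) has_derivative
    (\<lambda>v. det (H u) * (\<Sum>k\<in>UNIV. \<Sum>j\<in>UNIV. matrix_inv (H u) $ j $ k * D v k j))) (at u)"
  using has_derivative_det[OF assms(1)]
  by (simp add: det_replace_row[OF assms(2)] sum_distrib_left mult_ac)

text \<open>The trace with respect to \<open>h\<close> is invariant under isometries of
  \<open>h\<close>, while the symmetric part of \<open>B\<close> changes sign under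
  \<open>J\<close>. As the inverse of \<open>h\<close> is symmetric, only this symmetric part enters
  the trace.\<close>

lemma trace_eq_0_of_anti_invariant:
  fixes h B J :: "real^'m^'m"
  assumes det: "det h \<noteq> 0" and sym: "transpose h = h"
    and iso: "transpose J ** h ** J = h"
    and anti: "transpose J ** (B + transpose B) ** J = - (B + transpose B)"
  shows "(\<Sum>\<alpha>\<in>UNIV. \<Sum>\<beta>\<in>UNIV. matrix_inv h $ \<alpha> $ \<beta> * B $ \<alpha> $ \<beta>) = 0"
proof -
  let ?i = "matrix_inv h" and ?S = "B + transpose B"
  note inv = matrix_inv_works[OF det] and isym = matrix_inv_sym[OF det sym]
  have neg: "trace (X ** (- Y)) = - trace (X ** Y)" for X Y :: "real^'m^'m"
    by (simp add: trace_def matrix_matrix_mult_def sum_negf)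
  have "(?i ** transpose J ** h) ** J = mat 1"
    using iso inv by (metis matrix_mul_assoc)
  \<comment> \<open>A one-sided inverse of a square matrix is two-sided; this turns the invariance
    of \<open>h\<close> into that of its inverse.\<close>
  then have "J ** (?i ** transpose J ** h) = mat 1" by (simp add: matrix_left_right_inverse)
  then have J: "J ** ?i ** transpose J = ?i"
    using inv by (metis matrix_mul_assoc matrix_mul_lid matrix_mul_rid)
  have "trace (?i ** ?S) = trace (J ** (?i ** transpose J ** ?S))"
    by (subst J[symmetric]) (simp add: matrix_mul_assoc)
  also have "\<dots> = trace (?i ** (transpose J ** ?S ** J))"
    by (subst trace_mul_sym) (simp add: matrix_mul_assoc)
  also have "\<dots> = - trace (?i ** ?S)"
    unfolding anti neg ..
  finally have 0: "trace (?i ** ?S) = 0" by simp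
  have e: "?i $ a $ b = ?i $ b $ a" for a b using isym by (simp add: transpose_def vec_eq_iff)
  have "trace (?i ** ?S) = (\<Sum>\<alpha>\<in>UNIV. \<Sum>\<beta>\<in>UNIV. ?i $ \<alpha> $ \<beta> * B $ \<beta> $ \<alpha>) + (\<Sum>\<alpha>\<in>UNIV. \<Sum>\<beta>\<in>UNIV. ?i $ \<alpha> $ \<beta> * B $ \<alpha> $ \<beta>)"
    by (simp add: trace_def matrix_matrix_mult_def transpose_def distrib_left sum.distrib)
  also have "(\<Sum>\<alpha>\<in>UNIV. \<Sum>\<beta>\<in>UNIV. ?i $ \<alpha> $ \<beta> * B $ \<beta> $ \<alpha>) = (\<Sum>\<alpha>\<in>UNIV. \<Sum>\<beta>\<in>UNIV. ?i $ \<alpha> $ \<beta> * B $ \<alpha> $ \<beta>)"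
    by (subst sum.swap) (simp add: e)
  finally show ?thesis using 0 by simp
qed

text \<open>The product rule for the metric and for the Christoffel symbols at a moving point.
  Expansion in the bases leaves finitely many coefficients, so differentiability for fixed vectors
  \<open>a\<close>, \<open>b\<close> is enough.\<close>

lemma has_derivative_bilinear_param:
  fixes \<beta> :: "'x::real_normed_vector \<Rightarrow> 'a::euclidean_space \<Rightarrow> 'b::euclidean_space \<Rightarrow> 'c::real_normed_vector"
    and p :: "'u::real_normed_vector \<Rightarrow> 'x"
  assumes bil: "\<And>x. bilinear (\<beta> x)"
    and D: "\<And>a b. ((\<lambda>x. \<beta> x a b) has_derivative (\<lambda>c. D c a b)) (at (p u))"
    and p: "(p has_derivative p') (at u)"
    and q: "(q has_derivative q') (at u)"
    and r: "(r has_derivative r') (at u)"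
  shows "((\<lambda>z. \<beta> (p z) (q z) (r z)) has_derivative
    (\<lambda>h. D (p' h) (q u) (r u) + \<beta> (p u) (q' h) (r u) + \<beta> (p u) (q u) (r' h))) (at u)"
proof -
  have exp: "\<beta> x a b = (\<Sum>i\<in>Basis. \<Sum>j\<in>Basis. ((a \<bullet> i) * (b \<bullet> j)) *\<^sub>R \<beta> x i j)" for x a b
  proof -
    have "\<beta> x a b = \<beta> x (\<Sum>i\<in>Basis. (a \<bullet> i) *\<^sub>R i) (\<Sum>j\<in>Basis. (b \<bullet> j) *\<^sub>R j)"
      by (simp add: euclidean_representation)
    also have "\<dots> = (\<Sum>i\<in>Basis. \<Sum>j\<in>Basis. ((a \<bullet> i) * (b \<bullet> j)) *\<^sub>R \<beta> x i j)"
      by (simp add: bilinear_sum[OF bil] sum.cartesian_product[symmetric] bilinear_lmul[OF bil]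
          bilinear_rmul[OF bil] mult.commute)
    finally show ?thesis .
  qed
  \<comment> \<open>The bilinearity of \<open>D c\<close> is not assumed; it follows from the
    uniqueness of derivatives.\<close>
  have Dexp: "D c a b = (\<Sum>i\<in>Basis. \<Sum>j\<in>Basis. ((a \<bullet> i) * (b \<bullet> j)) *\<^sub>R D c i j)" for c a b
  proof -
    have "((\<lambda>x. \<beta> x a b) has_derivative
        (\<lambda>c. \<Sum>i\<in>Basis. \<Sum>j\<in>Basis. ((a \<bullet> i) * (b \<bullet> j)) *\<^sub>R D c i j)) (at (p u))"
      by (subst exp) (intro has_derivative_sum has_derivative_scaleR_right D)
    from has_derivative_unique[OF D this] show ?thesis by (rule fun_cong)
  qed
  have comp: "((\<lambda>z. \<beta> (p z) i j) has_derivative (\<lambda>h. D (p' h) i j)) (at u)" for i j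
    using has_derivative_compose[OF p D[of i j]] .
  have "((\<lambda>z. \<Sum>i\<in>Basis. \<Sum>j\<in>Basis. ((q z \<bullet> i) * (r z \<bullet> j)) *\<^sub>R \<beta> (p z) i j) has_derivative
      (\<lambda>h. \<Sum>i\<in>Basis. \<Sum>j\<in>Basis. ((q u \<bullet> i) * (r u \<bullet> j)) *\<^sub>R D (p' h) i j +
         ((q u \<bullet> i) * (r' h \<bullet> j) + (q' h \<bullet> i) * (r u \<bullet> j)) *\<^sub>R \<beta> (p u) i j)) (at u)"
    by (intro has_derivative_sum has_derivative_scaleR has_derivative_mult comp
        has_derivative_inner_left q r)
  moreover have "(\<Sum>i\<in>Basis. \<Sum>j\<in>Basis. ((q u \<bullet> i) * (r u \<bullet> j)) *\<^sub>R D (p' h) i j +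
         ((q u \<bullet> i) * (r' h \<bullet> j) + (q' h \<bullet> i) * (r u \<bullet> j)) *\<^sub>R \<beta> (p u) i j)
      = D (p' h) (q u) (r u) + \<beta> (p u) (q' h) (r u) + \<beta> (p u) (q u) (r' h)" for h
    unfolding Dexp[of _ "q u"] exp[of _ "q' h"] exp[of _ "q u" "r' h"]
    by (simp add: sum.distrib scaleR_add_left)
  moreover have "(\<lambda>z. \<beta> (p z) (q z) (r z)) =
      (\<lambda>z. \<Sum>i\<in>Basis. \<Sum>j\<in>Basis. ((q z \<bullet> i) * (r z \<bullet> j)) *\<^sub>R \<beta> (p z) i j)"
    by (rule ext, rule exp)
  ultimately show ?thesis by simp
qed

text \<open>In the contracted symbol the last two of the three derivatives cancel by symmetry. What
  remains is half the logarithmic derivative of \<open>det h\<close>, by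
  \<open>has_derivative_det_inv\<close>.\<close>

lemma christoffel_trace:
  assumes D: "\<And>i j. ((\<lambda>z. h z $ i $ j) has_derivative (\<lambda>v. D v i j)) (at u)"
    and sym: "\<And>v i j. D v i j = D v j i"
    and h: "det (h u) \<noteq> 0" "transpose (h u) = h u"
  shows "(\<Sum>\<gamma>\<in>UNIV. christoffel h u \<gamma> \<alpha> \<gamma>) =
    (\<Sum>k\<in>UNIV. \<Sum>j\<in>UNIV. matrix_inv (h u) $ j $ k * D (axis \<alpha> 1) k j) / 2"
proof -
  let ?i = "matrix_inv (h u)"
  have p: "partial i (\<lambda>z. h z $ j $ k) u = D (axis i 1) j k" for i j k
    unfolding partial_def frechet_derivative_at[OF D, symmetric] ..
  have e: "?i $ a $ b = ?i $ b $ a" for a b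
    using matrix_inv_sym[OF h] by (simp add: transpose_def vec_eq_iff)
  have "(\<Sum>\<gamma>\<in>UNIV. \<Sum>l\<in>UNIV. ?i $ \<gamma> $ l * D (axis \<gamma> 1) l \<alpha>) = (\<Sum>\<gamma>\<in>UNIV. \<Sum>l\<in>UNIV. ?i $ \<gamma> $ l * D (axis l 1) \<alpha> \<gamma>)"
    by (subst sum.swap) (simp add: e sym)
  then show ?thesis
    by (simp add: christoffel_def p sum_distrib_left[symmetric] distrib_left right_diff_distrib sum.distrib
        sum_subtractf sum_divide_distrib[symmetric])
      (rule sum.swap)
qed

text \<open>If vol is a constant multiple of the Riemannian volume, the density factor of the contact
  tensor is parallel.\<close>

lemma contact_curl_density_eq_divergence:
  fixes h :: "real^'m \<Rightarrow> real^'m^'m"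
  assumes S: "open S" "u \<in> S"
    and D: "\<And>i j. ((\<lambda>z. h z $ i $ j) has_derivative (\<lambda>v. D v i j)) (at u)"
    and \<theta>: "\<And>\<beta>. (\<lambda>z. \<theta> z $ \<beta>) differentiable at u"
    and h: "\<And>z. z \<in> S \<Longrightarrow> det (h z) > 0" "\<And>z. z \<in> S \<Longrightarrow> transpose (h z) = h z"
    and K: "K > 0" "\<And>z. z \<in> S \<Longrightarrow> (vol_coeff l \<theta> z)\<^sup>2 = K * det (h z)"
  shows "contact_curl_density l h \<theta> u = vol_power l \<theta> u *
    (\<Sum>\<alpha>\<in>UNIV. \<Sum>\<beta>\<in>UNIV. matrix_inv (h u) $ \<alpha> $ \<beta> * cov_deriv_form h \<theta> u \<alpha> \<beta>)"
proof -
  define lam where "lam = - 1 / (real l + 1)"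
  define \<phi> where "\<phi> = vol_power l \<theta>"
  \<comment> \<open>Since \<open>K * det (h z)\<close> is the square of \<open>vol_coeff\<close>,
    the power \<open>lam\<close> of the absolute value is the power \<open>lam / 2\<close> of this
    positive function, which can be differentiated.\<close>
  define r where "r = lam / 2"
  define tr where "tr v = (\<Sum>k\<in>UNIV. \<Sum>j\<in>UNIV. matrix_inv (h u) $ j $ k * D v k j)" for v
  have sym: "D v i j = D v j i" for v i j
  proof -
    have "h z $ j $ i = h z $ i $ j" if "z \<in> S" for z using h(2)[OF that] by (simp add: transpose_def vec_eq_iff)
    then have "((\<lambda>z. h z $ i $ j) has_derivative (\<lambda>v. D v j i)) (at u)"
      using has_derivative_transform_within_open[OF D[of j i] S] by simp
    from has_derivative_unique[OF D[of i j] this] show ?thesis by (rule fun_cong)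
  qed
  have \<phi>: "\<phi> z = (K * det (h z)) powr r" if "z \<in> S" for z
  proof -
    have "vol_coeff l \<theta> z \<noteq> 0" using K(2)[OF that] h(1)[OF that] K(1) by auto
    then have "(\<bar>vol_coeff l \<theta> z\<bar> powr 2) powr r = \<phi> z"
      unfolding powr_powr \<phi>_def vol_power_def lam_def[symmetric] by (simp add: r_def)
    then show ?thesis using K(2)[OF that] by simp
  qed
  have pos: "K * det (h u) > 0" using h(1) S K by simp
  have "((\<lambda>z. (K * det (h z)) powr r) has_derivative
      (\<lambda>v. (K * (det (h u) * tr v)) * (r * (K * det (h u)) powr (r - 1)))) (at u)"
    by (rule has_derivative_compose[OF has_derivative_mult_right[OF has_derivative_det_inv[OF D]]
       has_real_derivative_powr[OF pos, unfolded has_field_derivative_def, THEN has_derivative_eq_rhs], unfolded tr_def[symmetric]])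
      (use h(1)[OF S(2)] in \<open>auto simp: tr_def mult.commute\<close>)
  also have "(\<lambda>v. (K * (det (h u) * tr v)) * (r * (K * det (h u)) powr (r - 1))) = (\<lambda>v. r * tr v * \<phi> u)"
    using pos by (simp add: \<phi>[OF S(2)] powr_diff fun_eq_iff)
  finally have d\<phi>: "(\<phi> has_derivative (\<lambda>v. r * tr v * \<phi> u)) (at u)"
    by (rule has_derivative_transform_within_open[OF _ S]) (simp add: \<phi>)
  \<comment> \<open>The derivative of \<open>\<phi>\<close> is \<open>lam\<close> times half the
    trace \<open>tr\<close>, times \<open>\<phi>\<close>; by \<open>christoffel_trace\<close> this
    is exactly the term that the covariant derivative of a density subtracts.\<close>
  have "cov_deriv_density h lam \<phi> u \<alpha> = 0" for \<alpha>
    unfolding cov_deriv_density_def partial_def frechet_derivative_at[OF d\<phi>, symmetric]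
    using christoffel_trace[OF D sym] h S by (simp add: tr_def r_def less_imp_neq[symmetric])
  moreover have "\<phi> differentiable at u" using d\<phi> by (auto simp: differentiable_def)
  ultimately have "cov_deriv_weighted_form h lam (contact_tensor l \<theta>) u \<alpha> \<beta> = \<phi> u * cov_deriv_form h \<theta> u \<alpha> \<beta>" for \<alpha> \<beta>
    unfolding contact_tensor_def \<phi>_def[symmetric] using \<theta> by (simp add: cov_deriv_weighted_form_Leibniz)
  then show ?thesis
    unfolding contact_curl_density_def lam_def[symmetric] \<phi>_def[symmetric]
    by (simp add: sum_distrib_left mult.left_commute)
qed

section \<open>Orthonormal bases, bilinear forms and lowered Christoffel symbols\<close>

lemma orthonormal_extension:
  fixes G :: "real^'n^'n"
  assumes sym: "transpose G = G" and pos: "\<And>v. v \<noteq> 0 \<Longrightarrow> v \<bullet> (G *v v) > 0"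
    and y: "y \<bullet> (G *v y) = 1"
  obtains e :: "nat \<Rightarrow> real^'n" where "e 0 = y"
    "\<And>i j. i < CARD('n) \<Longrightarrow> j < CARD('n) \<Longrightarrow> e i \<bullet> (G *v e j) = of_bool (i = j)"
proof -
  have bil: "bilinear (\<lambda>a b. a \<bullet> (G *v b))"
    by (auto simp: bilinear_def intro!: linearI simp: inner_simps matrix_vector_right_distrib matrix_vector_mult_scaleR)
  have comm: "a \<bullet> (G *v b) = b \<bullet> (G *v a)" for a b
    by (metis dot_lmul_matrix inner_commute sym transpose_matrix_vector)
  have "\<exists>e. e 0 = y \<and> (\<forall>i<k. \<forall>j<k. e i \<bullet> (G *v e j) = of_bool (i = j))"
    if "1 \<le> k" "k \<le> CARD('n)" for k
    using that
  proof (induction k rule: dec_induct)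
    case base
    then show ?case using y by (intro exI[of _ "\<lambda>_. y"]) auto
  next
    case (step k)
    then obtain e where e: "e 0 = y" "\<And>i j. i < k \<Longrightarrow> j < k \<Longrightarrow> e i \<bullet> (G *v e j) = of_bool (i = j)"
      by auto
    have "dim (span (e ` {..<k})) \<le> k"
      using dim_le_card'[of "e ` {..<k}"] card_image_le[of "{..<k}" e] by auto
    moreover have "dim (UNIV :: (real^'n) set) = CARD('n)" by (simp add: dim_UNIV)
    ultimately have "span (e ` {..<k}) \<noteq> UNIV" using step.prems by (metis Suc_n_not_le_n order_trans)
    then obtain w where w: "w \<notin> span (e ` {..<k})" by auto
    define w' where "w' = w - (\<Sum>i<k. (e i \<bullet> (G *v w)) *\<^sub>R e i)"
    have "(\<Sum>i<k. (e i \<bullet> (G *v w)) *\<^sub>R e i) \<in> span (e ` {..<k})"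
      by (rule span_sum, rule span_scale, rule span_base) simp
    then have "w' \<noteq> 0" unfolding w'_def using w eq_iff_diff_eq_0[of w] by metis
    define s where "s = sqrt (w' \<bullet> (G *v w'))"
    have s: "s > 0" "s * s = w' \<bullet> (G *v w')" using pos[OF \<open>w' \<noteq> 0\<close>] by (auto simp: s_def)
    have orth: "e j \<bullet> (G *v w') = 0" if "j < k" for j
    proof -
      have "e j \<bullet> (G *v w') = e j \<bullet> (G *v w) - (\<Sum>i<k. (e i \<bullet> (G *v w)) * (e j \<bullet> (G *v e i)))"
        unfolding w'_def by (simp add: matrix_vector_mult_diff_distrib inner_diff_right
            linear_sum[OF matrix_vector_mul_linear] inner_sum_right matrix_vector_mult_scaleR)
      also have "(\<Sum>i<k. (e i \<bullet> (G *v w)) * (e j \<bullet> (G *v e i))) = (\<Sum>i<k. if i = j then e i \<bullet> (G *v w) else 0)"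
        using e that by (intro sum.cong) auto
      finally show ?thesis using that by simp
    qed
    define e' where "e' = e(k := (1 / s) *\<^sub>R w')"
    have "e' i \<bullet> (G *v e' j) = of_bool (i = j)" if "i < Suc k" "j < Suc k" for i j
    proof -
      have "w' \<bullet> (G *v e j) = 0" if "j < k" for j using orth[OF that] comm[of w' "e j"] by simp
      moreover have "w' \<bullet> (G *v w') / (s * s) = 1" unfolding s(2)[symmetric] using s(1) by simp
      ultimately show ?thesis
        using that e(2) orth by (auto simp: e'_def less_Suc_eq matrix_vector_mult_scaleR)
    qed
    moreover have "e' 0 = y" using step e by (simp add: e'_def)
    ultimately show ?case by blast
  qed
  from this[of "CARD('n)"] that show thesis by (auto simp: Suc_le_eq)
qed

lemma matrix_eq_bilinear:
  fixes A B :: "real^'m^'k"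
  assumes "\<And>a b. a \<bullet> (A *v b) = a \<bullet> (B *v b)"
  shows "A = B"
proof -
  have "A *v b = B *v b" for b using assms vector_eq_ldot by blast
  then show ?thesis by (simp add: matrix_eq)
qed

lemma inner_vec_lambda_linear:
  fixes f :: "real^'m \<Rightarrow> real"
  assumes "linear f"
  shows "(\<chi> \<alpha>. f (axis \<alpha> 1)) \<bullet> b = f b"
proof -
  have "f b = f (\<Sum>\<alpha>\<in>UNIV. b $ \<alpha> *s axis \<alpha> 1)" by (simp add: basis_expansion)
  also have "\<dots> = (\<Sum>\<alpha>\<in>UNIV. b $ \<alpha> * f (axis \<alpha> 1))"
    by (simp add: linear_sum[OF assms] linear_scale[OF assms] scalar_mult_eq_scaleR)
  finally show ?thesis by (simp add: inner_vec_def mult.commute)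
qed

text \<open>Lets matrices of components be treated as bilinear forms on arbitrary vectors; the
  Sasaki metric in a chart is computed in this way.\<close>

lemma inner_matrix_bilinear:
  fixes f :: "real^'m \<Rightarrow> real^'m \<Rightarrow> real"
  assumes "bilinear f"
  shows "a \<bullet> ((\<chi> \<alpha> \<beta>. f (axis \<alpha> 1) (axis \<beta> 1)) *v b) = f a b"
proof -
  have lin: "linear (f x)" "linear (\<lambda>x. f x y)" for x y using assms by (auto simp: bilinear_def)
  have "(\<chi> \<alpha> \<beta>. f (axis \<alpha> 1) (axis \<beta> 1)) *v b = (\<chi> \<alpha>. f (axis \<alpha> 1) b)"
  proof -
    have "(\<Sum>\<beta>\<in>UNIV. f (axis \<alpha> 1) (axis \<beta> 1) * b $ \<beta>) = f (axis \<alpha> 1) b" for \<alpha>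
      using inner_vec_lambda_linear[OF lin(1), of "axis \<alpha> 1" b] by (simp add: inner_vec_def)
    then show ?thesis by (simp add: matrix_vector_mult_def)
  qed
  then show ?thesis using inner_vec_lambda_linear[OF lin(2), of b a] by (simp add: inner_commute)
qed

lemma has_derivative_matrixI:
  fixes H :: "'a::real_normed_vector \<Rightarrow> real^'m^'k"
  assumes "\<And>i j. ((\<lambda>z. H z $ i $ j) has_derivative (\<lambda>v. D v $ i $ j)) (at u)"
  shows "(H has_derivative D) (at u)"
  unfolding has_derivative_componentwise_within[of H]
  using assms by (auto simp: Basis_vec_def inner_axis)

lemma bilinear_inner_matrix: "bilinear (\<lambda>a b. a \<bullet> ((A :: real^'m^'k) *v b))"
  by (auto simp: bilinear_def intro!: linearI simp: inner_simps matrix_vector_right_distrib matrix_vector_mult_scaleR)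

lemma has_derivative_inner_matrix:
  fixes H :: "'a::real_normed_vector \<Rightarrow> real^'m^'k"
  assumes "(H has_derivative D) (at u)"
  shows "((\<lambda>z. a \<bullet> (H z *v b)) has_derivative (\<lambda>v. a \<bullet> (D v *v b))) (at u)"
  unfolding inner_vec_def matrix_vector_mult_def
  by (auto intro!: has_derivative_sum has_derivative_mult_right has_derivative_mult_left
      bounded_linear.has_derivative[OF bounded_linear_vec_nth] assms)

lemma trace_form_eq_0_of_anti_invariant:
  fixes h :: "real^'m^'m" and E :: "real^'m \<Rightarrow> real^'m \<Rightarrow> real" and J :: "real^'m \<Rightarrow> real^'m"
  assumes det: "det h \<noteq> 0" and sym: "transpose h = h" and E: "bilinear E" and J: "linear J"
    and iso: "\<And>a b. J a \<bullet> (h *v J b) = a \<bullet> (h *v b)"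
    and anti: "\<And>a b. E (J a) (J b) + E (J b) (J a) = - (E a b + E b a)"
  shows "(\<Sum>\<alpha>\<in>UNIV. \<Sum>\<beta>\<in>UNIV. matrix_inv h $ \<alpha> $ \<beta> * E (axis \<alpha> 1) (axis \<beta> 1)) = 0"
proof -
  define B where "B = (\<chi> \<alpha> \<beta>. E (axis \<alpha> 1) (axis \<beta> 1))"
  have B: "a \<bullet> (B *v b) = E a b" for a b unfolding B_def by (rule inner_matrix_bilinear[OF E])
  have tr: "a \<bullet> (transpose X *v b) = b \<bullet> (X *v a)" for X :: "real^'m^'m" and a b
    by (metis dot_lmul_matrix inner_commute transpose_matrix_vector transpose_transpose)
  have J': "matrix J *v a = J a" for a using matrix_works[of J] J by simp
  have conj: "a \<bullet> (transpose (matrix J) ** X ** matrix J *v b) = J a \<bullet> (X *v J b)" for X :: "real^'m^'m" and a b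
  proof -
    have "a \<bullet> (transpose (matrix J) ** X ** matrix J *v b) = a \<bullet> (transpose (matrix J) *v (X *v (matrix J *v b)))"
      by (simp only: matrix_vector_mul_assoc matrix_mul_assoc)
    also have "\<dots> = (X *v J b) \<bullet> J a" unfolding tr J' ..
    finally show ?thesis by (simp only: inner_commute)
  qed
  have "transpose (matrix J) ** h ** matrix J = h"
    by (rule matrix_eq_bilinear) (simp only: conj iso)
  moreover have "transpose (matrix J) ** (B + transpose B) ** matrix J = - (B + transpose B)"
  proof (rule matrix_eq_bilinear)
    fix a b
    have add: "p \<bullet> ((B + transpose B) *v q) = E p q + E q p" for p q
      by (simp only: matrix_vector_mult_add_rdistrib inner_add_right tr B)
    have "a \<bullet> (- X *v b) = - (a \<bullet> (X *v b))" for X :: "real^'m^'m"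
      by (simp add: inner_vec_def matrix_vector_mult_def sum_negf)
    then show "a \<bullet> (transpose (matrix J) ** (B + transpose B) ** matrix J *v b) = a \<bullet> (- (B + transpose B) *v b)"
      by (simp only: conj add anti)
  qed
  ultimately show ?thesis
    using trace_eq_0_of_anti_invariant[OF det sym, of "matrix J" B] by (simp add: B_def)
qed

text \<open>The Koszul formula for constant vector fields, i.e. the Christoffel symbols of the first
  kind. It removes the inverse matrix from all later computations and serves both the metric of the
  base and that of the sphere bundle.\<close>

lemma christoffel_lower:
  fixes G :: "real^'n \<Rightarrow> real^'n^'n"
  assumes D: "(G has_derivative D) (at x)" and det: "det (G x) \<noteq> 0"
  shows "c \<bullet> (G x *v (\<chi> i. \<Sum>j\<in>UNIV. \<Sum>k\<in>UNIV. christoffel G x i j k * a $ j * b $ k)) =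
    (c \<bullet> (D a *v b) + c \<bullet> (D b *v a) - a \<bullet> (D c *v b)) / 2"
proof -
  define d where "d j l k = D (axis j 1) $ l $ k" for j l k
  define t where "t l j k = d j l k + d k l j - d l j k" for l j k
  have p: "partial i (\<lambda>z. G z $ j $ k) x = d i j k" for i j k
  proof -
    have "((\<lambda>z. G z $ j $ k) has_derivative (\<lambda>v. D v $ j $ k)) (at x)"
      by (intro bounded_linear.has_derivative[OF bounded_linear_vec_nth] D)
    then show ?thesis unfolding partial_def d_def using frechet_derivative_at by metis
  qed
  have lin: "linear D" using D has_derivative_linear by blast
  have form: "p \<bullet> (D v *v q) = (\<Sum>l\<in>UNIV. \<Sum>j\<in>UNIV. \<Sum>k\<in>UNIV. p $ l * v $ j * q $ k * d j l k)" for p v q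
  proof -
    have "D v = D (\<Sum>j\<in>UNIV. v $ j *s axis j 1)" by (simp add: basis_expansion)
    also have "\<dots> = (\<Sum>j\<in>UNIV. v $ j *\<^sub>R D (axis j 1))"
      by (simp add: linear_sum[OF lin] linear_scale[OF lin] scalar_mult_eq_scaleR)
    finally have "D v $ l $ k = (\<Sum>j\<in>UNIV. v $ j * d j l k)" for l k by (simp add: d_def)
    then have "p \<bullet> (D v *v q) = (\<Sum>l\<in>UNIV. \<Sum>k\<in>UNIV. \<Sum>j\<in>UNIV. p $ l * v $ j * q $ k * d j l k)"
      by (simp add: inner_vec_def matrix_vector_mult_def sum_distrib_left sum_distrib_right mult_ac)
    also have "\<dots> = (\<Sum>l\<in>UNIV. \<Sum>j\<in>UNIV. \<Sum>k\<in>UNIV. p $ l * v $ j * q $ k * d j l k)"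
      by (rule sum.cong[OF refl], rule sum.swap)
    finally show ?thesis .
  qed
  define T where "T = (\<chi> l. \<Sum>j\<in>UNIV. \<Sum>k\<in>UNIV. t l j k * a $ j * b $ k)"
  have "(\<chi> i. \<Sum>j\<in>UNIV. \<Sum>k\<in>UNIV. christoffel G x i j k * a $ j * b $ k) = (1/2) *\<^sub>R (matrix_inv (G x) *v T)"
  proof -
    have "(\<Sum>j\<in>UNIV. \<Sum>k\<in>UNIV. christoffel G x i j k * a $ j * b $ k) =
        (1/2) * (\<Sum>l\<in>UNIV. \<Sum>j\<in>UNIV. \<Sum>k\<in>UNIV. matrix_inv (G x) $ i $ l * (t l j k * a $ j * b $ k))" for i
    proof -
      have "(\<Sum>j\<in>UNIV. \<Sum>k\<in>UNIV. christoffel G x i j k * a $ j * b $ k) =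
          (\<Sum>j\<in>UNIV. \<Sum>k\<in>UNIV. \<Sum>l\<in>UNIV. (1/2) * (matrix_inv (G x) $ i $ l * (t l j k * a $ j * b $ k)))"
        unfolding christoffel_def p t_def[symmetric] sum_distrib_left sum_distrib_right
        by (intro sum.cong refl) simp
      also have "\<dots> = (\<Sum>j\<in>UNIV. \<Sum>l\<in>UNIV. \<Sum>k\<in>UNIV. (1/2) * (matrix_inv (G x) $ i $ l * (t l j k * a $ j * b $ k)))"
        by (rule sum.cong[OF refl], rule sum.swap)
      also have "\<dots> = (\<Sum>l\<in>UNIV. \<Sum>j\<in>UNIV. \<Sum>k\<in>UNIV. (1/2) * (matrix_inv (G x) $ i $ l * (t l j k * a $ j * b $ k)))"
        by (rule sum.swap)
      finally show ?thesis unfolding sum_distrib_left .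
    qed
    then show ?thesis
      by (simp add: vec_eq_iff T_def matrix_vector_mult_def sum_distrib_left)
  qed
  then have "G x *v (\<chi> i. \<Sum>j\<in>UNIV. \<Sum>k\<in>UNIV. christoffel G x i j k * a $ j * b $ k) = (1/2) *\<^sub>R T"
    by (simp add: matrix_vector_mult_scaleR matrix_vector_mul_assoc matrix_inv_works[OF det])
  moreover have "c \<bullet> T = c \<bullet> (D a *v b) + c \<bullet> (D b *v a) - a \<bullet> (D c *v b)"
  proof -
    have "c \<bullet> T = (\<Sum>l\<in>UNIV. \<Sum>j\<in>UNIV. \<Sum>k\<in>UNIV. c $ l * a $ j * b $ k * d j l k)
        + (\<Sum>l\<in>UNIV. \<Sum>j\<in>UNIV. \<Sum>k\<in>UNIV. c $ l * b $ k * a $ j * d k l j)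
        - (\<Sum>l\<in>UNIV. \<Sum>j\<in>UNIV. \<Sum>k\<in>UNIV. a $ j * c $ l * b $ k * d l j k)"
      by (simp add: T_def t_def inner_vec_def sum_distrib_left algebra_simps sum.distrib sum_subtractf)
    moreover have "(\<Sum>l\<in>UNIV. \<Sum>j\<in>UNIV. \<Sum>k\<in>UNIV. c $ l * b $ k * a $ j * d k l j) = c \<bullet> (D b *v a)"
      unfolding form by (rule sum.cong[OF refl], rule sum.swap)
    moreover have "(\<Sum>l\<in>UNIV. \<Sum>j\<in>UNIV. \<Sum>k\<in>UNIV. a $ j * c $ l * b $ k * d l j k) = a \<bullet> (D c *v b)"
      unfolding form by (rule sum.swap)
    ultimately show ?thesis by (simp add: form)
  qed
  ultimately show ?thesis by simp
qed

section \<open>Geometry of the unit sphere bundle in a chart\<close>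

text \<open>G is the metric in a chart of the base, and F = (x, y) is the inclusion of the sphere bundle,
  in some chart of it, into the tangent bundle in the induced coordinates.\<close>

locale sphere_chart =
  fixes G :: "real^'n \<Rightarrow> real^'n^'n" and V :: "(real^'n) set"
    and F :: "real^'m \<Rightarrow> (real^'n) \<times> (real^'n)" and U :: "(real^'m) set"
  assumes open_V: "open V" and open_U: "open U"
    and smooth_G: "smooth_on V G"
    and sym_G: "x \<in> V \<Longrightarrow> transpose (G x) = G x"
    and pos_G: "x \<in> V \<Longrightarrow> v \<noteq> 0 \<Longrightarrow> v \<bullet> (G x *v v) > 0"
    and smooth_F: "smooth_on U F"
    and inj_F: "u \<in> U \<Longrightarrow> inj (frechet_derivative F (at u))"
    and F_in_V: "u \<in> U \<Longrightarrow> fst (F u) \<in> V"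
    and unit_F: "u \<in> U \<Longrightarrow> snd (F u) \<bullet> (G (fst (F u)) *v snd (F u)) = 1"
    and card_m: "CARD('m) = 2 * CARD('n) - 1"
begin

definition gg :: "real^'n \<Rightarrow> real^'n \<Rightarrow> real^'n \<Rightarrow> real" where
  "gg x a b = a \<bullet> (G x *v b)"

definition Dg :: "real^'n \<Rightarrow> real^'n \<Rightarrow> real^'n \<Rightarrow> real^'n \<Rightarrow> real" where
  "Dg x c a b = a \<bullet> (frechet_derivative G (at x) c *v b)"

definition conn :: "real^'n \<Rightarrow> real^'n \<Rightarrow> real^'n \<Rightarrow> real^'n" where
  "conn x a b = (\<chi> i. \<Sum>j\<in>UNIV. \<Sum>k\<in>UNIV. christoffel G x i j k * a $ j * b $ k)"

definition Dconn :: "real^'n \<Rightarrow> real^'n \<Rightarrow> real^'n \<Rightarrow> real^'n \<Rightarrow> real^'n" where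
  "Dconn x c a b = frechet_derivative (\<lambda>z. conn z a b) (at x) c"

lemma bilinear_gg: "bilinear (gg x)"
  unfolding gg_def[abs_def] by (rule bilinear_inner_matrix)

lemmas gg_simps = bilinear_ladd[OF bilinear_gg] bilinear_radd[OF bilinear_gg]
  bilinear_lsub[OF bilinear_gg] bilinear_rsub[OF bilinear_gg]
  bilinear_lmul[OF bilinear_gg] bilinear_rmul[OF bilinear_gg]
  bilinear_lneg[OF bilinear_gg] bilinear_rneg[OF bilinear_gg]
  bilinear_lzero[OF bilinear_gg] bilinear_rzero[OF bilinear_gg]

lemma bilinear_conn: "bilinear (conn x)"
  unfolding bilinear_def conn_def
  by (auto intro!: linearI simp: vec_eq_iff algebra_simps sum.distrib sum_distrib_left)

lemmas conn_simps = bilinear_ladd[OF bilinear_conn] bilinear_radd[OF bilinear_conn]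
  bilinear_lsub[OF bilinear_conn] bilinear_rsub[OF bilinear_conn]
  bilinear_lmul[OF bilinear_conn] bilinear_rmul[OF bilinear_conn]
  bilinear_lneg[OF bilinear_conn] bilinear_rneg[OF bilinear_conn]
  bilinear_lzero[OF bilinear_conn] bilinear_rzero[OF bilinear_conn]

lemma gg_sym: "x \<in> V \<Longrightarrow> gg x a b = gg x b a"
  unfolding gg_def by (metis dot_lmul_matrix inner_commute sym_G transpose_matrix_vector)

lemma gg_pos: "x \<in> V \<Longrightarrow> v \<noteq> 0 \<Longrightarrow> gg x v v > 0"
  unfolding gg_def by (rule pos_G)

lemma gg_eq_0: "x \<in> V \<Longrightarrow> gg x v v = 0 \<longleftrightarrow> v = 0"
  using gg_pos[of x v] by (cases "v = 0") (auto simp: gg_simps)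

lemma det_G: "x \<in> V \<Longrightarrow> det (G x) \<noteq> 0"
  using pos_G[of x] matrix_left_invertible_ker[of "G x"] invertible_det_nz[of "G x"]
  unfolding invertible_left_inverse by fastforce

lemma G_derivative: "x \<in> V \<Longrightarrow> (G has_derivative frechet_derivative G (at x)) (at x)"
  by (rule smooth_on_imp_has_derivative[OF smooth_G])

lemma gg_derivative: "x \<in> V \<Longrightarrow> ((\<lambda>z. gg z a b) has_derivative (\<lambda>c. Dg x c a b)) (at x)"
  unfolding gg_def Dg_def by (rule has_derivative_inner_matrix[OF G_derivative])

lemma gg_chain:
  assumes "(p has_derivative p') (at u)" "(q has_derivative q') (at u)" "(r has_derivative r') (at u)" "p u \<in> V"
  shows "((\<lambda>z. gg (p z) (q z) (r z)) has_derivative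
    (\<lambda>h. Dg (p u) (p' h) (q u) (r u) + gg (p u) (q' h) (r u) + gg (p u) (q u) (r' h))) (at u)"
  by (rule has_derivative_bilinear_param[where \<beta> = gg and D = "Dg (p u)" and p = p,
        OF bilinear_gg gg_derivative[OF assms(4)] assms(1-3)])

lemma Dg_sym: "x \<in> V \<Longrightarrow> Dg x c a b = Dg x c b a"
proof -
  assume x: "x \<in> V"
  have "((\<lambda>z. gg z a b) has_derivative (\<lambda>c. Dg x c b a)) (at x)"
    by (rule has_derivative_transform_within_open[OF gg_derivative[OF x, of b a] open_V x]) (simp add: gg_sym)
  from has_derivative_unique[OF gg_derivative[OF x] this] show ?thesis by (rule fun_cong)
qed

lemma gg_conn: "x \<in> V \<Longrightarrow> gg x c (conn x a b) = (Dg x a c b + Dg x b c a - Dg x c a b) / 2"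
  unfolding gg_def Dg_def conn_def by (rule christoffel_lower[OF G_derivative det_G])

text \<open>\<open>Dconn\<close> is a \<open>frechet_derivative\<close> and has its meaning only
  where the Christoffel symbols are differentiable. They are built from entries of the inverse of
  \<open>G\<close> and from first derivatives of \<open>G\<close>, all differentiable by the
  smoothness of \<open>G\<close>.\<close>

lemma conn_derivative: "x \<in> V \<Longrightarrow> ((\<lambda>z. conn z a b) has_derivative (\<lambda>c. Dconn x c a b)) (at x)"
proof -
  assume x: "x \<in> V"
  have G: "(\<lambda>z. G z $ i $ j) differentiable at y" if "y \<in> V" for i j y
    using G_derivative[OF that]
    by (auto simp: differentiable_def intro!: exI bounded_linear.has_derivative[OF bounded_linear_vec_nth])
  have "(\<lambda>z. partial i (\<lambda>z. G z $ j $ k) z) differentiable at x" for i j k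
  proof -
    have p: "partial i (\<lambda>z. G z $ j $ k) y = frechet_derivative G (at y) (axis i 1) $ j $ k" if "y \<in> V" for y
    proof -
      have "((\<lambda>z. G z $ j $ k) has_derivative (\<lambda>v. frechet_derivative G (at y) v $ j $ k)) (at y)"
        by (intro bounded_linear.has_derivative[OF bounded_linear_vec_nth] G_derivative that)
      then show ?thesis unfolding partial_def using frechet_derivative_at by metis
    qed
    have "((\<lambda>z. frechet_derivative G (at z) (axis i 1) $ j $ k) has_derivative
        (\<lambda>c. second_deriv G x c (axis i 1) $ j $ k)) (at x)"
      by (intro bounded_linear.has_derivative[OF bounded_linear_vec_nth] smooth_on_has_second_deriv[OF smooth_G x])
    then have "((\<lambda>z. partial i (\<lambda>z. G z $ j $ k) z) has_derivative
        (\<lambda>c. second_deriv G x c (axis i 1) $ j $ k)) (at x)"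
      by (rule has_derivative_transform_within_open[OF _ open_V x]) (simp add: p)
    then show ?thesis by (auto simp: differentiable_def)
  qed
  moreover have "(\<lambda>z. matrix_inv (G z) $ i $ l) differentiable at x" for i l
    by (rule differentiable_matrix_inv_entry[OF G[OF x] open_V x det_G])
  ultimately have chr: "(\<lambda>z. christoffel G z i j k) differentiable at x" for i j k
    unfolding christoffel_def by (intro differentiable_mult differentiable_sum differentiable_add differentiable_diff) auto
  have "(\<lambda>z. conn z a b $ i) differentiable at x" for i
    unfolding conn_def using chr by (auto intro!: differentiable_sum differentiable_mult)
  then have "(\<lambda>z. conn z a b) differentiable at x"
    unfolding differentiable_componentwise_within[of "\<lambda>z. conn z a b"] by (auto simp: Basis_vec_def inner_axis)
  then show ?thesis unfolding Dconn_def using frechet_derivative_works by blast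
qed

lemma conn_chain:
  assumes "(p has_derivative p') (at u)" "(q has_derivative q') (at u)" "(r has_derivative r') (at u)" "p u \<in> V"
  shows "((\<lambda>z. conn (p z) (q z) (r z)) has_derivative
    (\<lambda>h. Dconn (p u) (p' h) (q u) (r u) + conn (p u) (q' h) (r u) + conn (p u) (q u) (r' h))) (at u)"
  by (rule has_derivative_bilinear_param[where \<beta> = conn and D = "Dconn (p u)" and p = p,
        OF bilinear_conn conn_derivative[OF assms(4)] assms(1-3)])

abbreviation "px u \<equiv> fst (F u)"
abbreviation "py u \<equiv> snd (F u)"
abbreviation "hor u a \<equiv> fst (frechet_derivative F (at u) a)"
abbreviation "dy u a \<equiv> snd (frechet_derivative F (at u) a)"

text \<open>The vertical component, i.e. delta y, of a tangent vector.\<close>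

definition ver :: "real^'m \<Rightarrow> real^'m \<Rightarrow> real^'n" where
  "ver u a = dy u a + conn (px u) (py u) (hor u a)"

definition theta :: "real^'m \<Rightarrow> real^'m" where
  "theta u = (\<chi> \<alpha>. liouville G (F u) (frechet_derivative F (at u) (axis \<alpha> 1)))"

definition metr :: "real^'m \<Rightarrow> real^'m^'m" where
  "metr u = (\<chi> \<alpha> \<beta>. sasaki G (F u) (frechet_derivative F (at u) (axis \<alpha> 1)) (frechet_derivative F (at u) (axis \<beta> 1)))"

lemma F_derivative: "u \<in> U \<Longrightarrow> (F has_derivative frechet_derivative F (at u)) (at u)"
  by (rule smooth_on_imp_has_derivative[OF smooth_F])

lemma linear_F: "u \<in> U \<Longrightarrow> linear (frechet_derivative F (at u))"
  using F_derivative has_derivative_linear by blast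

lemma linear_hor: "u \<in> U \<Longrightarrow> linear (\<lambda>a. hor u a)" and linear_dy: "u \<in> U \<Longrightarrow> linear (\<lambda>a. dy u a)"
  using linear_compose[OF linear_F linear_fst] linear_compose[OF linear_F linear_snd] by (auto simp: o_def)

lemma linear_ver: "u \<in> U \<Longrightarrow> linear (ver u)"
  unfolding ver_def[abs_def]
  by (rule linearI) (simp_all add: linear_add[OF linear_hor] linear_add[OF linear_dy] linear_scale[OF linear_hor]
      linear_scale[OF linear_dy] conn_simps scaleR_add_right)

text \<open>Here and in \<open>metr_inner\<close> the components in the chart give way to
  \<open>hor\<close> and \<open>ver\<close>, in terms of which the geometry below is
  computed.\<close>

lemma theta_inner: "u \<in> U \<Longrightarrow> theta u \<bullet> b = gg (px u) (hor u b) (py u)"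
proof -
  assume u: "u \<in> U"
  have "liouville G (F u) X = gg (px u) (fst X) (py u)" for X
    by (simp add: liouville_def gg_def split_beta inner_vec_def matrix_vector_mult_def sum_distrib_left mult_ac)
  moreover have "linear (\<lambda>b. gg (px u) (hor u b) (py u))"
    by (rule linearI) (simp_all add: linear_add[OF linear_hor[OF u]] linear_scale[OF linear_hor[OF u]] gg_simps)
  ultimately show ?thesis using inner_vec_lambda_linear unfolding theta_def by simp
qed

lemma metr_inner: "u \<in> U \<Longrightarrow> a \<bullet> (metr u *v b) = gg (px u) (hor u a) (hor u b) + gg (px u) (ver u a) (ver u b)"
proof -
  assume u: "u \<in> U"
  have d: "delta_y G (F u) X = snd X + conn (px u) (py u) (fst X)" for X
    by (simp add: delta_y_def conn_def split_beta vec_eq_iff)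
  have "sasaki G (F u) X Y = gg (px u) (fst X) (fst Y) + gg (px u) (delta_y G (F u) X) (delta_y G (F u) Y)" for X Y
    by (simp add: sasaki_def gg_def inner_vec_def matrix_vector_mult_def sum_distrib_left algebra_simps sum.distrib)
  then have "sasaki G (F u) (frechet_derivative F (at u) a) (frechet_derivative F (at u) b) =
      gg (px u) (hor u a) (hor u b) + gg (px u) (ver u a) (ver u b)" for a b
    unfolding ver_def d by simp
  moreover have "bilinear (\<lambda>a b. gg (px u) (hor u a) (hor u b) + gg (px u) (ver u a) (ver u b))"
    unfolding bilinear_def
    by (auto intro!: linearI simp: linear_add[OF linear_hor[OF u]] linear_scale[OF linear_hor[OF u]]
        linear_add[OF linear_ver[OF u]] linear_scale[OF linear_ver[OF u]] gg_simps algebra_simps)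
  ultimately show ?thesis
    unfolding metr_def
    using inner_matrix_bilinear[of "\<lambda>a b. gg (px u) (hor u a) (hor u b) + gg (px u) (ver u a) (ver u b)" a b]
    by (simp only:)
qed

lemma metr_sym: "u \<in> U \<Longrightarrow> transpose (metr u) = metr u"
proof (rule matrix_eq_bilinear)
  fix a b assume u: "u \<in> U"
  have "a \<bullet> (transpose (metr u) *v b) = b \<bullet> (metr u *v a)"
    by (metis dot_lmul_matrix inner_commute transpose_matrix_vector transpose_transpose)
  then show "a \<bullet> (transpose (metr u) *v b) = a \<bullet> (metr u *v b)"
    using gg_sym[OF F_in_V[OF u]] by (simp add: metr_inner[OF u])
qed

text \<open>\<open>hor\<close> and \<open>ver\<close> arise from the two components of the
  derivative of \<open>F\<close> by an invertible triangular change, and \<open>F\<close> is an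
  immersion.\<close>

lemma tangent_eq_0:
  assumes "u \<in> U" "hor u a = 0" "ver u a = 0"
  shows "a = 0"
proof -
  have "frechet_derivative F (at u) a = 0"
    using assms by (simp add: ver_def prod_eq_iff conn_simps)
  then show ?thesis
    using inj_F[OF assms(1)] linear_injective_0[OF linear_F[OF assms(1)]] by blast
qed

lemma metr_pos: "u \<in> U \<Longrightarrow> a \<noteq> 0 \<Longrightarrow> a \<bullet> (metr u *v a) > 0"
  using tangent_eq_0[of u a] gg_pos[OF F_in_V, of u] gg_eq_0[OF F_in_V, of u]
  by (smt (verit) metr_inner)

lemma det_metr: "u \<in> U \<Longrightarrow> det (metr u) \<noteq> 0"
  using metr_pos[of u] matrix_left_invertible_ker[of "metr u"] invertible_det_nz[of "metr u"]
  unfolding invertible_left_inverse by fastforce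

text \<open>Differentiating the equation of the sphere bundle.\<close>

lemma gg_ver: "u \<in> U \<Longrightarrow> gg (px u) (py u) (ver u a) = 0"
proof -
  assume u: "u \<in> U"
  note V = F_in_V[OF u]
  have "((\<lambda>z. gg (px z) (py z) (py z)) has_derivative
      (\<lambda>c. Dg (px u) (hor u c) (py u) (py u) + gg (px u) (dy u c) (py u) + gg (px u) (py u) (dy u c))) (at u)"
    by (intro gg_chain has_derivative_fst has_derivative_snd F_derivative u V)
  moreover have "((\<lambda>z. gg (px z) (py z) (py z)) has_derivative (\<lambda>c. 0)) (at u)"
    by (rule has_derivative_transform_within_open[OF has_derivative_const[of 1] open_U u])
      (simp add: gg_def unit_F)
  ultimately have "Dg (px u) (hor u a) (py u) (py u) + gg (px u) (dy u a) (py u) + gg (px u) (py u) (dy u a) = 0"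
    by (rule fun_cong[OF has_derivative_unique])
  then show ?thesis
    using gg_sym[OF V, of "dy u a" "py u"] gg_conn[OF V, of "py u" "py u" "hor u a"]
    by (simp add: ver_def gg_simps)
qed

text \<open>By comparison of dimensions, the preceding equation characterizes the tangent vectors.\<close>

lemma tangent_exists:
  assumes u: "u \<in> U" and v: "gg (px u) (py u) v = 0"
  obtains a where "hor u a = p" "ver u a = v"
proof -
  \<comment> \<open>By \<open>gg_ver\<close> this linear form on the ambient tangent space vanishes
    on vectors tangent to the sphere bundle. Its value at \<open>(0, py u)\<close> is 1, so its
    kernel is proper and is exhausted by the range of the injective derivative of \<open>F\<close>,
    of dimension \<open>2 * CARD('n) - 1\<close>.\<close>
  define L where "L X = gg (px u) (py u) (snd X + conn (px u) (py u) (fst X))" for X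
  define K where "K = {X. L X = 0}"
  have lin: "linear L"
    unfolding L_def by (rule linearI) (simp_all add: gg_simps conn_simps algebra_simps)
  have sub: "subspace K" unfolding K_def using lin by (rule linear_subspace_kernel)
  have y: "gg (px u) (py u) (py u) = 1" using unit_F[OF u] by (simp add: gg_def)
  have "K \<noteq> UNIV"
  proof
    assume "K = UNIV"
    then have "L (0, py u) = 0" by (auto simp: K_def)
    then show False using y by (simp add: L_def conn_simps)
  qed
  then have "dim K \<noteq> dim (UNIV :: ((real^'n) \<times> (real^'n)) set)"
    using subspace_dim_equal[OF sub subspace_UNIV] by fastforce
  then have "dim K < 2 * CARD('n)"
    using dim_subset[of K UNIV] by (simp add: dim_UNIV)
  moreover have "dim (range (frechet_derivative F (at u))) = 2 * CARD('n) - 1"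
    using dim_image_eq[OF linear_F[OF u], of UNIV] inj_F[OF u] card_m by (simp add: dim_UNIV)
  moreover have "range (frechet_derivative F (at u)) \<subseteq> K"
    using gg_ver[OF u] by (auto simp: K_def L_def ver_def)
  moreover have "subspace (range (frechet_derivative F (at u)))"
    using linear_subspace_image[OF linear_F[OF u] subspace_UNIV] .
  ultimately have "range (frechet_derivative F (at u)) = K"
    by (intro subspace_dim_equal sub) linarith+
  moreover have "(p, v - conn (px u) (py u) p) \<in> K"
    using v by (simp add: K_def L_def)
  ultimately obtain a where "frechet_derivative F (at u) a = (p, v - conn (px u) (py u) p)"
    by (metis imageE)
  then show thesis by (intro that[of a]) (simp_all add: ver_def)
qed

end

text \<open>Passing from the coordinate vectors to the frame \<open>b\<close> multiplies vol by the
  determinant of the frame, and orthonormality says that the square of this determinant is the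
  inverse of \<open>det h\<close>. The square on the left makes the orientation of the frame
  immaterial.\<close>

lemma vol_coeff_adapted_frame:
  fixes \<theta> :: "real^'m \<Rightarrow> real^'m" and h :: "real^'m^'m" and b :: "nat \<Rightarrow> real^'m"
  assumes card: "CARD('m) = 2 * l + 1"
    and diff: "\<And>v. (\<lambda>z. \<theta> z \<bullet> v) differentiable at u"
    and \<theta>: "\<And>j. j < 2 * l + 1 \<Longrightarrow> \<theta> u \<bullet> b j = of_bool (j = 0)"
    and d\<theta>: "\<And>i j. i < 2 * l + 1 \<Longrightarrow> j < 2 * l + 1 \<Longrightarrow> ext_deriv \<theta> u [b i, b j] = darboux_form [i, j]"
    and h: "\<And>i j. i < 2 * l + 1 \<Longrightarrow> j < 2 * l + 1 \<Longrightarrow> b i \<bullet> (h *v b j) = of_bool (i = j)"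
  shows "(vol_coeff l \<theta> u)\<^sup>2 = (darboux_volume l)\<^sup>2 * det h"
proof -
  let ?N = "2 * l + 1"
  define co where "co = (coordinate_order :: 'm list)"
  have "\<exists>xs. distinct xs \<and> set xs = (UNIV :: 'm set)" using finite_distinct_list[OF finite] by blast
  then have co: "distinct co" "set co = UNIV" unfolding co_def coordinate_order_def by (metis (mono_tags, lifting) someI_ex)+
  have len: "length co = ?N" using distinct_card[OF co(1)] co(2) card by simp
  define vol where "vol = wedge 1 (2 * l) (form_at \<theta> u) (wedge_power2 l (ext_deriv \<theta> u))"
  define f where "f x = vol (map x co)" for x
  define fd where "fd v = frechet_derivative (\<lambda>z. \<theta> z \<bullet> v) (at u)" for v
  have fd: "((\<lambda>z. \<theta> z \<bullet> v) has_derivative fd v) (at u)" for v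
    unfolding fd_def using diff frechet_derivative_works by blast
  have fd_lin: "linear (fd v)" "linear (\<lambda>v. fd v x)" for v x
  proof -
    show "linear (fd v)" using fd has_derivative_linear by blast
    have "fd (v + w) = (\<lambda>x. fd v x + fd w x)" for v w
      using has_derivative_unique[OF fd[of "v + w"]] has_derivative_add[OF fd[of v] fd[of w]] by (simp add: inner_add_right)
    moreover have "fd (c *\<^sub>R v) = (\<lambda>x. c * fd v x)" for v c
      using has_derivative_unique[OF fd[of "c *\<^sub>R v"]] has_derivative_mult_right[OF fd[of v], of c] by simp
    ultimately show "linear (\<lambda>v. fd v x)" by (intro linearI) auto
  qed
  have ext: "ext_deriv \<theta> u [v, w] = fd w v - fd v w" for v w by (simp add: ext_deriv_def fd_def)
  have "multilinear_form 2 (ext_deriv \<theta> u)"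
    unfolding multilinear_form_def
  proof (intro allI impI)
    fix vs :: "(real^'m) list" and p :: nat assume "length vs = 2" "p < 2"
    then obtain v w where "vs = [v, w]" "p = 0 \<or> p = 1"
      by (auto simp: numeral_2_eq_2 length_Suc_conv less_Suc_eq)
    then show "linear (\<lambda>x. ext_deriv \<theta> u (vs[p := x]))"
      using fd_lin by (auto simp: ext intro!: linear_compose_sub)
  qed
  moreover have "multilinear_form 1 (form_at \<theta> u)"
    unfolding multilinear_form_def form_at_def by (auto intro!: linearI simp: inner_simps)
  ultimately have "multilinear_form (1 + 2 * l) vol"
    unfolding vol_def by (intro multilinear_form_wedge multilinear_form_wedge_power2)
  then have mult: "multilinear_form ?N vol" by simp
  \<comment> \<open>The type of coordinates carries no order; \<open>idx\<close> is the position in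
    the chosen list \<open>co\<close> and translates between families over the type and lists of
    vectors.\<close>
  define idx where "idx i = (THE k. k < ?N \<and> co ! k = i)" for i
  have ex1: "\<exists>!k. k < ?N \<and> co ! k = i" for i
    using co len by (metis UNIV_I distinct_conv_nth in_set_conv_nth)
  have idx: "idx i < ?N" "co ! idx i = i" for i using theI'[OF ex1[of i]] by (auto simp: idx_def)
  have idx_co: "idx (co ! k) = k" if "k < ?N" for k
    using ex1[of "co ! k"] idx[of "co ! k"] that by blast
  have idx_inj: "idx i = idx j \<longleftrightarrow> i = j" for i j using idx(2) by metis
  have upd: "map (x(i := v)) co = (map x co)[idx i := v]" for x i v
    using idx_co idx by (intro nth_equalityI) (auto simp: nth_list_update len)
  have lin: "linear (\<lambda>v. f (x(i := v)))" for x i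
    using mult idx[of i] unfolding f_def upd multilinear_form_def by (simp add: len)
  have alt: "f (x \<circ> Transposition.transpose m n) = - f x" if "m \<noteq> n" for x m n
  proof -
    let ?\<tau> = "Transposition.transpose (idx m) (idx n)"
    have \<tau>: "?\<tau> permutes {..<1 + 2 * l}" using idx by (intro permutes_swap_id) auto
    have "map (x \<circ> Transposition.transpose m n) co = map (\<lambda>k. map x co ! ?\<tau> k) [0..<1 + 2 * l]"
    proof (rule nth_equalityI)
      fix k assume "k < length (map (x \<circ> Transposition.transpose m n) co)"
      then have k: "k < ?N" by (simp add: len)
      then have "?\<tau> k < ?N" using permutes_in_image[OF \<tau>, of k] by simp
      moreover have "co ! ?\<tau> k = Transposition.transpose m n (co ! k)"
        using idx idx_co[OF k] by (auto simp: Transposition.transpose_def)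
      ultimately show "map (x \<circ> Transposition.transpose m n) co ! k = map (\<lambda>k. map x co ! ?\<tau> k) [0..<1 + 2 * l] ! k"
        using k by (simp add: len del: upt_Suc)
    qed (simp add: len)
    then have "f (x \<circ> Transposition.transpose m n) = of_int (sign ?\<tau>) * vol (map x co)"
      unfolding f_def vol_def using wedge_permute[OF \<tau>, of "map x co"] len by simp
    then show ?thesis using that idx_inj by (simp add: sign_swap_id f_def)
  qed
  \<comment> \<open>The rows of \<open>A\<close> are the frame vectors, placed so that reading them
    along \<open>co\<close> gives \<open>b 0\<close>, \<open>b 1\<close>, and so on.\<close>
  define A where "A = (\<chi> i. b (idx i))"
  have "(\<lambda>i. \<Sum>j\<in>UNIV. A $ i $ j *\<^sub>R axis j 1) = (\<lambda>i. b (idx i))"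
    using basis_expansion by (auto simp: A_def scalar_mult_eq_scaleR[symmetric])
  then have "f (\<lambda>i. b (idx i)) = det A * f (\<lambda>i. axis i 1)"
    using alternating_multilinear_det[of f A "\<lambda>i. axis i 1", OF lin alt] by simp
  moreover have "f (\<lambda>i. axis i 1) = vol_coeff l \<theta> u"
    by (simp add: f_def vol_def vol_coeff_def co_def)
  moreover have "f (\<lambda>i. b (idx i)) = darboux_volume l"
  proof -
    have "map (\<lambda>i. b (idx i)) co = map b [0..<?N]"
      using idx_co by (intro nth_equalityI) (auto simp: len simp del: upt_Suc)
    moreover have "vol (map b [0..<?N]) = wedge 1 (2 * l) (\<lambda>is. form_at \<theta> u (map b is)) (\<lambda>is. wedge_power2 l (ext_deriv \<theta> u) (map b is)) [0..<?N]"
      unfolding vol_def by (rule wedge_map) simp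
    moreover have "\<dots> = darboux_volume l"
      unfolding darboux_volume_def
    proof (rule wedge_cong)
      fix js :: "nat list" assume js: "length js = 1" "set js \<subseteq> set [0..<?N]"
      then obtain j where "js = [j]" "j < ?N" by (auto simp: length_Suc_conv)
      then show "form_at \<theta> u (map b js) = of_bool (js ! 0 = 0)" using \<theta> by (simp add: form_at_def)
    next
      fix js :: "nat list" assume js: "length js = 2 * l" "set js \<subseteq> set [0..<?N]"
      show "wedge_power2 l (ext_deriv \<theta> u) (map b js) = wedge_power2 l darboux_form js"
        unfolding wedge_power2_map[OF js(1)]
      proof (rule wedge_power2_cong[OF _ js])
        fix ks :: "nat list" assume "length ks = 2" "set ks \<subseteq> set [0..<?N]"
        then obtain i j where "ks = [i, j]" "i < ?N" "j < ?N" by (auto simp: numeral_2_eq_2 length_Suc_conv)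
        then show "ext_deriv \<theta> u (map b ks) = darboux_form ks" using d\<theta> by simp
      qed
    qed simp
    ultimately show ?thesis by (simp only: f_def)
  qed
  ultimately have v: "det A * vol_coeff l \<theta> u = darboux_volume l" by simp
  \<comment> \<open>Orthonormality of the frame; on determinants it gives the factor that relates
    \<open>det A\<close> to \<open>det h\<close>.\<close>
  have "A ** h ** transpose A = mat 1"
  proof -
    have "(A ** h ** transpose A) $ i $ j = A $ i \<bullet> (h *v A $ j)" for i j
      by (simp add: matrix_matrix_mult_def transpose_def inner_vec_def matrix_vector_mult_def
          sum_distrib_left sum_distrib_right mult_ac) (rule sum.swap)
    then show ?thesis using h idx idx_inj by (simp add: vec_eq_iff A_def mat_def)
  qed
  then have "det A * det h * det A = 1" by (metis det_I det_mul det_transpose)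
  moreover have "(det A * vol_coeff l \<theta> u)\<^sup>2 * det h = (vol_coeff l \<theta> u)\<^sup>2 * (det A * det h * det A)"
    by (simp add: power2_eq_square)
  ultimately have "(vol_coeff l \<theta> u)\<^sup>2 = (det A * vol_coeff l \<theta> u)\<^sup>2 * det h" by simp
  then show ?thesis unfolding v .
qed

section \<open>Derivatives of the contact form and of the metric; adapted frames\<close>

context sphere_chart
begin

abbreviation "F2 u a b \<equiv> second_deriv F u a b"

text \<open>\<open>Dver\<close>, \<open>Dtheta\<close> and \<open>Dmetr\<close> are the derivatives
  in the direction \<open>c\<close> of \<open>ver\<close>, \<open>theta\<close> and
  \<open>metr\<close> evaluated on vectors that are constant in the chart. Such constant fields
  commute, so no bracket terms occur below.\<close>

definition Dver :: "real^'m \<Rightarrow> real^'m \<Rightarrow> real^'m \<Rightarrow> real^'n" where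
  "Dver u c b = snd (F2 u c b) + (Dconn (px u) (hor u c) (py u) (hor u b) + conn (px u) (dy u c) (hor u b)
     + conn (px u) (py u) (fst (F2 u c b)))"

definition Dtheta :: "real^'m \<Rightarrow> real^'m \<Rightarrow> real^'m \<Rightarrow> real" where
  "Dtheta u c b = Dg (px u) (hor u c) (hor u b) (py u) + gg (px u) (fst (F2 u c b)) (py u) + gg (px u) (hor u b) (dy u c)"

definition Dmetr :: "real^'m \<Rightarrow> real^'m \<Rightarrow> real^'m \<Rightarrow> real^'m \<Rightarrow> real" where
  "Dmetr u c a b = (Dg (px u) (hor u c) (hor u a) (hor u b) + gg (px u) (fst (F2 u c a)) (hor u b)
      + gg (px u) (hor u a) (fst (F2 u c b)))
    + (Dg (px u) (hor u c) (ver u a) (ver u b) + gg (px u) (Dver u c a) (ver u b)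
      + gg (px u) (ver u a) (Dver u c b))"

lemma
  assumes u: "u \<in> U"
  shows px_derivative: "((\<lambda>z. px z) has_derivative (\<lambda>c. hor u c)) (at u)"
    and py_derivative: "((\<lambda>z. py z) has_derivative (\<lambda>c. dy u c)) (at u)"
    and hor_derivative: "((\<lambda>z. hor z b) has_derivative (\<lambda>c. fst (F2 u c b))) (at u)"
    and dy_derivative: "((\<lambda>z. dy z b) has_derivative (\<lambda>c. snd (F2 u c b))) (at u)"
  using F_derivative[OF u] smooth_on_has_second_deriv[OF smooth_F u]
  by (auto intro: has_derivative_fst has_derivative_snd)

lemma ver_derivative: "u \<in> U \<Longrightarrow> ((\<lambda>z. ver z b) has_derivative (\<lambda>c. Dver u c b)) (at u)"
  unfolding ver_def Dver_def
  by (intro has_derivative_add dy_derivative conn_chain px_derivative py_derivative hor_derivative F_in_V)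

lemma theta_derivative: "u \<in> U \<Longrightarrow> ((\<lambda>z. theta z \<bullet> b) has_derivative (\<lambda>c. Dtheta u c b)) (at u)"
  unfolding Dtheta_def
  by (rule has_derivative_transform_within_open[OF gg_chain[OF px_derivative hor_derivative py_derivative F_in_V] open_U])
    (auto simp: theta_inner)

lemma metr_derivative: "u \<in> U \<Longrightarrow> ((\<lambda>z. a \<bullet> (metr z *v b)) has_derivative (\<lambda>c. Dmetr u c a b)) (at u)"
  unfolding Dmetr_def
  by (rule has_derivative_transform_within_open[OF has_derivative_add[OF
      gg_chain[OF px_derivative hor_derivative hor_derivative F_in_V]
      gg_chain[OF px_derivative ver_derivative ver_derivative F_in_V]] open_U])
    (auto simp: metr_inner)

text \<open>The second derivatives of \<open>F\<close> cancel by symmetry. Writing \<open>dy\<close>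
  through \<open>ver\<close> produces Christoffel terms, which by \<open>gg_conn\<close> cancel the
  derivatives of the metric.\<close>

lemma ext_deriv_theta:
  assumes u: "u \<in> U"
  shows "ext_deriv theta u [a, b] = gg (px u) (hor u b) (ver u a) - gg (px u) (hor u a) (ver u b)"
proof -
  note V = F_in_V[OF u]
  have "ext_deriv theta u [a, b] = Dtheta u a b - Dtheta u b a"
    by (simp add: ext_deriv_def frechet_derivative_at[OF theta_derivative[OF u], symmetric])
  moreover have "dy u c = ver u c - conn (px u) (py u) (hor u c)" for c by (simp add: ver_def)
  ultimately show ?thesis
    using gg_conn[OF V, of "hor u a" "py u" "hor u b"] gg_conn[OF V, of "hor u b" "py u" "hor u a"]
      Dg_sym[OF V, of "py u" "hor u a" "hor u b"] Dg_sym[OF V, of "hor u a" "hor u b" "py u"]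
      Dg_sym[OF V, of "hor u b" "hor u a" "py u"]
    unfolding Dtheta_def second_deriv_sym[OF open_U smooth_F u, of b a]
    by (simp add: gg_simps field_simps)
qed

lemma linear_F2: "u \<in> U \<Longrightarrow> linear (\<lambda>a. F2 u a b)" "u \<in> U \<Longrightarrow> linear (\<lambda>b. F2 u a b)"
  using second_deriv_linear[OF smooth_F _ open_U] by auto

lemma vol_coeff_theta:
  assumes u: "u \<in> U"
  shows "(vol_coeff (CARD('n) - 1) theta u)\<^sup>2 = (darboux_volume (CARD('n) - 1))\<^sup>2 * det (metr u)"
proof -
  note V = F_in_V[OF u]
  have N: "2 * (CARD('n) - 1) + 1 = CARD('m)" using card_m zero_less_card_finite[where 'a='n] by linarith
  obtain e :: "nat \<Rightarrow> real^'n" where e0: "e 0 = py u"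
    and e: "\<And>i j. i < CARD('n) \<Longrightarrow> j < CARD('n) \<Longrightarrow> e i \<bullet> (G (px u) *v e j) = of_bool (i = j)"
    using orthonormal_extension[of "G (px u)" "py u"] sym_G[OF V] pos_G[OF V] unit_F[OF u] by blast
  \<comment> \<open>Index 0 is the spray, as \<open>e 0\<close> is \<open>py u\<close>. For i > 0
    the vertical lift of \<open>e i\<close> has the index 2 i - 1 and the horizontal lift the index
    2 i; with the vertical one first, dtheta is 1 on the pair.\<close>
  define H where "H j = (if even j then e (j div 2) else 0)" for j :: nat
  define W where "W j = (if odd j then e (Suc j div 2) else 0)" for j :: nat
  have idx: "j div 2 < CARD('n)" "odd j \<Longrightarrow> Suc j div 2 < CARD('n)" if "j < CARD('m)" for j
    using that card_m by (auto elim!: oddE)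
  have gg_e: "gg (px u) (e i) (e j) = of_bool (i = j)" if "i < CARD('n)" "j < CARD('n)" for i j
    unfolding gg_def using e[OF that] .
  have HH: "gg (px u) (H i) (H j) = of_bool (i = j \<and> even i)"
    and WW: "gg (px u) (W i) (W j) = of_bool (i = j \<and> odd i)"
    and HW: "gg (px u) (H j) (W i) = of_bool (odd i \<and> j = Suc i)" if "i < CARD('m)" "j < CARD('m)" for i j
  proof -
    show "gg (px u) (H i) (H j) = of_bool (i = j \<and> even i)"
      using idx[OF that(1)] idx[OF that(2)] by (auto simp: H_def gg_e gg_simps elim!: evenE)
    show "gg (px u) (W i) (W j) = of_bool (i = j \<and> odd i)"
      using idx[OF that(1)] idx[OF that(2)] by (auto simp: W_def gg_e gg_simps elim!: oddE)
    show "gg (px u) (H j) (W i) = of_bool (odd i \<and> j = Suc i)"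
      using idx[OF that(1)] idx[OF that(2)] by (auto simp: H_def W_def gg_e gg_simps elim!: oddE evenE)
  qed
  have m0: "0 < CARD('m)" by simp
  \<comment> \<open>The vertical lift of \<open>e 0\<close> itself does not occur in the frame, so
    all vertical parts are orthogonal to \<open>py u\<close> and the vectors are tangent to the
    sphere bundle.\<close>
  have "gg (px u) (py u) (W j) = 0" if "j < CARD('m)" for j
    using HW[OF that m0] e0 by (simp add: H_def)
  then have "\<exists>a. hor u a = H j \<and> ver u a = W j" if "j < CARD('m)" for j
    using tangent_exists[OF u] that by metis
  then obtain b where b: "\<And>j. j < CARD('m) \<Longrightarrow> hor u (b j) = H j \<and> ver u (b j) = W j" by metis
  show ?thesis
  proof (rule vol_coeff_adapted_frame[where b = b])
    show "CARD('m) = 2 * (CARD('n) - 1) + 1" using N by simp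
    show "(\<lambda>z. theta z \<bullet> v) differentiable at u" for v
      using theta_derivative[OF u] by (auto simp: differentiable_def)
    show "theta u \<bullet> b j = of_bool (j = 0)" if "j < 2 * (CARD('n) - 1) + 1" for j
      using HH[of j 0] b that e0 unfolding N theta_inner[OF u] by (auto simp: H_def)
    show "ext_deriv theta u [b i, b j] = darboux_form [i, j]"
      if "i < 2 * (CARD('n) - 1) + 1" "j < 2 * (CARD('n) - 1) + 1" for i j
      using that b HW unfolding N ext_deriv_theta[OF u] by (simp add: darboux_form_def)
    show "b i \<bullet> (metr u *v b j) = of_bool (i = j)"
      if "i < 2 * (CARD('n) - 1) + 1" "j < 2 * (CARD('n) - 1) + 1" for i j
      using that b HH WW unfolding N metr_inner[OF u] by auto
  qed
qed

text \<open>The sign is read off from \<open>vol_coeff_theta\<close>, whose left-hand side is a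
  square; \<open>det_metr\<close> excludes 0.\<close>

lemma det_metr_pos:
  assumes u: "u \<in> U"
  shows "det (metr u) > 0"
proof -
  have "0 \<le> (darboux_volume (CARD('n) - 1))\<^sup>2 * det (metr u)"
    unfolding vol_coeff_theta[OF u, symmetric] by simp
  then have "det (metr u) \<ge> 0" using darboux_volume_pos[of "CARD('n) - 1"] by (simp add: zero_le_mult_iff)
  then show ?thesis using det_metr[OF u] by simp
qed

lemma vol_power_theta_nonzero:
  assumes u: "u \<in> U"
  shows "vol_power (CARD('n) - 1) theta u \<noteq> 0"
proof -
  have "vol_coeff (CARD('n) - 1) theta u \<noteq> 0"
    using vol_coeff_theta[OF u] det_metr[OF u] darboux_volume_pos[of "CARD('n) - 1"] by auto
  then show ?thesis by (simp add: vol_power_def)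
qed

text \<open>The equation \<open>gg_ver\<close> of the tangent vectors is invariant under the change
  of sign of \<open>ver\<close>, so the reflected vector exists. It is unique by
  \<open>tangent_eq_0\<close>, and uniqueness gives linearity.\<close>

lemma reflection_exists:
  assumes u: "u \<in> U"
  obtains J where "linear J" "\<And>a. hor u (J a) = hor u a" "\<And>a. ver u (J a) = - ver u a"
proof -
  have "\<exists>b. hor u b = hor u a \<and> ver u b = - ver u a" for a
    using tangent_exists[OF u, of "- ver u a"] gg_ver[OF u] by (metis bilinear_rneg[OF bilinear_gg] minus_zero)
  then obtain J where J: "\<And>a. hor u (J a) = hor u a" "\<And>a. ver u (J a) = - ver u a" by metis
  have eq: "a = b" if "hor u a = hor u b" "ver u a = ver u b" for a b
    using tangent_eq_0[OF u, of "a - b"] that by (simp add: linear_diff[OF linear_hor[OF u]] linear_diff[OF linear_ver[OF u]])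
  have "linear J"
    by (rule linearI; rule eq) (simp_all add: J linear_add[OF linear_hor[OF u]] linear_add[OF linear_ver[OF u]]
      linear_scale[OF linear_hor[OF u]] linear_scale[OF linear_ver[OF u]])
  with J show thesis by (intro that)
qed

end

section \<open>Vanishing of the curl density and nondegeneracy of dtheta\<close>

context sphere_chart
begin

text \<open>\<open>Z\<close> is the geodesic spray. Being the metric dual of the contact form, it
  turns the contraction of \<open>theta\<close> with Christoffel symbols into a lowered
  symbol.\<close>

lemma spray_exists:
  assumes u: "u \<in> U"
  obtains Z where "hor u Z = py u" "ver u Z = 0" "\<And>a. Z \<bullet> (metr u *v a) = theta u \<bullet> a"
proof -
  obtain Z where Z: "hor u Z = py u" "ver u Z = 0"
    using tangent_exists[OF u, of 0] by (auto simp: gg_simps)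
  moreover have "Z \<bullet> (metr u *v a) = theta u \<bullet> a" for a
    using gg_sym[OF F_in_V[OF u]] by (simp add: metr_inner[OF u] theta_inner[OF u] Z gg_simps)
  ultimately show thesis by (rule that)
qed

text \<open>Twice the covariant derivative of the contact form is, after symmetrization, the Lie derivative
  of the metric along the spray. It pairs horizontal with vertical components only, and is therefore
  anti-invariant under the reflection of the vertical components.\<close>

lemma lie_derivative_mixed:
  assumes u: "u \<in> U" and Z: "hor u Z = py u" "ver u Z = 0"
  defines "E \<equiv> \<lambda>a b. Dtheta u a b - (Dmetr u a Z b + Dmetr u b Z a - Dmetr u Z a b) / 2"
    and "x \<equiv> px u" and "y \<equiv> py u"
  defines "R \<equiv> \<lambda>w. Dconn x w y y - conn x (conn x y w) y - Dconn x y y w + conn x (conn x y y) w"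
  shows "E a b + E b a = gg x (hor u b) (ver u a) + gg x (hor u a) (ver u b)
    - gg x (R (hor u a)) (ver u b) - gg x (R (hor u b)) (ver u a)"
proof -
  have V: "x \<in> V" unfolding x_def by (rule F_in_V[OF u])
  have dy: "dy u c = ver u c - conn x y (hor u c)" for c by (simp add: ver_def x_def y_def)
  have F2: "F2 u Z c = F2 u c Z" "F2 u b a = F2 u a b" for c
    by (rule second_deriv_sym[OF open_U smooth_F u])+
  \<comment> \<open>Exchanging the directions \<open>Z\<close> and \<open>c\<close> in the
    derivative of \<open>ver\<close> costs the curvature: \<open>R w\<close> is the curvature of
    \<open>w\<close> and \<open>y\<close>, applied to \<open>y\<close>, written in Christoffel
    symbols.\<close>
  have DZ: "Dver u Z c = Dver u c Z - R (hor u c) - conn x (ver u c) y" for c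
    unfolding Dver_def R_def by (simp add: dy Z F2 conn_simps x_def[symmetric] y_def[symmetric])
  have 1: "Dtheta u a b = Dg x (hor u a) (hor u b) y + gg x (fst (F2 u a b)) y
      + gg x (hor u b) (ver u a) - gg x (hor u b) (conn x y (hor u a))"
    unfolding Dtheta_def by (simp add: dy gg_simps x_def[symmetric] y_def[symmetric])
  have 2: "Dtheta u b a = Dg x (hor u b) (hor u a) y + gg x (fst (F2 u a b)) y
      + gg x (hor u a) (ver u b) - gg x (hor u a) (conn x y (hor u b))"
    unfolding Dtheta_def by (simp add: dy F2 gg_simps x_def[symmetric] y_def[symmetric])
  have Dg0: "Dg x c 0 q = 0" for c q by (simp add: Dg_def)
  have 3: "Dmetr u a Z b = Dg x (hor u a) y (hor u b) + gg x (fst (F2 u a Z)) (hor u b)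
      + gg x y (fst (F2 u a b)) + gg x (Dver u a Z) (ver u b)"
    unfolding Dmetr_def by (simp add: Z Dg0 gg_simps x_def[symmetric] y_def[symmetric])
  have 4: "Dmetr u b Z a = Dg x (hor u b) y (hor u a) + gg x (fst (F2 u b Z)) (hor u a)
      + gg x y (fst (F2 u a b)) + gg x (Dver u b Z) (ver u a)"
    unfolding Dmetr_def by (simp add: Z F2 Dg0 gg_simps x_def[symmetric] y_def[symmetric])
  have 5: "Dmetr u Z a b = Dg x y (hor u a) (hor u b) + gg x (fst (F2 u a Z)) (hor u b)
      + gg x (hor u a) (fst (F2 u b Z)) + Dg x y (ver u a) (ver u b)
      + (gg x (Dver u a Z) (ver u b) - gg x (R (hor u a)) (ver u b) - gg x (conn x (ver u a) y) (ver u b))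
      + (gg x (ver u a) (Dver u b Z) - gg x (ver u a) (R (hor u b)) - gg x (ver u a) (conn x (ver u b) y))"
    unfolding Dmetr_def by (simp add: Z F2 DZ gg_simps x_def[symmetric] y_def[symmetric])
  have 6: "Dmetr u Z b a = Dmetr u Z a b"
    unfolding Dmetr_def using gg_sym[OF V] Dg_sym[OF V] by (simp add: Z x_def[symmetric] y_def[symmetric])
  \<comment> \<open>The uses of \<open>gg_conn\<close> remove the purely horizontal terms and, since
    the connection is metric, the purely vertical ones. The second derivatives of \<open>F\<close>
    cancel.\<close>
  show ?thesis
    unfolding E_def 6 unfolding 1 2 3 4 5
    using gg_conn[OF V, of "hor u b" y "hor u a"] gg_conn[OF V, of "hor u a" y "hor u b"]
      gg_conn[OF V, of "ver u b" "ver u a" y] gg_conn[OF V, of "ver u a" "ver u b" y]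
      gg_sym[OF V, of "conn x (ver u a) y" "ver u b"]
      gg_sym[OF V, of y "fst (F2 u a b)"]
      gg_sym[OF V, of "hor u a" "fst (F2 u b Z)"] gg_sym[OF V, of "ver u a" "Dver u b Z"]
      gg_sym[OF V, of "ver u a" "R (hor u b)"]
      Dg_sym[OF V, of "hor u a" "hor u b" y] Dg_sym[OF V, of "hor u b" "hor u a" y]
      Dg_sym[OF V, of y "hor u a" "hor u b"] Dg_sym[OF V, of y "ver u a" "ver u b"]
      Dg_sym[OF V, of "ver u a" "ver u b" y] Dg_sym[OF V, of "ver u b" "ver u a" y]
    by (simp add: field_simps)
qed

lemma contact_curl_density_eq_0:
  assumes u: "u \<in> U"
  shows "contact_curl_density (CARD('n) - 1) metr theta u = 0"
proof -
  define Mt where "Mt c = (\<chi> \<alpha> \<beta>. Dmetr u c (axis \<alpha> 1) (axis \<beta> 1))" for c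
  have comp: "((\<lambda>z. metr z $ i $ j) has_derivative (\<lambda>c. Mt c $ i $ j)) (at u)" for i j
  proof -
    have "metr z $ i $ j = axis i 1 \<bullet> (metr z *v axis j 1)" for z
      by (simp add: inner_axis' matrix_vector_mul_component inner_axis)
    then show ?thesis using metr_derivative[OF u, of "axis i 1" "axis j 1"] by (simp add: Mt_def)
  qed
  have Md: "(metr has_derivative Mt) (at u)" by (rule has_derivative_matrixI[OF comp])
  have M: "p \<bullet> (Mt c *v q) = Dmetr u c p q" for p c q
    using has_derivative_unique[OF has_derivative_inner_matrix[OF Md, of p q] metr_derivative[OF u, of p q]]
    by (rule fun_cong)
  have theta_comp: "theta z $ \<beta> = theta z \<bullet> axis \<beta> 1" for z \<beta> by (simp add: inner_axis)
  obtain Z where Z: "hor u Z = py u" "ver u Z = 0" "\<And>a. Z \<bullet> (metr u *v a) = theta u \<bullet> a"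
    using spray_exists[OF u] by blast
  obtain J where J: "linear J" "\<And>a. hor u (J a) = hor u a" "\<And>a. ver u (J a) = - ver u a"
    using reflection_exists[OF u] by blast
  define E where "E a b = Dtheta u a b - (Dmetr u a Z b + Dmetr u b Z a - Dmetr u Z a b) / 2" for a b
  \<comment> \<open>By duality, \<open>theta\<close> of the contracted Christoffel symbol is the
    metric product of that symbol with \<open>Z\<close>, which \<open>christoffel_lower\<close>
    expresses by derivatives of the metric.\<close>
  have cov: "cov_deriv_form metr theta u \<alpha> \<beta> = E (axis \<alpha> 1) (axis \<beta> 1)" for \<alpha> \<beta>
  proof -
    have "partial \<alpha> (\<lambda>z. theta z $ \<beta>) u = Dtheta u (axis \<alpha> 1) (axis \<beta> 1)"
      unfolding partial_def theta_comp frechet_derivative_at[OF theta_derivative[OF u], symmetric] ..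
    moreover have "(\<Sum>\<delta>\<in>UNIV. christoffel metr u \<delta> \<alpha> \<beta> * theta u $ \<delta>) =
        theta u \<bullet> (\<chi> i. \<Sum>j\<in>UNIV. \<Sum>k\<in>UNIV. christoffel metr u i j k * axis \<alpha> 1 $ j * axis \<beta> 1 $ k)"
    proof -
      have "(\<Sum>k\<in>UNIV. c k * axis \<gamma> 1 $ k) = c \<gamma>" for c :: "'m \<Rightarrow> real" and \<gamma>
        by (simp add: axis_def if_distrib[of "\<lambda>x. _ * x"] cong: if_cong)
      then show ?thesis by (simp add: inner_vec_def mult.commute[of "theta u $ _"])
    qed
    ultimately show ?thesis
      unfolding cov_deriv_form_def E_def
      by (simp only: Z(3)[symmetric] christoffel_lower[OF Md det_metr[OF u]] M)
  qed
  have "bilinear E"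
  proof -
    have lin: "linear (\<lambda>a. Dtheta u a b)" "linear (\<lambda>b. Dtheta u a b)" for a b
    proof -
      show "linear (\<lambda>a. Dtheta u a b)" using theta_derivative[OF u] has_derivative_linear by blast
      note simps = linear_add[OF linear_hor[OF u]] linear_add[OF linear_F2(2)[OF u]]
        linear_scale[OF linear_hor[OF u]] linear_scale[OF linear_F2(2)[OF u]]
      show "linear (\<lambda>b. Dtheta u a b)" unfolding Dtheta_def Dg_def
        by (rule linearI) (simp_all add: simps gg_simps matrix_vector_right_distrib
            matrix_vector_mult_scaleR inner_add_left algebra_simps)
    qed
    have Mtl: "linear Mt" using Md has_derivative_linear by blast
    show ?thesis unfolding bilinear_def E_def M[symmetric]
      by (auto intro!: linearI simp: linear_add[OF lin(1)] linear_add[OF lin(2)] linear_scale[OF lin(1)] linear_scale[OF lin(2)]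
          linear_add[OF Mtl] linear_scale[OF Mtl] inner_add_left inner_add_right matrix_vector_mult_add_rdistrib
          matrix_vector_right_distrib matrix_vector_mult_scaleR scaleR_matrix_vector_assoc[symmetric] field_simps)
  qed
  have "(\<Sum>\<alpha>\<in>UNIV. \<Sum>\<beta>\<in>UNIV. matrix_inv (metr u) $ \<alpha> $ \<beta> * E (axis \<alpha> 1) (axis \<beta> 1)) = 0"
  proof (rule trace_form_eq_0_of_anti_invariant[OF det_metr[OF u] metr_sym[OF u] \<open>bilinear E\<close> J(1)])
    show "J a \<bullet> (metr u *v J b) = a \<bullet> (metr u *v b)" for a b
      by (simp add: metr_inner[OF u] J gg_simps)
    \<comment> \<open>Every term of \<open>lie_derivative_mixed\<close> has exactly one factor
      \<open>ver\<close>, and the curvature operator in it is applied to \<open>hor\<close>, which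
      \<open>J\<close> preserves.\<close>
    show "E (J a) (J b) + E (J b) (J a) = - (E a b + E b a)" for a b
      unfolding E_def lie_derivative_mixed[OF u Z(1,2)] by (simp add: J gg_simps)
  qed
  moreover have "contact_curl_density (CARD('n) - 1) metr theta u = vol_power (CARD('n) - 1) theta u *
      (\<Sum>\<alpha>\<in>UNIV. \<Sum>\<beta>\<in>UNIV. matrix_inv (metr u) $ \<alpha> $ \<beta> * cov_deriv_form metr theta u \<alpha> \<beta>)"
  proof (rule contact_curl_density_eq_divergence[OF open_U u comp])
    show "(\<lambda>z. theta z $ \<beta>) differentiable at u" for \<beta>
      unfolding theta_comp using theta_derivative[OF u] by (auto simp: differentiable_def)
    show "(darboux_volume (CARD('n) - 1))\<^sup>2 > 0" using darboux_volume_pos[of "CARD('n) - 1"] by simp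
  qed (use det_metr_pos metr_sym vol_coeff_theta in auto)
  ultimately show ?thesis by (simp add: cov)
qed

lemma ext_deriv_theta_nondegenerate:
  assumes u: "u \<in> U" and X: "theta u \<bullet> a = 0"
    and ker: "\<And>b. theta u \<bullet> b = 0 \<Longrightarrow> ext_deriv theta u [a, b] = 0"
  shows "a = 0"
proof -
  note V = F_in_V[OF u]
  have h: "gg (px u) (py u) (hor u a) = 0" using X gg_sym[OF V] by (simp add: theta_inner[OF u])
  then have "gg (px u) (py u) (- hor u a) = 0" by (simp add: gg_simps)
  \<comment> \<open>The test vector is the image of \<open>a\<close> under the almost complex
    structure of the contact hyperplane; dtheta of \<open>a\<close> and \<open>b\<close> is the
    squared length of \<open>a\<close>. That \<open>a\<close> lies in the hyperplane makes
    \<open>b\<close> tangent.\<close>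
  then obtain b where b: "hor u b = ver u a" "ver u b = - hor u a"
    using tangent_exists[OF u] by blast
  have "theta u \<bullet> b = 0" using gg_ver[OF u] gg_sym[OF V] by (simp add: theta_inner[OF u] b)
  from ker[OF this] have sum0: "gg (px u) (ver u a) (ver u a) + gg (px u) (hor u a) (hor u a) = 0"
    by (simp add: ext_deriv_theta[OF u] b gg_simps)
  have nn: "gg (px u) w w \<ge> 0" for w
    using gg_pos[OF V, of w] by (cases "w = 0") (auto simp: gg_simps)
  have "gg (px u) (ver u a) (ver u a) = 0" "gg (px u) (hor u a) (hor u a) = 0"
    using sum0 nn[of "ver u a"] nn[of "hor u a"] by linarith+
  then have "ver u a = 0" "hor u a = 0" using gg_eq_0[OF V] by auto
  then show ?thesis by (intro tangent_eq_0[OF u])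
qed

end

section \<open>Contact fields tangent to the contact hyperplanes\<close>

context sphere_chart
begin

text \<open>The vanishing of \<open>theta\<close> on \<open>Z\<close> is differentiated in space,
  and the preservation of the hyperplanes in time. Comparing the two shows that \<open>Z u\<close>
  is in the kernel of dtheta on the hyperplane, which is trivial.\<close>

lemma contact_field_in_hyperplane_eq_0:
  assumes smooth: "smooth_on U Z"
    and hyper: "\<And>w. w \<in> U \<Longrightarrow> theta w \<bullet> Z w = 0"
    and flow: "local_flow U Z \<epsilon> N \<Phi>" and u: "u \<in> N"
    and preserves: "\<And>t w. t \<in> {-\<epsilon><..<\<epsilon>} \<Longrightarrow> w \<in> N \<Longrightarrow>
      frechet_derivative (\<Phi> t) (at w) ` form_kernel (theta w) = form_kernel (theta (\<Phi> t w))"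
  shows "Z u = 0"
proof -
  \<comment> \<open>As one smooth map of time and space, the flow has symmetric mixed second
    derivatives.\<close>
  define \<psi> where "\<psi> = (\<lambda>(t, w). \<Phi> t w)"
  define S where "S = {-\<epsilon><..<\<epsilon>} \<times> N"
  have \<epsilon>: "\<epsilon> > 0" and N: "open N" "N \<subseteq> U" and sm: "smooth_on S \<psi>"
    and init: "\<And>w. w \<in> N \<Longrightarrow> \<Phi> 0 w = w"
    and vel: "\<And>t w. w \<in> N \<Longrightarrow> t \<in> {-\<epsilon><..<\<epsilon>} \<Longrightarrow> ((\<lambda>s. \<Phi> s w) has_vector_derivative Z (\<Phi> t w)) (at t)"
    using flow by (auto simp: local_flow_def \<psi>_def S_def)
  have uU: "u \<in> U" using u N by blast
  have S: "open S" "(t, w) \<in> S \<longleftrightarrow> - \<epsilon> < t \<and> t < \<epsilon> \<and> w \<in> N" for t w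
    using N by (auto simp: S_def open_Times)
  have S0: "(0, w) \<in> S \<longleftrightarrow> w \<in> N" for w using \<epsilon> by (simp add: S)
  note d\<psi> = smooth_on_imp_has_derivative[OF sm]
  have along_w: "((\<lambda>w. \<psi> (t, w)) has_derivative (\<lambda>v. frechet_derivative \<psi> (at (t, w)) (0, v))) (at w)"
    if "(t, w) \<in> S" for t w
    by (rule has_derivative_compose[of "\<lambda>w. (t, w)" "\<lambda>v. (0, v)" w UNIV \<psi>, OF _ d\<psi>[OF that]])
      (auto intro!: derivative_eq_intros)
  have along_t: "((\<lambda>t. \<psi> (t, w)) has_derivative (\<lambda>s. frechet_derivative \<psi> (at (t, w)) (s, 0))) (at t)"
    if "(t, w) \<in> S" for t w
    by (rule has_derivative_compose[of "\<lambda>t. (t, w)" "\<lambda>s. (s, 0)" t UNIV \<psi>, OF _ d\<psi>[OF that]])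
      (auto intro!: derivative_eq_intros)
  have w_deriv: "frechet_derivative (\<Phi> t) (at w) v = frechet_derivative \<psi> (at (t, w)) (0, v)" if "(t, w) \<in> S" for t w v
    using fun_cong[OF frechet_derivative_at[OF along_w[OF that]], of v] by (simp add: \<psi>_def)
  have t_deriv: "frechet_derivative \<psi> (at (t, w)) (1, 0) = Z (\<Phi> t w)" if "(t, w) \<in> S" for t w
    using has_derivative_unique[OF along_t[OF that], of "\<lambda>s. s *\<^sub>R Z (\<Phi> t w)"] vel[of w t] that
    by (auto simp: \<psi>_def S has_vector_derivative_def fun_eq_iff)
  have second: "((\<lambda>w. frechet_derivative \<psi> (at (t, w)) c) has_derivative (\<lambda>v. second_deriv \<psi> (t, w) (0, v) c)) (at w)"
      "((\<lambda>t. frechet_derivative \<psi> (at (t, w)) c) has_derivative (\<lambda>s. second_deriv \<psi> (t, w) (s, 0) c)) (at t)"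
    if "(t, w) \<in> S" for t w c
    by (rule has_derivative_compose[of "\<lambda>w. (t, w)" "\<lambda>v. (0, v)" w UNIV "\<lambda>z. frechet_derivative \<psi> (at z) c",
          OF _ smooth_on_has_second_deriv[OF sm that]], force intro!: derivative_eq_intros)
      (rule has_derivative_compose[of "\<lambda>t. (t, w)" "\<lambda>s. (s, 0)" t UNIV "\<lambda>z. frechet_derivative \<psi> (at z) c",
          OF _ smooth_on_has_second_deriv[OF sm that]], force intro!: derivative_eq_intros)
  define D where "D c = (\<chi> i. Dtheta u c (axis i 1))" for c
  have dth: "(theta has_derivative D) (at u)"
  proof -
    have "D c \<bullet> axis i 1 = Dtheta u c (axis i 1)" for c i by (simp add: D_def inner_axis)
    then show ?thesis
      unfolding has_derivative_componentwise_within[of theta]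
      using theta_derivative[OF uU] by (auto simp: Basis_vec_def)
  qed
  have D: "D c \<bullet> b = Dtheta u c b" for c b
    using has_derivative_unique[OF has_derivative_inner_left[OF dth, of b] theta_derivative[OF uU, of b]]
    by (rule fun_cong)
  \<comment> \<open>At time 0 the velocity of the flow is \<open>Z\<close> itself; its derivative in
    space is therefore the mixed second derivative.\<close>
  have dZ: "second_deriv \<psi> (0, u) (0, b) (1, 0) = frechet_derivative Z (at u) b" for b
  proof -
    have "((\<lambda>w. frechet_derivative \<psi> (at (0, w)) (1, 0)) has_derivative frechet_derivative Z (at u)) (at u)"
      by (rule has_derivative_transform_within_open[OF smooth_on_imp_has_derivative[OF smooth uU] N(1) u])
        (simp add: t_deriv S0 init)
    from has_derivative_unique[OF second(1) this] u show ?thesis by (auto simp: S0 fun_eq_iff)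
  qed
  have "ext_deriv theta u [Z u, b] = 0" if b: "theta u \<bullet> b = 0" for b
  proof -
    \<comment> \<open>The hyperplane condition, differentiated in the direction
      \<open>b\<close>.\<close>
    have "((\<lambda>w. theta w \<bullet> Z w) has_derivative (\<lambda>v. theta u \<bullet> frechet_derivative Z (at u) v + D v \<bullet> Z u)) (at u)"
      by (intro has_derivative_inner dth smooth_on_imp_has_derivative[OF smooth uU])
    moreover have "((\<lambda>w. theta w \<bullet> Z w) has_derivative (\<lambda>v. 0)) (at u)"
      by (rule has_derivative_transform_within_open[OF has_derivative_const[of 0] open_U uU]) (simp add: hyper)
    ultimately have "theta u \<bullet> frechet_derivative Z (at u) b + D b \<bullet> Z u = 0"
      by (rule fun_cong[OF has_derivative_unique])
    \<comment> \<open>The vector \<open>b\<close>, transported by the flow, stays in the kernel of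
      \<open>theta\<close>; this is differentiated at time 0.\<close>
    moreover have "theta u \<bullet> second_deriv \<psi> (0, u) (1, 0) (0, b) + D (Z u) \<bullet> b = 0"
    proof -
      have 0: "(0, u) \<in> S" using u by (simp add: S0)
      have \<psi>0: "\<psi> (0, u) = u" using u by (simp add: \<psi>_def init)
      have "frechet_derivative (\<Phi> 0) (at u) b = b"
        using frechet_derivative_cong_open[OF N(1) u, of "\<Phi> 0" "\<lambda>w. w"] init by simp
      then have b0: "frechet_derivative \<psi> (at (0, u)) (0, b) = b" by (simp add: w_deriv[OF 0])
      have "((\<lambda>t. theta (\<psi> (t, u))) has_derivative (\<lambda>s. D (frechet_derivative \<psi> (at (0, u)) (s, 0)))) (at 0)"
        by (rule has_derivative_compose[of "\<lambda>t. \<psi> (t, u)" _ 0 UNIV theta, OF along_t[OF 0]]) (use dth in \<open>simp add: \<psi>0\<close>)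
      from has_derivative_inner[OF this second(2)[OF 0, of "(0, b)"]]
      have "((\<lambda>t. theta (\<psi> (t, u)) \<bullet> frechet_derivative \<psi> (at (t, u)) (0, b)) has_derivative
        (\<lambda>s. theta u \<bullet> second_deriv \<psi> (0, u) (s, 0) (0, b) + D (frechet_derivative \<psi> (at (0, u)) (s, 0)) \<bullet> b)) (at 0)"
        by (simp add: \<psi>0 b0)
      moreover have "((\<lambda>t. theta (\<psi> (t, u)) \<bullet> frechet_derivative \<psi> (at (t, u)) (0, b)) has_derivative (\<lambda>s. 0)) (at 0)"
      proof (rule has_derivative_transform_within_open[OF has_derivative_const[of 0], of "{-\<epsilon><..<\<epsilon>}"])
        fix t assume t: "t \<in> {-\<epsilon><..<\<epsilon>}"
        have "frechet_derivative (\<Phi> t) (at u) b \<in> form_kernel (theta (\<Phi> t u))"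
          using preserves[OF t u] b by (auto simp: form_kernel_def)
        then show "0 = theta (\<psi> (t, u)) \<bullet> frechet_derivative \<psi> (at (t, u)) (0, b)"
          using t u w_deriv[of t u b] by (simp add: form_kernel_def \<psi>_def S)
      qed (use \<epsilon> in auto)
      ultimately have "theta u \<bullet> second_deriv \<psi> (0, u) (1, 0) (0, b) + D (frechet_derivative \<psi> (at (0, u)) (1, 0)) \<bullet> b = 0"
        by (rule fun_cong[OF has_derivative_unique])
      then show ?thesis using t_deriv[OF 0] u by (simp add: init)
    qed
    moreover have "second_deriv \<psi> (0, u) (1, 0) (0, b) = second_deriv \<psi> (0, u) (0, b) (1, 0)"
      using u by (intro second_deriv_sym[OF S(1) sm]) (simp add: S0)
    \<comment> \<open>The mixed derivatives agree, so the difference of the two equations is left,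
      and it is dtheta of \<open>Z u\<close> and \<open>b\<close>.\<close>
    ultimately have "Dtheta u (Z u) b = Dtheta u b (Z u)" by (simp add: dZ D)
    then show ?thesis
      by (simp add: ext_deriv_def frechet_derivative_at[OF theta_derivative[OF uU], symmetric])
  qed
  then show ?thesis using ext_deriv_theta_nondegenerate[OF uU hyper[OF uU]] by blast
qed

end

section \<open>Transition maps of submanifold charts\<close>

text \<open>A left inverse of \<open>L\<close> reduces the claim to a map \<open>p\<close> whose
  derivative at \<open>T u\<close> is the identity. Then \<open>q w - q u\<close> approximates
  \<open>T w - T u\<close> up to a small multiple of the latter, and continuity of \<open>T\<close>
  keeps \<open>T w\<close> where this holds. Charts of a submanifold are given as homeomorphisms,
  and this makes their transition maps differentiable.\<close>

lemma differentiable_of_comp_immersion: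
  fixes P :: "'b::euclidean_space \<Rightarrow> 'c::euclidean_space" and T :: "'a::real_normed_vector \<Rightarrow> 'b"
  assumes W: "open W" "u \<in> W" and cont: "continuous_on W T"
    and P: "(P has_derivative L) (at (T u))" "inj L"
    and Q: "(Q has_derivative K) (at u)" and PT: "\<And>w. w \<in> W \<Longrightarrow> P (T w) = Q w"
  shows "T differentiable at u"
proof -
  obtain R where R: "linear R" "R \<circ> L = id"
    using linear_injective_left_inverse[OF has_derivative_linear[OF P(1)] P(2)] by blast
  have Rb: "bounded_linear R" using R linear_conv_bounded_linear by blast
  define p where "p y = R (P y)" for y
  define q where "q w = R (Q w)" for w
  have p: "(p has_derivative (\<lambda>h. h)) (at (T u))"
  proof -
    have "(p has_derivative (\<lambda>h. R (L h))) (at (T u))" unfolding p_def by (rule bounded_linear.has_derivative[OF Rb P(1)])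
    then show ?thesis using R(2) by (simp add: fun_eq_iff)
  qed
  have q: "(q has_derivative (\<lambda>h. R (K h))) (at u)" unfolding q_def by (rule bounded_linear.has_derivative[OF Rb Q])
  have pq: "p (T w) = q w" if "w \<in> W" for w using PT[OF that] by (simp add: p_def q_def)
  obtain M where M: "M > 0" "\<And>h. norm (R (K h)) \<le> norm h * M"
    using bounded_linear.pos_bounded[OF has_derivative_bounded_linear[OF q]] by blast
  have "(T has_derivative (\<lambda>h. R (K h))) (at u)"
    unfolding has_derivative_at_alt
  proof (intro conjI allI impI)
    fix e :: real assume e: "e > 0"
    \<comment> \<open>The bound 1/2 lets the error \<open>e1 * X\<close> be absorbed, which with
      \<open>e2 \<le> 1\<close> gives \<open>X \<le> 2 * (M + 1) * Y\<close>. The other bounds on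
      \<open>e1\<close> and \<open>e2\<close> each leave half of \<open>e * Y\<close> in the final
      estimate.\<close>
    define e1 where "e1 = min (1 / 2) (e / (4 * (M + 1)))"
    define e2 where "e2 = min 1 (e / 2)"
    have "e1 \<le> e / (4 * (M + 1))" unfolding e1_def by (rule min.cobounded2)
    then have pos3: "e1 * (4 * (M + 1)) \<le> e" using M(1) by (simp add: pos_le_divide_eq)
    have pos2: "e1 \<le> 1 / 2" unfolding e1_def by (rule min.cobounded1)
    have pos: "e1 > 0" "e2 > 0" "e2 \<le> 1" "e2 \<le> e / 2"
      using e M(1) by (auto simp: e1_def e2_def)
    obtain d1 where d1: "d1 > 0" "\<And>y. norm (y - T u) < d1 \<Longrightarrow> norm (p y - p (T u) - (y - T u)) \<le> e1 * norm (y - T u)"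
      using p pos(1) unfolding has_derivative_at_alt by blast
    have "continuous (at u) T" using cont W by (simp add: continuous_on_eq_continuous_at)
    then obtain d2 where d2: "d2 > 0" "\<And>w. norm (w - u) < d2 \<Longrightarrow> norm (T w - T u) < d1"
      using d1(1) unfolding continuous_at_eps_delta by (auto simp: dist_norm)
    obtain d3 where d3: "d3 > 0" "\<And>w. norm (w - u) < d3 \<Longrightarrow> norm (q w - q u - R (K (w - u))) \<le> e2 * norm (w - u)"
      using q pos(2) unfolding has_derivative_at_alt by blast
    obtain d4 where d4: "d4 > 0" "\<And>w. norm (w - u) < d4 \<Longrightarrow> w \<in> W"
      using W unfolding open_dist by (auto simp: dist_norm)
    have "norm (T w - T u - R (K (w - u))) \<le> e * norm (w - u)" if w: "norm (w - u) < Min {d2, d3, d4}" for w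
    proof -
      define X where "X = norm (T w - T u)"
      define Y where "Y = norm (w - u)"
      have XY: "X \<ge> 0" "Y \<ge> 0" by (simp_all add: X_def Y_def)
      have wW: "w \<in> W" using d4 w by simp
      have 1: "norm (q w - q u - (T w - T u)) \<le> e1 * X"
      proof -
        have "norm (T w - T u) < d1" using d2(2) w by simp
        from d1(2)[OF this] show ?thesis by (simp add: X_def pq[OF wW] pq[OF W(2)])
      qed
      have 2: "norm (q w - q u - R (K (w - u))) \<le> e2 * Y" using d3 w by (simp add: Y_def)
      have 3: "norm (R (K (w - u))) \<le> Y * M" using M(2) by (simp add: Y_def)
      have "X \<le> norm (q w - q u - (T w - T u)) + norm (q w - q u - R (K (w - u))) + norm (R (K (w - u)))"
        unfolding X_def by norm
      also have "\<dots> \<le> (1 / 2) * X + 1 * Y + Y * M"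
        using 1 2 3 mult_right_mono[OF pos2 XY(1)] mult_right_mono[OF pos(3) XY(2)] by linarith
      finally have X: "X \<le> 2 * (M + 1) * Y" by (simp add: algebra_simps)
      have "norm (T w - T u - R (K (w - u))) \<le> norm (q w - q u - (T w - T u)) + norm (q w - q u - R (K (w - u)))"
        by norm
      also have "\<dots> \<le> e1 * (2 * (M + 1) * Y) + (e / 2) * Y"
        using 1 2 mult_left_mono[OF X less_imp_le[OF pos(1)]] mult_right_mono[OF pos(4) XY(2)] by linarith
      also have "e1 * (2 * (M + 1) * Y) = (e1 * (4 * (M + 1))) * Y / 2" by simp
      also have "\<dots> \<le> e * Y / 2" using mult_right_mono[OF pos3 XY(2)] by simp
      finally show ?thesis by (simp add: Y_def field_simps)
    qed
    then show "\<exists>d>0. \<forall>y. norm (y - u) < d \<longrightarrow> norm (T y - T u - R (K (y - u))) \<le> e * norm (y - u)"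
      using d2(1) d3(1) d4(1) by (intro exI[of _ "Min {d2, d3, d4}"]) auto
  qed (rule has_derivative_bounded_linear[OF q])
  then show ?thesis by (auto simp: differentiable_def)
qed

lemma chart_inv_in: "u \<in> chart_image \<kappa> \<Longrightarrow> chart_inv \<kappa> u \<in> fst \<kappa>"
  by (simp add: chart_image_def chart_inv_def inv_into_into)

lemma chart_inv_snd: "inj_on (snd \<kappa>) (fst \<kappa>) \<Longrightarrow> q \<in> fst \<kappa> \<Longrightarrow> chart_inv \<kappa> (snd \<kappa> q) = q"
  by (simp add: chart_inv_def)

lemma submanifold_atlas_domain:
  assumes "\<kappa> \<in> submanifold_atlas B \<B> S"
  shows "fst \<kappa> \<subseteq> S" "fst \<kappa> \<subseteq> topspace (atlas_topology B \<B>)"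
  using assms openin_subset[of "subtopology (atlas_topology B \<B>) S" "fst \<kappa>"] unfolding submanifold_atlas_def by auto

lemma submanifold_atlas_inj:
  assumes "\<kappa> \<in> submanifold_atlas B \<B> S"
  shows "inj_on (snd \<kappa>) (fst \<kappa>)"
proof -
  have "homeomorphic_map (subtopology (atlas_topology B \<B>) (fst \<kappa>)) (top_of_set (chart_image \<kappa>)) (snd \<kappa>)"
    using assms by (simp add: submanifold_atlas_def)
  from homeomorphic_imp_injective_map[OF this] show ?thesis
    using submanifold_atlas_domain(2)[OF assms] by (simp add: Int_absorb1)
qed

lemma submanifold_transition_continuous:
  assumes \<kappa>: "\<kappa> \<in> submanifold_atlas B \<B> S" and \<mu>: "\<mu> \<in> submanifold_atlas B \<B> S"
  shows "open (snd \<kappa> ` (fst \<kappa> \<inter> fst \<mu>))" "continuous_on (snd \<kappa> ` (fst \<kappa> \<inter> fst \<mu>)) (transition \<kappa> \<mu>)"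
proof -
  define X where "X = atlas_topology B \<B>"
  let ?W = "snd \<kappa> ` (fst \<kappa> \<inter> fst \<mu>)"
  have k: "open (chart_image \<kappa>)" "homeomorphic_map (subtopology X (fst \<kappa>)) (top_of_set (chart_image \<kappa>)) (snd \<kappa>)"
    and m: "openin (subtopology X S) (fst \<mu>)" "homeomorphic_map (subtopology X (fst \<mu>)) (top_of_set (chart_image \<mu>)) (snd \<mu>)"
    using \<kappa> \<mu> by (auto simp: submanifold_atlas_def X_def)
  note sub = submanifold_atlas_domain[OF \<kappa>, folded X_def] submanifold_atlas_domain[OF \<mu>, folded X_def]
  \<comment> \<open>The domain of \<open>\<mu>\<close> is open in \<open>S\<close> and thus meets
    the domain of \<open>\<kappa>\<close> in a relatively open set, which the homeomorphism
    \<open>snd \<kappa>\<close> carries to an open set.\<close>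
  obtain O' where "openin X O'" "fst \<mu> = O' \<inter> S" using m(1) by (auto simp: openin_subtopology)
  then have "openin (subtopology X (fst \<kappa>)) (fst \<kappa> \<inter> fst \<mu>)"
    using sub(1) by (auto simp: openin_subtopology)
  then have "openin (top_of_set (chart_image \<kappa>)) ?W"
    using homeomorphic_imp_open_map[OF k(2)] by (simp add: open_map_def)
  then show "open ?W" using k(1) by (simp add: openin_open_eq)
  obtain g where g: "homeomorphic_maps (subtopology X (fst \<kappa>)) (top_of_set (chart_image \<kappa>)) (snd \<kappa>) g"
    using k(2) homeomorphic_map_maps by blast
  have g_eq: "g (snd \<kappa> q) = q" if "q \<in> fst \<kappa>" for q
    using g sub(2) that by (auto simp: homeomorphic_maps_def)
  have "continuous_map (top_of_set (chart_image \<kappa>)) (subtopology X (fst \<kappa>)) g"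
    using g by (simp add: homeomorphic_maps_def)
  then have "continuous_map (top_of_set ?W) X g"
    by (intro continuous_map_from_subtopology_mono[of euclidean "chart_image \<kappa>" X g ?W])
      (auto simp: continuous_map_in_subtopology chart_image_def)
  moreover have "g ` ?W \<subseteq> fst \<mu>" using g_eq by auto
  ultimately have "continuous_map (top_of_set ?W) (subtopology X (fst \<mu>)) g"
    by (auto simp: continuous_map_in_subtopology)
  moreover have "continuous_map (subtopology X (fst \<mu>)) euclidean (snd \<mu>)"
    using homeomorphic_imp_continuous_map[OF m(2)] by (simp add: continuous_map_in_subtopology)
  ultimately have "continuous_on ?W (snd \<mu> \<circ> g)"
    using continuous_map_compose by fastforce
  moreover have "(snd \<mu> \<circ> g) w = transition \<kappa> \<mu> w" if "w \<in> ?W" for w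
    using that g_eq chart_inv_snd[OF submanifold_atlas_inj[OF \<kappa>]] by (auto simp: transition_def)
  ultimately show "continuous_on ?W (transition \<kappa> \<mu>)" by (simp cong: continuous_on_cong)
qed

text \<open>Over an ambient chart \<open>b\<close> that covers the domain of \<open>\<mu>\<close>,
  the inverse of \<open>\<mu>\<close> is an immersion, and its composition with the transition map
  is the smooth map \<open>transition \<kappa> b\<close>.\<close>

lemma submanifold_transition_differentiable:
  assumes \<kappa>: "\<kappa> \<in> submanifold_atlas B \<B> S" and \<mu>: "\<mu> \<in> submanifold_atlas B \<B> S"
    and q: "q \<in> fst \<kappa> \<inter> fst \<mu>"
  shows "transition \<kappa> \<mu> differentiable at (snd \<kappa> q)"
proof -
  obtain b where b: "b \<in> \<B>" "fst \<mu> \<subseteq> fst b" using \<mu> by (auto simp: submanifold_atlas_def)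
  note inj = chart_inv_snd[OF submanifold_atlas_inj[OF \<kappa>]] chart_inv_snd[OF submanifold_atlas_inj[OF \<mu>]]
  have Tq: "transition \<kappa> \<mu> (snd \<kappa> q) = snd \<mu> q" using q inj by (simp add: transition_def)
  have sm: "smooth_on (snd \<kappa> ` (fst \<kappa> \<inter> fst b)) (transition \<kappa> b)"
    "smooth_on (snd \<mu> ` (fst \<mu> \<inter> fst b)) (transition \<mu> b)"
    and imm: "inj (frechet_derivative (transition \<mu> b) (at (snd \<mu> q)))"
    using \<kappa> \<mu> b q by (auto simp: submanifold_atlas_def)
  show ?thesis
  proof (rule differentiable_of_comp_immersion[OF submanifold_transition_continuous(1)[OF \<kappa> \<mu>] _
        submanifold_transition_continuous(2)[OF \<kappa> \<mu>]])
    show "(transition \<mu> b has_derivative frechet_derivative (transition \<mu> b) (at (snd \<mu> q))) (at (transition \<kappa> \<mu> (snd \<kappa> q)))"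
      unfolding Tq by (rule smooth_on_imp_has_derivative[OF sm(2)]) (use q b in auto)
    show "(transition \<kappa> b has_derivative frechet_derivative (transition \<kappa> b) (at (snd \<kappa> q))) (at (snd \<kappa> q))"
      by (rule smooth_on_imp_has_derivative[OF sm(1)]) (use q b in auto)
    show "transition \<mu> b (transition \<kappa> \<mu> w) = transition \<kappa> b w" if "w \<in> snd \<kappa> ` (fst \<kappa> \<inter> fst \<mu>)" for w
      using that inj by (auto simp: transition_def)
  qed (use q imm in auto)
qed

text \<open>Where a map is not differentiable, \<open>frechet_derivative\<close> is an arbitrary
  function and may move 0. Even the zero vector therefore requires differentiable transition
  maps.\<close>

lemma zero_in_tangent_space:
  "(\<lambda>\<kappa>. 0) \<in> tangent_space (submanifold_atlas B \<B> S) q"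
proof -
  have "frechet_derivative (transition \<kappa> \<mu>) (at (snd \<kappa> q)) 0 = 0"
    if "\<kappa> \<in> submanifold_atlas B \<B> S" "\<mu> \<in> submanifold_atlas B \<B> S" "q \<in> fst \<kappa> \<inter> fst \<mu>" for \<kappa> \<mu>
    by (rule linear_0[OF linear_frechet_derivative[OF submanifold_transition_differentiable[OF that]]])
  then show ?thesis unfolding tangent_space_def by (simp, blast)
qed

section \<open>The contact Riemannian curl of the sphere bundle\<close>

lemma sphere_chart_sphere_inclusion:
  fixes M :: "'a set"
    and \<A> :: "('a, real^'n) chart set"
    and g :: "('a, real^'n) chart \<Rightarrow> real^'n \<Rightarrow> real^'n^'n"
    and \<kappa> :: "(('a, real^'n) tangent_point, real^'m) chart"
  assumes M: "smooth_manifold M \<A>" and g: "riemannian_metric \<A> g"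
    and card: "CARD('m) = 2 * CARD('n) - 1"
    and \<kappa>: "\<kappa> \<in> sphere_atlas M \<A> g"
  shows "sphere_chart (g (base_chart M \<A> \<kappa>)) (chart_image (base_chart M \<A> \<kappa>))
    (sphere_inclusion M \<A> \<kappa>) (chart_image \<kappa>)"
proof -
  define c where "c = base_chart M \<A> \<kappa>"
  define b where "b = bundle_chart M \<A> c"
  note \<kappa>' = \<kappa>[unfolded sphere_atlas_def]
  have "\<exists>c. c \<in> \<A> \<and> fst \<kappa> \<subseteq> fst (bundle_chart M \<A> c)"
    using \<kappa>' by (auto simp: submanifold_atlas_def bundle_atlas_def)
  from someI_ex[OF this] have c: "c \<in> \<A>" "fst \<kappa> \<subseteq> fst b"
    unfolding b_def c_def base_chart_def by auto
  have b: "b \<in> bundle_atlas M \<A>" using c by (simp add: b_def bundle_atlas_def)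
  have F: "sphere_inclusion M \<A> \<kappa> = transition \<kappa> b" by (simp add: sphere_inclusion_def b_def c_def)
  have img: "snd \<kappa> ` (fst \<kappa> \<inter> fst b) = chart_image \<kappa>"
    using c by (simp add: chart_image_def Int_absorb2)
  have imm: "smooth_on (snd \<kappa> ` (fst \<kappa> \<inter> fst b)) (transition \<kappa> b)"
    "\<forall>u \<in> snd \<kappa> ` (fst \<kappa> \<inter> fst b). inj (frechet_derivative (transition \<kappa> b) (at u))"
    using \<kappa>' b unfolding submanifold_atlas_def by blast+
  have point: "fst (transition \<kappa> b u) \<in> chart_image c"
    "snd (transition \<kappa> b u) \<bullet> (g c (fst (transition \<kappa> b u)) *v snd (transition \<kappa> b u)) = 1"
    if u: "u \<in> chart_image \<kappa>" for u
  proof -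
    obtain p v where z: "chart_inv \<kappa> u = (p, v)" by force
    have "(p, v) \<in> fst \<kappa>" using chart_inv_in[OF u] z by simp
    then have "(p, v) \<in> sphere_bundle M \<A> g" "p \<in> fst c"
      using submanifold_atlas_domain(1)[OF \<kappa>'] c(2) by (auto simp: b_def bundle_chart_def)
    moreover have "transition \<kappa> b u = (snd c p, v c)" by (simp add: transition_def z b_def bundle_chart_def)
    ultimately show "fst (transition \<kappa> b u) \<in> chart_image c"
      "snd (transition \<kappa> b u) \<bullet> (g c (fst (transition \<kappa> b u)) *v snd (transition \<kappa> b u)) = 1"
      using c(1) by (auto simp: chart_image_def sphere_bundle_def inner_vec_def matrix_vector_mult_def
          sum_distrib_left mult_ac)
  qed
  show ?thesis
    unfolding F c_def[symmetric]
  proof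
    show "open (chart_image c)" using M c by (auto simp: smooth_manifold_def smooth_atlas_def)
    show "open (chart_image \<kappa>)" using \<kappa>' by (simp add: submanifold_atlas_def)
    show "smooth_on (chart_image \<kappa>) (transition \<kappa> b)"
      using imm img by simp
    show "inj (frechet_derivative (transition \<kappa> b) (at u))" if "u \<in> chart_image \<kappa>" for u
      using imm img that by blast
  qed (use g c point card in \<open>auto simp: riemannian_metric_def\<close>)
qed

theorem theorem5p1p1:
  fixes M :: "'a set"
    and \<A> :: "('a, real^'n) chart set"
    and g :: "('a, real^'n) chart \<Rightarrow> real^'n \<Rightarrow> real^'n^'n"
  assumes "smooth_manifold M \<A>"
    and "riemannian_metric \<A> g"
    and "CARD('n) \<ge> 2"
    and "CARD('m::finite) = 2 * CARD('n) - 1"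
  shows "(\<forall>\<kappa> \<in> (sphere_atlas M \<A> g :: (('a, real^'n) tangent_point, real^'m) chart set).
            \<forall>u \<in> chart_image \<kappa>.
              contact_curl_density (CARD('n) - 1) (sphere_metric M \<A> g \<kappa>)
                (sphere_contact_form M \<A> g \<kappa>) u = 0) \<and>
         (\<forall>X :: ('a, real^'n) tangent_point \<Rightarrow> (('a, real^'n) tangent_point, real^'m) chart \<Rightarrow> real^'m.
            is_contact_riemannian_curl (CARD('n) - 1) (sphere_bundle M \<A> g) (sphere_atlas M \<A> g)
              (sphere_contact_form M \<A> g) (sphere_metric M \<A> g) X \<longleftrightarrow>
            (\<forall>q \<in> sphere_bundle M \<A> g. X q = (\<lambda>\<kappa>. 0)))"
proof -
  let ?N = "sphere_bundle M \<A> g" and ?l = "CARD('n) - 1"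
  let ?\<theta> = "sphere_contact_form M \<A> g" and ?h = "sphere_metric M \<A> g"
  let ?\<N> = "sphere_atlas M \<A> g :: (('a, real^'n) tangent_point, real^'m) chart set"
  note chart = sphere_chart_sphere_inclusion[OF assms(1,2,4)]
  have \<theta>: "?\<theta> \<kappa> = sphere_chart.theta (g (base_chart M \<A> \<kappa>)) (sphere_inclusion M \<A> \<kappa>)" if "\<kappa> \<in> ?\<N>" for \<kappa>
    by (simp add: sphere_chart.theta_def[OF chart[OF that]] sphere_contact_form_def Let_def fun_eq_iff)
  have h: "?h \<kappa> = sphere_chart.metr (g (base_chart M \<A> \<kappa>)) (sphere_inclusion M \<A> \<kappa>)" if "\<kappa> \<in> ?\<N>" for \<kappa>
    by (simp add: sphere_chart.metr_def[OF chart[OF that]] sphere_metric_def Let_def fun_eq_iff)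
  have density: "contact_curl_density ?l (?h \<kappa>) (?\<theta> \<kappa>) u = 0" if "\<kappa> \<in> ?\<N>" "u \<in> chart_image \<kappa>" for \<kappa> u
    unfolding \<theta>[OF that(1)] h[OF that(1)]
    by (rule sphere_chart.contact_curl_density_eq_0[OF chart[OF that(1)] that(2)])
  have dom: "fst \<kappa> \<subseteq> ?N" and inj: "inj_on (snd \<kappa>) (fst \<kappa>)" and op: "open (chart_image \<kappa>)" if "\<kappa> \<in> ?\<N>" for \<kappa>
    using submanifold_atlas_domain(1)[OF that[unfolded sphere_atlas_def]]
      submanifold_atlas_inj[OF that[unfolded sphere_atlas_def]] that
    by (auto simp: sphere_atlas_def submanifold_atlas_def)
  have "X q = (\<lambda>\<kappa>. 0)" if X: "is_contact_riemannian_curl ?l ?N ?\<N> ?\<theta> ?h X" and q: "q \<in> ?N" for X q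
  proof
    fix \<kappa>
    have vf: "vector_field ?N ?\<N> X"
      and flow: "\<And>\<kappa> u. \<kappa> \<in> ?\<N> \<Longrightarrow> u \<in> chart_image \<kappa> \<Longrightarrow> \<exists>\<epsilon> V \<Phi>.
        u \<in> V \<and> local_flow (chart_image \<kappa>) (field_components X \<kappa>) \<epsilon> V \<Phi> \<and>
        (\<forall>t\<in>{-\<epsilon><..<\<epsilon>}. \<forall>w\<in>V.
           frechet_derivative (\<Phi> t) (at w) ` form_kernel (?\<theta> \<kappa> w) = form_kernel (?\<theta> \<kappa> (\<Phi> t w)))"
      and eq: "\<And>\<kappa> u. \<kappa> \<in> ?\<N> \<Longrightarrow> u \<in> chart_image \<kappa> \<Longrightarrow>
        (?\<theta> \<kappa> u \<bullet> field_components X \<kappa> u) * vol_power ?l (?\<theta> \<kappa>) u = contact_curl_density ?l (?h \<kappa>) (?\<theta> \<kappa>) u"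
      using X by (auto simp: is_contact_riemannian_curl_def contact_vector_field_def)
    show "X q \<kappa> = 0"
    \<comment> \<open>Components in charts that do not contain \<open>q\<close> are 0 by the
      convention in \<open>tangent_space\<close>; the geometry is needed only for charts around
      \<open>q\<close>.\<close>
    proof (cases "\<kappa> \<in> ?\<N> \<and> q \<in> fst \<kappa>")
      case False
      have "X q \<in> tangent_space ?\<N> q" using vf q by (simp add: vector_field_def)
      with False show ?thesis unfolding tangent_space_def by blast
    next
      case True
      then have \<kappa>: "\<kappa> \<in> ?\<N>" and u: "snd \<kappa> q \<in> chart_image \<kappa>" by (auto simp: chart_image_def)
      interpret sphere_chart "g (base_chart M \<A> \<kappa>)" "chart_image (base_chart M \<A> \<kappa>)"
        "sphere_inclusion M \<A> \<kappa>" "chart_image \<kappa>" by (rule chart[OF \<kappa>])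
      obtain \<epsilon> V \<Phi> where f: "snd \<kappa> q \<in> V" "local_flow (chart_image \<kappa>) (field_components X \<kappa>) \<epsilon> V \<Phi>"
        "\<And>t w. t \<in> {-\<epsilon><..<\<epsilon>} \<Longrightarrow> w \<in> V \<Longrightarrow>
          frechet_derivative (\<Phi> t) (at w) ` form_kernel (theta w) = form_kernel (theta (\<Phi> t w))"
        using flow[OF \<kappa> u] unfolding \<theta>[OF \<kappa>] by blast
      \<comment> \<open>The curl density is 0 and the power of vol is not, so \<open>X\<close> lies
        in the contact hyperplanes.\<close>
      have "field_components X \<kappa> (snd \<kappa> q) = 0"
      proof (rule contact_field_in_hyperplane_eq_0[OF _ _ f(2,1) f(3)])
        show "smooth_on (chart_image \<kappa>) (field_components X \<kappa>)"
          using vf \<kappa> by (simp add: vector_field_def)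
        show "theta w \<bullet> field_components X \<kappa> w = 0" if "w \<in> chart_image \<kappa>" for w
          using eq[OF \<kappa> that] density[OF \<kappa> that] vol_power_theta_nonzero[OF that] unfolding \<theta>[OF \<kappa>] by simp
      qed
      then show ?thesis
        using True chart_inv_snd[OF inj[OF \<kappa>]] by (simp add: field_components_def)
    qed
  qed
  moreover have "is_contact_riemannian_curl ?l ?N ?\<N> ?\<theta> ?h X" if X: "\<And>q. q \<in> ?N \<Longrightarrow> X q = (\<lambda>\<kappa>. 0)" for X
  proof -
    have X0: "field_components X \<kappa> u = 0" if "\<kappa> \<in> ?\<N>" "u \<in> chart_image \<kappa>" for \<kappa> u
      using X[OF subsetD[OF dom[OF that(1)] chart_inv_in[OF that(2)]]] by (simp add: field_components_def)
    have "vector_field ?N ?\<N> X"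
      unfolding vector_field_def
    proof (intro conjI ballI)
      show "X q \<in> tangent_space ?\<N> q" if "q \<in> ?N" for q
        unfolding X[OF that] sphere_atlas_def by (rule zero_in_tangent_space)
      show "smooth_on (chart_image \<kappa>) (field_components X \<kappa>)" if "\<kappa> \<in> ?\<N>" for \<kappa>
        by (rule smooth_on_cong[OF op[OF that], of "\<lambda>_. 0"]) (use X0[OF that] Ck_on_const in \<open>auto simp: smooth_on_def\<close>)
    qed
    \<comment> \<open>The zero field has the stationary flow, defined on the whole chart; the time
      bound 1 is an arbitrary positive number.\<close>
    moreover have "local_flow (chart_image \<kappa>) (field_components X \<kappa>) 1 (chart_image \<kappa>) (\<lambda>t w. w)"
      if "\<kappa> \<in> ?\<N>" for \<kappa>
      unfolding local_flow_def using op[OF that] X0[OF that]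
      by (auto intro!: smooth_on_bounded_linear bounded_linear_snd simp: case_prod_beta')
    moreover have "frechet_derivative (\<lambda>w. w) (at w) ` K = K" for w :: "real^'m" and K by simp
    ultimately have "contact_vector_field ?N ?\<N> ?\<theta> X"
      unfolding contact_vector_field_def by blast
    then show ?thesis
      unfolding is_contact_riemannian_curl_def using X0 density by simp
  qed
  ultimately show ?thesis using density by blast
qed

end
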